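(* Let $C$ be the plane affine curve over $\mathbb{R}$ with equation $x_1^2+x_2^2=1$, so $\mathbb{R}[C]=\mathbb{R}[x_1,x_2]/(x_1^2+x_2^2-1)$, and let $V=C\times\mathbb{A}^1$, so $\mathbb{R}[V]=\mathbb{R}[C][y]$ and $V(\mathbb{R})=C(\mathbb{R})\times\mathbb{R}$. Then every $f\in\mathbb{R}[V]$ with $f\ge0$ on $V(\mathbb{R})$ is a sum of squares in $\mathbb{R}[V]$. *)

theory Defs
  imports "HOL-Computational_Algebra.Polynomial"
begin

text \<open>The polynomial ring R[x1,x2,y] is modelled as real poly poly poly:
  the outermost variable is y, the middle one x2, the innermost one x1.\<close>

type_synonym rpoly3 = "real poly poly poly"

definition X1 :: rpoly3 where "X1 = [:[:[:0, 1:]:]:]"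
definition X2 :: rpoly3 where "X2 = [:[:0, 1:]:]"

definition eval3 :: "rpoly3 \<Rightarrow> real \<Rightarrow> real \<Rightarrow> real \<Rightarrow> real" where
  "eval3 p a b t = poly (poly (poly p [:[:t:]:]) [:b:]) a"

definition circle_eq :: rpoly3 where "circle_eq = X1^2 + X2^2 - 1"

text \<open>p represents an element of R[V] = R[x1,x2,y]/(x1^2+x2^2-1) which is a sum of squares
  in R[V]: p is congruent modulo the ideal (circle_eq) to a finite sum of squares.\<close>
definition sos_mod_circle :: "rpoly3 \<Rightarrow> bool" where
  "sos_mod_circle p \<longleftrightarrow> (\<exists>gs :: rpoly3 list. circle_eq dvd (p - sum_list (map (\<lambda>g. g^2) gs)))"

end

theory Submission
  imports Defs "HOL-Analysis.Analysis" "HOL-Real_Asymp.Real_Asymp"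
    "HOL-Computational_Algebra.Computational_Algebra" "HOL-Computational_Algebra.Field_as_Ring"
begin

text \<open>
  The circle is parametrised by \<open>t \<mapsto> ((1 - t\<^sup>2) / (1 + t\<^sup>2), 2 t / (1 + t\<^sup>2))\<close>. This turns the claim
  into the statement that every \<open>P \<in> \<real>[t][y]\<close> which is nonnegative on the plane becomes a sum of
  squares after multiplication with a power of \<open>1 + t\<^sup>2\<close>. Induction on the degree in \<open>y\<close> removes square
  factors; otherwise \<open>P\<close> and its derivative in \<open>y\<close> generate a nonzero \<open>r(t)\<close>, and this gives a bound
  \<open>f \<ge> \<epsilon> A (1 + y\<^sup>2)\<^sup>d\<close> for the corresponding function \<open>f\<close> on the cylinder, where \<open>A \<ge> 0\<close> depends on
  the point of the circle only and has finitely many zeros.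

  At such a zero, \<open>f\<^sub>1 = f - \<epsilon> A (1 + y\<^sup>2)\<^sup>d / 2\<close> has no real branch, so by Newton-Puiseux it factors over
  the complex power series as \<open>h\<close> times its conjugate. It is thus a sum of two squares to any order, and the
  Chinese remainder theorem gives \<open>f\<^sub>1 = u\<^sup>2 + v\<^sup>2 + A\<^sup>2 Q\<close>. With \<open>\<phi> = (1 - c A)\<^sup>K\<close> and \<open>1 - \<phi> = A \<chi>\<close>,
    \<open>f = \<phi> (u\<^sup>2 + v\<^sup>2) + A (\<chi> f\<^sub>1 + \<phi> A Q + \<epsilon> (1 + y\<^sup>2)\<^sup>d / 2)\<close>,
  and for large \<open>K\<close> the last bracket is at least a positive multiple of \<open>(1 + y\<^sup>2)\<^sup>d\<close>. A function with
  this property is a sum of squares: approximate it by a partition of unity with squares of polynomials,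
  and absorb the small error.
\<close>

section \<open>Hensel's lemma over formal power series\<close>

text \<open>Stone-Weierstrass alone handles only functions bounded below by a positive multiple of
  \<open>(1 + y\<^sup>2) ^ d\<close>. This weight measures positivity uniformly up to y = infinity,
  so zeros of the leading coefficient obstruct as much as zeros of f. The Lojasiewicz bound confines
  both obstructions to finitely many fibres of the cylinder, where approximation has no room and an
  exact algebraic expression is needed. Only half of the lower bound is removed to form f1: the half
  kept in f1 excludes real branches, the half removed pays for all later errors. The congruence is
  taken modulo A^2 rather than A because, once one A is factored out, the error
  \<open>\<phi> A Q\<close> still carries an A, and \<open>A (1 - c A) ^ K\<close> tends to 0
  uniformly as K grows. The power of 1 + t^2 can be cancelled at the end because the circle is
  compact: boundedness on each slice y = const limits the t-degree of every summand. In the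
  coordinate t the point -1 lies at infinity; a rotation first ensures that the lower bound does not
  vanish there.\<close>

locale crhom =
  fixes h :: "'a::comm_ring_1 \<Rightarrow> 'b::comm_ring_1"
  assumes h_add: "h (x + y) = h x + h y"
    and h_mult: "h (x * y) = h x * h y"
    and h_1: "h 1 = 1"
begin

lemma h_0: "h 0 = 0"
  using h_add[of 0 0] by simp

lemma h_sum: "h (sum f A) = (\<Sum>i\<in>A. h (f i))"
  by (induction A rule: infinite_finite_induct) (simp_all add: h_0 h_add)

lemma h_uminus: "h (- x) = - h x"
  using h_add[of x "- x"] by (simp add: h_0 eq_neg_iff_add_eq_0 add.commute)

lemma h_diff: "h (x - y) = h x - h y"
  using h_add[of x "- y"] by (simp add: h_uminus)

lemma h_power: "h (x ^ n) = h x ^ n"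
  by (induction n) (simp_all add: h_1 h_mult)

lemma coeff_map: "coeff (map_poly h p) n = h (coeff p n)"
  by (rule coeff_map_poly) (rule h_0)

lemma map_crhom: "crhom (map_poly h)"
proof
  show "map_poly h (p + q) = map_poly h p + map_poly h q" for p q
    by (rule poly_eqI) (simp add: coeff_map h_add)
  show "map_poly h (p * q) = map_poly h p * map_poly h q" for p q
    by (rule poly_eqI) (simp add: coeff_map coeff_mult h_sum h_mult)
  show "map_poly h 1 = 1"
    using h_1 by simp
qed

lemma poly_map: "poly (map_poly h p) (h x) = h (poly p x)"
proof (induction p)
  case 0
  then show ?case by (simp add: h_0)
next
  case (pCons a p)
  then show ?case by (simp add: map_poly_pCons h_0 h_add h_mult)
qed

lemma monic_map:
  assumes "lead_coeff p = 1"
  shows "lead_coeff (map_poly h p) = 1" "degree (map_poly h p) = degree p"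
proof -
  have "coeff (map_poly h p) (degree p) = 1"
    using assms by (simp add: coeff_map h_1)
  moreover have "degree (map_poly h p) \<le> degree p"
    by (intro degree_le) (simp add: coeff_map h_0 coeff_eq_0)
  ultimately show "degree (map_poly h p) = degree p"
    by (metis le_antisym le_degree zero_neq_one)
  then show "lead_coeff (map_poly h p) = 1"
    using \<open>coeff (map_poly h p) (degree p) = 1\<close> by simp
qed

end

text \<open>The coefficient of \<open>t ^ k\<close>, a polynomial in \<open>y\<close>, of an element of \<open>R[[t]][y]\<close>.\<close>
definition tcoeff :: "nat \<Rightarrow> 'a::comm_ring_1 fps poly \<Rightarrow> 'a poly" where
  "tcoeff k F = map_poly (\<lambda>c. fps_nth c k) F"

lemma coeff_tcoeff: "coeff (tcoeff k F) j = fps_nth (coeff F j) k"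
  by (simp add: tcoeff_def coeff_map_poly)

lemma fps_poly_eqI:
  assumes "\<And>k. tcoeff k F = tcoeff k G"
  shows "F = G"
proof (rule poly_eqI, rule fps_ext)
  fix j k
  show "fps_nth (coeff F j) k = fps_nth (coeff G j) k"
    using assms[of k] by (metis coeff_tcoeff)
qed

lemma tcoeff_mult: "tcoeff k (F * G) = (\<Sum>i\<le>k. tcoeff i F * tcoeff (k - i) G)"
proof (rule poly_eqI)
  fix n
  have "coeff (tcoeff k (F * G)) n =
      (\<Sum>i\<le>n. \<Sum>l\<le>k. fps_nth (coeff F i) l * fps_nth (coeff G (n - i)) (k - l))"
    by (simp add: coeff_tcoeff coeff_mult fps_sum_nth fps_mult_nth atLeast0AtMost)
  also have "\<dots> = (\<Sum>l\<le>k. \<Sum>i\<le>n. fps_nth (coeff F i) l * fps_nth (coeff G (n - i)) (k - l))"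
    by (rule sum.swap)
  also have "\<dots> = coeff (\<Sum>i\<le>k. tcoeff i F * tcoeff (k - i) G) n"
    by (simp add: coeff_sum coeff_mult coeff_tcoeff)
  finally show "coeff (tcoeff k (F * G)) n = coeff (\<Sum>i\<le>k. tcoeff i F * tcoeff (k - i) G) n" .
qed

lemma fps_poly_of_tcoeffs:
  fixes g :: "nat \<Rightarrow> 'a::comm_ring_1 poly"
  assumes "\<And>k. degree (g k) \<le> n"
  obtains G where "\<And>k. tcoeff k G = g k"
proof
  define G where "G = (\<Sum>j\<le>n. monom (Abs_fps (\<lambda>k. coeff (g k) j)) j)"
  have "coeff G j = Abs_fps (\<lambda>k. coeff (g k) j)" for j
  proof (cases "j \<le> n")
    case True
    then show ?thesis by (simp add: G_def coeff_sum)
  next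
    case False
    then have "coeff (g k) j = 0" for k
      using assms[of k] by (intro coeff_eq_0) simp
    then show ?thesis
      using False by (simp add: G_def coeff_sum fps_eq_iff)
  qed
  then show "tcoeff k G = g k" for k
    by (intro poly_eqI) (simp add: coeff_tcoeff)
qed

text \<open>Reducing the multiplier of \<open>h\<close> modulo \<open>g\<close> bounds its degree;
  the bound on \<open>y\<close> then follows by comparing degrees in
  \<open>g * y = R - x * h\<close>. The alternative \<open>y = 0\<close> covers constant
  \<open>h\<close>.\<close>

lemma bezout_degree_bound:
  fixes g h R :: "'a::field_gcd poly"
  assumes "coprime g h" and "degree g > 0" and "degree R < degree g + degree h"
  obtains x y where "x * h + g * y = R" "degree x < degree g" "y = 0 \<or> degree y < degree h"
proof -
  obtain s t where st: "s * g + t * h = 1"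
    using assms(1) bezout_coefficients_fst_snd[of g h] by (metis coprime_iff_gcd_eq_1)
  define x where "x = (R * t) mod g"
  define y where "y = R * s + ((R * t) div g) * h"
  have "R * t = (R * t) div g * g + x"
    by (simp add: x_def)
  then have "x = R * t - (R * t) div g * g"
    by (simp add: algebra_simps)
  then have "x * h = R * t * h - (R * t) div g * g * h"
    by (simp only: left_diff_distrib)
  then have "x * h + g * y = R * (s * g + t * h)"
    by (simp add: y_def algebra_simps)
  then have eq: "x * h + g * y = R"
    by (simp add: st)
  have dx: "degree x < degree g"
    using assms(2) degree_mod_less[of g "R * t"] by (metis degree_0 less_irrefl x_def)
  have "degree y < degree h" if "y \<noteq> 0"
  proof -
    have "degree (x * h) < degree g + degree h"
      using dx by (meson add_less_cancel_right degree_mult_le le_less_trans)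
    then have "degree (R - x * h) < degree g + degree h"
      using assms(3) degree_diff_less by blast
    moreover have "R - x * h = g * y" using eq by (simp add: algebra_simps)
    moreover have "degree (g * y) = degree g + degree y"
      using that assms(2) by (intro degree_mult_eq) auto
    ultimately show ?thesis by simp
  qed
  then show ?thesis using that eq dx by blast
qed

text \<open>Comparing coefficients of t^n gives a linear Bezout equation for the n-th coefficients
  of the two factors, solvable because \<open>g0\<close> and \<open>h0\<close> are coprime. Its
  right-hand side has degree below \<open>degree F\<close>, so all corrections can be kept of
  smaller degree than \<open>g0\<close> and \<open>h0\<close>.\<close>

lemma hensel_factorization:
  fixes F :: "'a::field_gcd fps poly"
  assumes F0: "tcoeff 0 F = g0 * h0" and cop: "coprime g0 h0"
    and monic: "lead_coeff F = 1" "lead_coeff g0 = 1" "lead_coeff h0 = 1"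
    and deg: "degree F = degree g0 + degree h0" "degree g0 > 0" "degree h0 > 0"
  obtains G H where "F = G * H" "lead_coeff G = 1" "lead_coeff H = 1"
    "degree G = degree g0" "degree H = degree h0"
proof -
  \<comment> \<open>\<open>Q f n r\<close> says that \<open>r\<close> is an admissible pair of t^n
    coefficients, given the earlier pairs in \<open>f\<close>. The strict degree bounds for n > 0
    are what keeps both factors monic.\<close>
  define Q where "Q = (\<lambda>(f :: nat \<Rightarrow> 'a poly \<times> 'a poly) n r.
     if n = 0 then r = (g0, h0)
     else degree (fst r) < degree g0 \<and> degree (snd r) < degree h0 \<and>
       fst r * h0 + g0 * snd r = tcoeff n F - (\<Sum>i\<in>{0<..<n}. fst (f i) * snd (f (n - i))))"
  have "\<exists>f. \<forall>n. Q f n (f n)"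
  proof (rule dependent_wellorder_choice)
    fix r and f g :: "nat \<Rightarrow> 'a poly \<times> 'a poly" and x :: nat
    assume "\<And>y. y < x \<Longrightarrow> f y = g y"
    then have "(\<Sum>i\<in>{0<..<x}. fst (f i) * snd (f (x - i))) =
        (\<Sum>i\<in>{0<..<x}. fst (g i) * snd (g (x - i)))"
      by (intro sum.cong) auto
    then show "Q f x r = Q g x r" by (simp add: Q_def)
  next
    fix x f
    assume IH: "\<And>y. y < x \<Longrightarrow> Q f y (f y)"
    show "\<exists>r. Q f x r"
    proof (cases "x = 0")
      case False
      define R where "R = tcoeff x F - (\<Sum>i\<in>{0<..<x}. fst (f i) * snd (f (x - i)))"
      \<comment> \<open>Since \<open>F\<close> is monic, its top coefficient contributes to t^0
        only, and here x > 0.\<close>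
      have "degree (tcoeff x F) < degree F"
      proof -
        have "coeff (tcoeff x F) i = 0" if "i > degree F - 1" for i
        proof -
          have "i = degree F \<or> i > degree F" using that by linarith
          then show ?thesis
            using monic(1) False by (auto simp: coeff_tcoeff coeff_eq_0)
        qed
        then have "degree (tcoeff x F) \<le> degree F - 1" by (intro degree_le) auto
        then show ?thesis using deg by linarith
      qed
      moreover have "degree (\<Sum>i\<in>{0<..<x}. fst (f i) * snd (f (x - i))) < degree F"
      proof (rule degree_sum_less)
        fix i assume "i \<in> {0<..<x}"
        then have "i < x" "x - i < x" "i \<noteq> 0" "x - i \<noteq> 0" by auto
        then have "degree (fst (f i)) < degree g0" "degree (snd (f (x - i))) < degree h0"
          using IH[of i] IH[of "x - i"] by (auto simp: Q_def)
        then show "degree (fst (f i) * snd (f (x - i))) < degree F"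
          using degree_mult_le[of "fst (f i)" "snd (f (x - i))"] deg by linarith
      qed (use deg in simp)
      ultimately have "degree R < degree g0 + degree h0"
        unfolding R_def using degree_diff_less deg(1) by metis
      then obtain a b where "a * h0 + g0 * b = R" "degree a < degree g0" "b = 0 \<or> degree b < degree h0"
        using bezout_degree_bound[OF cop deg(2)] by metis
      then have "Q f x (a, b)"
        using False deg(3) by (auto simp: Q_def R_def)
      then show ?thesis by blast
    qed (simp add: Q_def)
  qed
  then obtain f where f: "\<And>n. Q f n (f n)" by blast
  have f0: "f 0 = (g0, h0)" using f[of 0] by (simp add: Q_def)
  have dg: "degree (fst (f n)) < degree g0" and dh: "degree (snd (f n)) < degree h0" if "n > 0" for n
    using f[of n] that by (auto simp: Q_def)
  have "degree (fst (f k)) \<le> degree g0" "degree (snd (f k)) \<le> degree h0" for k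
    using dg[of k] dh[of k] f0 by (cases "k = 0"; simp)+
  then obtain G H where G: "\<And>k. tcoeff k G = fst (f k)" and H: "\<And>k. tcoeff k H = snd (f k)"
    using fps_poly_of_tcoeffs[of "\<lambda>k. fst (f k)"] fps_poly_of_tcoeffs[of "\<lambda>k. snd (f k)"] by metis
  have "F = G * H"
  proof (rule fps_poly_eqI)
    fix k
    show "tcoeff k F = tcoeff k (G * H)"
    proof (cases "k = 0")
      case True
      then show ?thesis by (simp add: tcoeff_mult G H f0 F0)
    next
      case False
      have "{..k} = insert 0 (insert k {0<..<k})" using False by auto
      then have "tcoeff k (G * H) = g0 * snd (f k) + (fst (f k) * h0 +
          (\<Sum>i\<in>{0<..<k}. fst (f i) * snd (f (k - i))))"
        using False by (simp add: tcoeff_mult G H f0)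
      also have "\<dots> = tcoeff k F"
        using f[of k] False by (simp add: Q_def algebra_simps)
      finally show ?thesis by simp
    qed
  qed
  have lift: "lead_coeff K = 1 \<and> degree K = degree k0"
    if K0: "tcoeff 0 K = k0" and Kk: "\<And>k. k > 0 \<Longrightarrow> degree (tcoeff k K) < degree k0"
      and k0: "lead_coeff k0 = 1" for K :: "'a fps poly" and k0
  proof -
    have "fps_nth (coeff K j) k = (if j = degree k0 \<and> k = 0 then 1 else 0)" if "j \<ge> degree k0" for j k
    proof (cases "k = 0")
      case True
      then show ?thesis using k0 K0 coeff_tcoeff[of 0 K j] that coeff_eq_0[of k0 j] by auto
    next
      case False
      then show ?thesis using Kk[of k] coeff_tcoeff[of k K j] that by (simp add: coeff_eq_0)
    qed
    then have "coeff K (degree k0) = 1" "\<And>j. j > degree k0 \<Longrightarrow> coeff K j = 0"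
      by (auto simp: fps_eq_iff)
    then have "degree K = degree k0"
      by (metis degree_le le_antisym le_degree zero_neq_one)
    then show ?thesis using \<open>coeff K (degree k0) = 1\<close> by simp
  qed
  show ?thesis
    using that[OF \<open>F = G * H\<close>] lift[of G g0] lift[of H h0] G H f0 dg dh monic by force
qed

unbundle no vec_syntax

section \<open>Puiseux expansions and conjugate factorisations\<close>

text \<open>The substitution \<open>t = c s ^ e\<close>.\<close>
definition ram :: "'a::idom \<Rightarrow> nat \<Rightarrow> 'a fps \<Rightarrow> 'a fps" where
  "ram c e f = f oo (fps_const c * fps_X ^ e)"

lemma ram_nth:
  assumes "e > 0"
  shows "ram c e f $ n = (if e dvd n then c ^ (n div e) * f $ (n div e) else 0)"
proof -
  have "(fps_const c * fps_X ^ e) ^ i $ n = (if n = e * i then c ^ i else 0)" for i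
    by (simp add: power_mult_distrib fps_const_power flip: power_mult)
  then have eq: "ram c e f $ n = (\<Sum>i\<in>{0..n}. if n = e * i then f $ i * c ^ i else 0)"
    unfolding ram_def fps_compose_nth by (intro sum.cong) simp_all
  show ?thesis
  proof (cases "e dvd n")
    case True
    then obtain k where k: "n = e * k" by blast
    then have "k \<le> n" using assms by simp
    have "(\<Sum>i\<in>{0..n}. if n = e * i then f $ i * c ^ i else 0) =
        (\<Sum>i\<in>{0..n}. if i = k then f $ i * c ^ i else 0)"
      using assms k by (intro sum.cong) auto
    then show ?thesis
      using eq True \<open>k \<le> n\<close> k assms by (simp add: mult.commute)
  next
    case False
    then have "(\<Sum>i\<in>{0..n}. if n = e * i then f $ i * c ^ i else 0) = 0"
      by (intro sum.neutral) auto
    then show ?thesis using eq False by simp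
  qed
qed

lemma ram_crhom:
  assumes "e > 0"
  shows "crhom (ram (c :: 'a::idom) e)"
proof
  have "(fps_const c * fps_X ^ e) $ 0 = 0" using assms by simp
  then show "ram c e (f * g) = ram c e f * ram c e g" for f g
    unfolding ram_def by (rule fps_compose_mult_distrib)
qed (simp_all add: ram_def fps_compose_add_distrib)

lemma ram_ram:
  assumes "e > 0" "e' > 0"
  shows "ram c e (ram d e' f) = ram (d * c ^ e') (e * e') f"
proof (rule fps_ext)
  fix n
  show "ram c e (ram d e' f) $ n = ram (d * c ^ e') (e * e') f $ n"
  proof (cases "e * e' dvd n")
    case True
    then obtain k where "n = e * e' * k" by blast
    then show ?thesis
      using assms by (simp add: ram_nth mult.assoc power_mult_distrib power_mult)
  next
    case False
    then have "\<not> (e dvd n \<and> e' dvd n div e)"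
      using assms by (metis dvd_div_iff_mult mult.commute not_gr_zero)
    then show ?thesis using assms False by (simp add: ram_nth)
  qed
qed

lemma ram_1_1: "ram 1 1 f = f"
  by (rule fps_ext) (simp add: ram_nth)

lemma ram_inj:
  assumes "e > 0" "ram (1 :: 'a::idom) e f = ram 1 e g"
  shows "f = g"
proof (rule fps_ext)
  fix n
  have "ram 1 e f $ (e * n) = ram 1 e g $ (e * n)" using assms by simp
  then show "f $ n = g $ n" using assms(1) by (simp add: ram_nth)
qed

section \<open>The Newton-Puiseux theorem\<close>

lemma coeff_shift_top:
  fixes p :: "'a::comm_ring_1 poly"
  assumes "degree p \<le> n"
  shows "coeff (p \<circ>\<^sub>p [:a, 1:]) n = coeff p n"
  using assms
proof (induction p arbitrary: n)
  case (pCons b p)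
  show ?case
  proof (cases n)
    case 0
    then have "p = 0" using pCons.prems by (auto split: if_splits)
    then show ?thesis using 0 by (simp add: pcompose_pCons)
  next
    case (Suc m)
    then have "degree p \<le> m" using pCons.prems by (auto split: if_splits)
    moreover from this have "degree (p \<circ>\<^sub>p [:a, 1:]) \<le> m"
      using degree_pcompose_le[of p "[:a, 1:]"] by simp
    ultimately show ?thesis
      using pCons.IH Suc by (simp add: pcompose_pCons coeff_eq_0)
  qed
qed simp

text \<open>Serves twice in the next theorem: to choose the shift that kills the coefficient of
  y^(n-1), and to read off that coefficient of (y - \<open>\<alpha>\<close>)^n.\<close>

lemma coeff_shift_second:
  fixes p :: "'a::comm_ring_1 poly"
  assumes "degree p \<le> Suc n"
  shows "coeff (p \<circ>\<^sub>p [:a, 1:]) n = coeff p n + of_nat (Suc n) * a * coeff p (Suc n)"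
  using assms
proof (induction p arbitrary: n)
  case (pCons b p)
  then have d: "degree p \<le> n" by (auto split: if_splits)
  show ?case
  proof (cases n)
    case 0
    then show ?thesis
      using d by (auto simp: pcompose_pCons elim: degree_eq_zeroE)
  next
    case (Suc m)
    then show ?thesis
      using d pCons.IH[of m] coeff_shift_top[OF d, of a]
      by (simp add: pcompose_pCons algebra_simps)
  qed
qed simp

lemma poly_sum_upto:
  fixes p :: "'a::comm_semiring_1 poly"
  assumes "degree p \<le> n"
  shows "poly p x = (\<Sum>i\<le>n. coeff p i * x ^ i)"
  unfolding poly_altdef
  by (rule sum.mono_neutral_left) (use assms in \<open>auto simp: coeff_eq_0\<close>)

lemma poly_scaled_coeffs:
  fixes A B :: "'a::comm_ring_1 poly"
  assumes "degree A \<le> n" "degree B \<le> n" "\<And>j. j \<le> n \<Longrightarrow> coeff A j = x ^ (n - j) * coeff B j"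
  shows "poly A (x * y) = x ^ n * poly B y"
proof -
  have "poly A (x * y) = (\<Sum>j\<le>n. coeff A j * (x * y) ^ j)"
    using assms(1) by (rule poly_sum_upto)
  also have "\<dots> = (\<Sum>j\<le>n. x ^ n * (coeff B j * y ^ j))"
  proof (rule sum.cong)
    fix j assume "j \<in> {..n}"
    then have "x ^ n = x ^ (n - j) * x ^ j" by (simp flip: power_add)
    then show "coeff A j * (x * y) ^ j = x ^ n * (coeff B j * y ^ j)"
      using assms(3) \<open>j \<in> {..n}\<close> by (simp add: power_mult_distrib mult_ac)
  qed simp
  also have "\<dots> = x ^ n * poly B y"
    by (simp only: poly_sum_upto[OF assms(2)] sum_distrib_left)
  finally show ?thesis .
qed

text \<open>After the coefficient of \<open>y ^ (n - 1)\<close> has been shifted away and the smallest slope of the Newton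
  polygon has been scaled to zero, the reduction at \<open>t = 0\<close> is not an \<open>n\<close>-th power, so Hensel's lemma
  splits off a factor of smaller degree.\<close>
lemma puiseux_root:
  fixes F :: "complex fps poly"
  assumes "lead_coeff F = 1" "degree F > 0"
  shows "\<exists>e>0. \<exists>\<phi>. poly (map_poly (ram 1 e) F) \<phi> = 0"
  using assms
proof (induction "degree F" arbitrary: F rule: less_induct)
  case less
  define n where "n = degree F"
  have n: "n > 0" using less.prems n_def by simp
  \<comment> \<open>The solution of n * a + coeff F (n - 1) = 0, so that the shifted polynomial has
    no y^(n-1) term; this uses characteristic 0.\<close>
  define a where "a = - (fps_const (1 / of_nat n) * coeff F (n - 1))"
  define F1 where "F1 = F \<circ>\<^sub>p [:a, 1:]"
  have dF1: "degree F1 = n" and lF1: "coeff F1 n = 1"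
    using less.prems n_def by (simp_all add: F1_def degree_pcompose coeff_shift_top)
  have "of_nat n * (fps_const (1 / of_nat n) :: complex fps) = 1"
    using n by (simp flip: fps_of_nat)
  then have "coeff F1 (n - 1) = 0"
    using coeff_shift_second[of F "n - 1" a] n less.prems
    by (simp add: F1_def a_def n_def flip: mult.assoc)
  have shift: "\<exists>e>0. \<exists>\<phi>. poly (map_poly (ram 1 e) F) \<phi> = 0"
    if "e > 0" "poly (map_poly (ram 1 e) F1) \<phi> = 0" for e \<phi>
  proof -
    interpret crhom "ram (1::complex) e" using ram_crhom that by blast
    have "map_poly (ram 1 e) (p \<circ>\<^sub>p [:a, 1:]) = map_poly (ram 1 e) p \<circ>\<^sub>p [:ram 1 e a, 1:]" for p
    proof (induction p)
      case (pCons b p)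
      interpret m: crhom "map_poly (ram (1::complex) e)" by (rule map_crhom)
      show ?case
        using pCons by (simp add: pcompose_pCons m.h_add m.h_mult map_poly_pCons map_poly_smult h_mult h_0 h_1)
    qed simp
    then have "poly (map_poly (ram 1 e) F) (ram 1 e a + \<phi>) = 0"
      using that(2) by (simp add: F1_def poly_pcompose)
    then show ?thesis using that(1) by blast
  qed
  define S where "S = {j. j < n \<and> coeff F1 j \<noteq> 0}"
  show ?case
  proof (cases "S = {}")
    case True
    have "poly F1 0 = 0"
      using True n by (auto simp: S_def poly_0_coeff_0)
    moreover have "map_poly (ram 1 1) F1 = F1"
      by (rule map_poly_idI) (rule ram_1_1)
    ultimately show ?thesis using shift[of 1 0] by simp
  next
    case False
    \<comment> \<open>The slope of the line from (n, 0) to the Newton point of y^j. The minimal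
      slope is p / q with q = n - j0, not necessarily in lowest terms.\<close>
    define \<rho> where "\<rho> j = real (subdegree (coeff F1 j)) / real (n - j)" for j
    have "finite S" by (simp add: S_def)
    then obtain j0 where j0: "j0 \<in> S" "\<And>j. j \<in> S \<Longrightarrow> \<rho> j0 \<le> \<rho> j"
      using False ex_is_arg_min_if_finite[of S \<rho>] by (auto simp: is_arg_min_linorder)
    define p where "p = subdegree (coeff F1 j0)"
    define q where "q = n - j0"
    have q: "q > 0" using j0 by (simp add: S_def q_def)
    have slope: "p * (n - j) \<le> q * subdegree (coeff F1 j)" if "j \<in> S" for j
    proof -
      have "n - j > 0" using that by (simp add: S_def)
      then have "real p * real (n - j) \<le> real q * real (subdegree (coeff F1 j))"
        using j0(2)[OF that] q by (simp add: \<rho>_def p_def q_def field_simps)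
      then show ?thesis by (metis of_nat_le_iff of_nat_mult)
    qed
    \<comment> \<open>\<open>F1\<close> after t = s^q and y = s^p * y, divided by s^(p n).
      Minimality of the slope ensures that \<open>fps_shift\<close> cuts off only zeros, which is
      \<open>rel\<close>.\<close>
    define G where "G = (\<Sum>j\<le>n. monom (fps_shift (p * (n - j)) (ram 1 q (coeff F1 j))) j)"
    have cG: "coeff G j = (if j \<le> n then fps_shift (p * (n - j)) (ram 1 q (coeff F1 j)) else 0)" for j
      by (simp add: G_def coeff_sum)
    have Gn: "coeff G n = 1"
      using lF1 ram_crhom[OF q, of "1::complex"] by (simp add: cG crhom.h_1)
    then have dG: "degree G = n"
      by (intro le_antisym degree_le le_degree) (auto simp: cG)
    have rel: "ram 1 q (coeff F1 j) = (fps_X ^ p) ^ (n - j) * coeff G j" if "j \<le> n" for j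
    proof (rule fps_ext)
      fix k
      have "ram 1 q (coeff F1 j) $ k = 0" if "k < p * (n - j)"
      proof (cases "j \<in> S")
        case True
        have "k div q < subdegree (coeff F1 j)" if "q dvd k"
          using slope[OF True] \<open>k < p * (n - j)\<close> that q
          by (metis dvd_mult_div_cancel leI le_trans mult_le_mono2 not_le)
        then have "coeff F1 j $ (k div q) = 0" if "q dvd k"
          using that nth_less_subdegree_zero by blast
        then show ?thesis by (simp add: ram_nth[OF q])
      next
        case False
        then have "j = n \<or> coeff F1 j = 0" using \<open>j \<le> n\<close> by (auto simp: S_def)
        then show ?thesis
        proof
          assume "coeff F1 j = 0"
          then show ?thesis by (simp add: ram_def)
        qed (use that in simp)
      qed
      then show "ram 1 q (coeff F1 j) $ k = ((fps_X ^ p) ^ (n - j) * coeff G j) $ k"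
        using \<open>j \<le> n\<close> by (simp add: cG fps_X_power_mult_nth flip: power_mult)
    qed
    define g where "g = tcoeff 0 G"
    have cg: "coeff g j = coeff G j $ 0" for j by (simp add: g_def coeff_tcoeff)
    have gn: "coeff g n = 1" by (simp add: cg Gn)
    then have dg: "degree g = n"
      using dG by (intro le_antisym degree_le le_degree) (auto simp: cg coeff_eq_0)
    \<comment> \<open>The point j0 lies on the edge of minimal slope: the order of its coefficient
      after ramification is exactly p * q, the amount that is shifted away.\<close>
    have gj0: "coeff g j0 \<noteq> 0"
    proof -
      have "j0 < n" "coeff F1 j0 \<noteq> 0" using j0 by (auto simp: S_def)
      then show ?thesis
        using q by (simp add: cg cG ram_nth p_def flip: q_def)
    qed
    have gn1: "coeff g (n - 1) = 0"
      using \<open>coeff F1 (n - 1) = 0\<close> n by (simp add: cg cG ram_def)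
    have "\<not> constant (poly g)" using dg n by (simp add: constant_degree)
    then obtain \<alpha> where \<alpha>: "poly g \<alpha> = 0" using fundamental_theorem_of_algebra by blast
    have "g \<noteq> 0" using gn by auto
    define m where "m = order \<alpha> g"
    obtain h where h: "g = [:- \<alpha>, 1:] ^ m * h" "\<not> [:- \<alpha>, 1:] dvd h"
      using order_decomp[OF \<open>g \<noteq> 0\<close>] m_def by blast
    have "m > 0" using \<alpha> \<open>g \<noteq> 0\<close> by (simp add: m_def order_root)
    have "h \<noteq> 0" using h(2) by auto
    have dm: "degree ([:- \<alpha>, 1:] ^ m) = m" by (simp add: degree_linear_power)
    have lm: "lead_coeff ([:- \<alpha>, 1:] ^ m) = 1" by (simp add: lead_coeff_power)
    have dh: "n = m + degree h"
      using h(1) dg dm \<open>h \<noteq> 0\<close> by (metis degree_mult_eq power_eq_0_iff pCons_eq_0_iff zero_neq_one)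
    have lh: "lead_coeff h = 1"
      using h(1) gn dg lm by (metis lead_coeff_mult mult_1)
    \<comment> \<open>Otherwise g = (y - \<open>\<alpha>\<close>)^n. The missing y^(n-1) term forces
      \<open>\<alpha>\<close> = 0, so g = y^n, against \<open>gj0\<close>.\<close>
    have "degree h > 0"
    proof (rule ccontr)
      assume "\<not> degree h > 0"
      then obtain c where "h = [:c:]" by (auto elim: degree_eq_zeroE)
      then have "h = 1" using lh by (simp add: one_pCons)
      then have g_pow: "g = [:- \<alpha>, 1:] ^ n" using h(1) dh by simp
      have "monom 1 n \<circ>\<^sub>p [:- \<alpha>, 1:] = g"
        by (simp add: g_pow pcompose_altdef map_poly_monom poly_monom)
      then have "coeff g (n - 1) = of_nat n * (- \<alpha>)"
        using coeff_shift_second[of "monom 1 n" "n - 1" "- \<alpha>"] n by (simp add: degree_monom_eq)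
      then have "\<alpha> = 0" using gn1 n by simp
      then have "g = monom 1 n" by (simp add: g_pow monom_altdef)
      then show False using gj0 j0 by (simp add: S_def)
    qed
    have "coprime [:- \<alpha>, 1:] h"
      using h(2) prime_elem_linear_field_poly[of 1 "- \<alpha>"] by (simp add: prime_elem_imp_coprime)
    then have "coprime ([:- \<alpha>, 1:] ^ m) h" by simp
    then obtain G1 H1 where GH: "G = G1 * H1" "lead_coeff G1 = 1" "degree G1 = m"
      using hensel_factorization[of G "[:- \<alpha>, 1:] ^ m" h] g_def h(1) dG Gn lm lh dm dh \<open>m > 0\<close> \<open>degree h > 0\<close>
      by metis
    then obtain e \<phi> where e: "e > 0" "poly (map_poly (ram 1 e) G1) \<phi> = 0"
      using less.hyps[of G1] dh \<open>degree h > 0\<close> \<open>m > 0\<close> n_def by auto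
    interpret e: crhom "ram (1::complex) e" using ram_crhom e by blast
    interpret me: crhom "map_poly (ram (1::complex) e)" by (rule e.map_crhom)
    have root: "poly (map_poly (ram 1 e) G) \<phi> = 0" using e GH(1) by (simp add: me.h_mult)
    have eq: "coeff (map_poly (ram 1 (e * q)) F1) j =
        ram 1 e (fps_X ^ p) ^ (n - j) * coeff (map_poly (ram 1 e) G) j" if "j \<le> n" for j
    proof -
      have "coeff (map_poly (ram 1 (e * q)) F1) j = ram 1 e (ram 1 q (coeff F1 j))"
        using e(1) q by (simp add: ram_ram coeff_map_poly ram_def[of _ _ 0])
      also have "\<dots> = ram 1 e (fps_X ^ p) ^ (n - j) * coeff (map_poly (ram 1 e) G) j"
        using rel[OF that] by (simp only: e.h_mult e.h_power e.coeff_map)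
      finally show ?thesis .
    qed
    have "poly (map_poly (ram 1 (e * q)) F1) (ram 1 e (fps_X ^ p) * \<phi>) =
        ram 1 e (fps_X ^ p) ^ n * poly (map_poly (ram 1 e) G) \<phi>"
      by (rule poly_scaled_coeffs[OF _ _ eq])
        (auto intro!: degree_le simp: coeff_map_poly ram_def coeff_eq_0 dF1 dG)
    then show ?thesis using shift[of "e * q"] root e(1) q by auto
  qed
qed

section \<open>Conjugation and the Galois action on series in s\<close>

definition cj :: "complex fps \<Rightarrow> complex fps" where
  "cj f = Abs_fps (\<lambda>n. cnj (f $ n))"

lemma cj_nth: "cj f $ n = cnj (f $ n)"
  by (simp add: cj_def)

lemma cj_crhom: "crhom cj"
proof
  show "cj (f * g) = cj f * cj g" for f g
    by (rule fps_ext) (simp add: cj_nth fps_mult_nth)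
qed (simp_all add: fps_eq_iff cj_nth)

interpretation cj: crhom cj by (rule cj_crhom)
interpretation mcj: crhom "map_poly cj" by (rule cj.map_crhom)

lemma cj_cj [simp]: "cj (cj f) = f"
  by (rule fps_ext) (simp add: cj_nth)

lemma mcj_mcj [simp]: "map_poly cj (map_poly cj F) = F"
  by (rule poly_eqI) (simp add: cj.coeff_map)

lemma cj_ram: "e > 0 \<Longrightarrow> cj (ram c e f) = ram (cnj c) e (cj f)"
  by (rule fps_ext) (simp add: cj_nth ram_nth)

lemma prod_linear_factors_dvd:
  fixes p :: "'a::idom poly"
  assumes "finite S" "\<And>x. x \<in> S \<Longrightarrow> poly p x = 0"
  shows "(\<Prod>x\<in>S. [:- x, 1:]) dvd p"
  using assms
proof (induction S arbitrary: p rule: finite_induct)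
  case (insert x S)
  then obtain q where q: "p = [:- x, 1:] * q"
    using poly_eq_0_iff_dvd[of p x] by auto
  have "poly q y = 0" if "y \<in> S" for y
    using insert.prems[of y] insert.hyps that q by auto
  then have "(\<Prod>x\<in>S. [:- x, 1:]) dvd q" by (rule insert.IH)
  then show ?case unfolding q prod.insert[OF insert.hyps] by (rule mult_dvd_mono[OF dvd_refl])
qed simp

text \<open>The substitution of c * s for s; for c an e-th root of unity this is the Galois action
  over t = s^e.\<close>

definition rot :: "complex \<Rightarrow> complex fps \<Rightarrow> complex fps" where
  "rot c = ram c 1"

lemma rot_crhom: "crhom (rot c)"
  unfolding rot_def by (rule ram_crhom) simp

lemma rot_nth: "rot c f $ n = c ^ n * f $ n"
  by (simp add: rot_def ram_nth)

lemma rot_rot: "rot c (rot d f) = rot (c * d) f"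
  by (rule fps_ext) (simp add: rot_nth power_mult_distrib)

lemma rot_1: "rot 1 f = f"
  by (rule fps_ext) (simp add: rot_nth)

lemma cj_rot: "cj (rot c f) = rot (cnj c) (cj f)"
  by (simp add: rot_def cj_ram)

lemma rot_ram: "e > 0 \<Longrightarrow> rot c (ram d e f) = ram (d * c ^ e) e f"
  unfolding rot_def by (subst ram_ram) simp_all

text \<open>Both signs are needed because \<open>t = s ^ e\<close> only covers \<open>t > 0\<close> if \<open>e\<close> is even.\<close>
definition no_real_branch :: "complex fps poly \<Rightarrow> bool" where
  "no_real_branch F \<longleftrightarrow> (\<forall>e>0. \<forall>\<eta>\<in>{1, -1}. \<forall>\<psi>. cj \<psi> = \<psi> \<longrightarrow> poly (map_poly (ram \<eta> e) F) \<psi> \<noteq> 0)"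

text \<open>The rotation multiplies the coefficient of s^n by the n-th power of a primitive e-th
  root of unity, so invariance kills all coefficients with n not divisible by e.\<close>

lemma ram_fixed_imp:
  fixes f :: "complex fps"
  assumes e: "e > 0" and "rot (exp (2 * of_real pi * \<i> / of_nat e)) f = f"
  obtains g where "f = ram 1 e g"
proof
  define z where "z = exp (2 * of_real pi * \<i> / of_nat e)"
  show "f = ram 1 e (Abs_fps (\<lambda>m. f $ (e * m)))"
  proof (rule fps_ext)
    fix n
    have "z ^ n * f $ n = f $ n"
      using arg_cong[OF assms(2), of "\<lambda>f. f $ n"] by (simp add: rot_nth z_def)
    moreover have "z ^ n \<noteq> 1" if "\<not> e dvd n"
    proof -
      have "z ^ n = exp (2 * of_real pi * \<i> * of_nat n / of_nat e)"
        by (simp add: z_def mult_ac flip: exp_of_nat_mult)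
      then show ?thesis using complex_root_unity_eq_1[of e n] that e by simp
    qed
    ultimately have "f $ n = 0" if "\<not> e dvd n" using that by auto
    then show "f $ n = ram 1 e (Abs_fps (\<lambda>m. f $ (e * m))) $ n"
      using e by (simp add: ram_nth)
  qed
qed

lemma map_ram_fixed_imp:
  fixes F :: "complex fps poly"
  assumes e: "e > 0" and "map_poly (rot (exp (2 * of_real pi * \<i> / of_nat e))) F = F"
  obtains G where "F = map_poly (ram 1 e) G"
proof -
  define z where "z = exp (2 * of_real pi * \<i> / of_nat e)"
  interpret r: crhom "rot z" by (rule rot_crhom)
  interpret re: crhom "ram (1::complex) e" by (rule ram_crhom) (rule e)
  have "\<exists>g. coeff F j = ram 1 e g" for j
  proof -
    have "rot z (coeff F j) = coeff F j"
      using assms(2) by (metis r.coeff_map z_def)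
    then show ?thesis using ram_fixed_imp[OF e] unfolding z_def by metis
  qed
  then obtain g where g: "\<And>j. coeff F j = ram 1 e (g j)" by metis
  define G where "G = (\<Sum>j\<le>degree F. monom (g j) j)"
  have "F = map_poly (ram 1 e) G"
  proof (rule poly_eqI)
    fix j
    show "coeff F j = coeff (map_poly (ram 1 e) G) j"
      by (simp add: re.coeff_map G_def coeff_sum g re.h_0)
        (metis coeff_eq_0 g not_le re.h_0)
  qed
  then show ?thesis using that by blast
qed

lemma map_ram_inj:
  fixes F :: "'a::idom fps poly"
  assumes "e > 0" "map_poly (ram 1 e) F = map_poly (ram 1 e) G"
  shows "F = G"
proof -
  interpret re: crhom "ram (1::'a) e" by (rule ram_crhom) (rule assms(1))
  show ?thesis
    by (rule poly_eqI) (metis assms re.coeff_map ram_inj)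
qed

text \<open>Let \<open>Or\<close> be the orbit of a root \<open>\<phi>\<close> over \<open>t = s ^ e\<close> under \<open>s \<mapsto> z s\<close> with \<open>z ^ e = 1\<close>. If
  it met its conjugate, then \<open>cj \<phi> = rot (z ^ k) \<phi>\<close> for some \<open>k\<close>, and \<open>rot w \<phi>\<close> with \<open>w\<^sup>2 = z ^ k\<close>
  would be a real branch.\<close>
lemma conjugate_factorization:
  fixes F :: "complex fps poly"
  assumes "lead_coeff F = 1" "map_poly cj F = F" "no_real_branch F"
  shows "\<exists>h. F = h * map_poly cj h"
  using assms
proof (induction "degree F" arbitrary: F rule: less_induct)
  case less
  show ?case
  proof (cases "degree F = 0")
    case True
    then have "F = 1" using less.prems(1) by (auto elim: degree_eq_zeroE simp: one_pCons)
    then show ?thesis by (intro exI[of _ 1]) (simp add: mcj.h_1)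
  next
    case False
    then obtain e \<phi> where e: "e > 0" and root: "poly (map_poly (ram 1 e) F) \<phi> = 0"
      using puiseux_root less.prems(1) by blast
    define z where "z = exp (2 * of_real pi * \<i> / of_nat e)"
    have ze: "z ^ e = 1" using e by (simp add: z_def flip: exp_of_nat_mult)
    have zcis: "z ^ k = cis (2 * pi * k / e)" for k
      by (simp add: z_def cis_conv_exp mult_ac flip: exp_of_nat_mult)
    define F' where "F' = map_poly (ram 1 e) F"
    interpret re: crhom "ram (1::complex) e" by (rule ram_crhom) (rule e)
    interpret mre: crhom "map_poly (ram (1::complex) e)" by (rule re.map_crhom)
    note r1 = rot_crhom and rr = rot_rot
    have mr1: "crhom (map_poly (rot c))" for c :: complex by (rule crhom.map_crhom[OF r1])
    have mapF': "map_poly (rot c) F' = map_poly (ram (c ^ e) e) F" for c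
      unfolding F'_def
      by (rule poly_eqI) (simp add: coeff_map_poly crhom.h_0[OF rot_crhom] crhom.h_0[OF ram_crhom] rot_ram e)
    have F'_inv: "map_poly (rot (z ^ k)) F' = F'" for k
    proof -
      have "(z ^ k) ^ e = 1" by (metis ze power_mult mult.commute power_one)
      then show ?thesis using mapF'[of "z ^ k"] by (simp add: F'_def)
    qed
    have F'_cj: "map_poly cj F' = F'"
    proof (rule poly_eqI)
      fix j
      have "cj (coeff F j) = coeff F j" using less.prems(2) by (metis cj.coeff_map)
      then show "coeff (map_poly cj F') j = coeff F' j"
        by (simp add: F'_def cj.coeff_map re.coeff_map cj_ram e)
    qed
    \<comment> \<open>Taken as a set, so that conjugates which coincide enter the product
      \<open>D\<close> below only once and its linear factors are distinct.\<close>
    define Or where "Or = (\<lambda>k. rot (z ^ k) \<phi>) ` {..<e}"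
    have "finite Or" by (simp add: Or_def)
    have Or_root: "poly F' \<psi> = 0" if \<psi>: "\<psi> \<in> Or" for \<psi>
    proof -
      obtain k where k: "\<psi> = rot (z ^ k) \<phi>" using \<psi> unfolding Or_def by auto
      have "poly (map_poly (rot (z ^ k)) F') (rot (z ^ k) \<phi>) = 0"
        using root crhom.poly_map[OF r1[of "z ^ k"], of F' \<phi>] crhom.h_0[OF r1[of "z ^ k"]]
        by (simp add: F'_def)
      then show ?thesis by (simp add: F'_inv k)
    qed
    have cjOr_root: "poly F' (cj \<psi>) = 0" if "\<psi> \<in> Or" for \<psi>
      using cj.poly_map[of F' \<psi>] Or_root[OF that] by (simp add: F'_cj cj.h_0)
    have disj: "Or \<inter> cj ` Or = {}"
    proof (rule ccontr)
      assume "Or \<inter> cj ` Or \<noteq> {}"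
      then obtain k l where kl: "rot (z ^ k) \<phi> = cj (rot (z ^ l) \<phi>)"
        by (auto simp: Or_def)
      have "cnj (z ^ l) * z ^ l = 1"
        by (simp add: zcis cis_cnj cis_mult)
      have "rot (z ^ l) (cj (rot (z ^ l) \<phi>)) = rot (cnj (z ^ l) * z ^ l) (cj \<phi>)"
        by (simp add: cj_rot rr mult.commute del: complex_cnj_power)
      also have "\<dots> = cj \<phi>" using \<open>cnj (z ^ l) * z ^ l = 1\<close> rot_1 by metis
      finally have cj\<phi>: "cj \<phi> = rot (z ^ (k + l)) \<phi>"
        using kl by (metis rr power_add add.commute)
      \<comment> \<open>Half the angle of \<open>z ^ (k + l)\<close>, so that
        \<open>rot w \<phi>\<close> is fixed by conjugation. Then \<open>w ^ e\<close> is the sign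
        (-1)^(k + l), which is why t = - s^e must be allowed as well.\<close>
      define w where "w = cis (pi * (k + l) / e)"
      have "cnj w * z ^ (k + l) = w"
        by (simp add: w_def zcis cis_cnj cis_mult)
      then have real: "cj (rot w \<phi>) = rot w \<phi>"
        by (simp add: cj_rot cj\<phi> rr)
      have "w ^ e = cis pi ^ (k + l)"
        using e by (simp only: w_def Complex.DeMoivre) (simp add: mult.commute)
      then have "w ^ e \<in> {1, -1}"
        by (simp add: minus_one_power_iff)
      moreover have "poly (map_poly (ram (w ^ e) e) F) (rot w \<phi>) = 0"
        using crhom.poly_map[OF r1[of w], of F' \<phi>] root crhom.h_0[OF r1[of w]]
        by (simp add: mapF' flip: F'_def)
      ultimately show False
        using less.prems(3) e real unfolding no_real_branch_def by blast
    qed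
    define D where "D = (\<Prod>\<psi>\<in>Or. [:- \<psi>, 1:])"
    have D0: "D \<noteq> 0" by (simp add: D_def \<open>finite Or\<close>)
    have map_prod: "map_poly h (\<Prod>\<psi>\<in>A. [:- \<psi>, 1:]) = (\<Prod>\<psi>\<in>h ` A. [:- \<psi>, 1:])"
      if h: "crhom h" and inj: "inj_on h A" for h :: "complex fps \<Rightarrow> complex fps" and A
    proof -
      interpret h: crhom h by (rule h)
      interpret mh: crhom "map_poly h" by (rule h.map_crhom)
      have "map_poly h (\<Prod>\<psi>\<in>A. [:- \<psi>, 1:]) = (\<Prod>\<psi>\<in>A. map_poly h [:- \<psi>, 1:])"
        by (induction A rule: infinite_finite_induct) (simp_all add: mh.h_1 mh.h_mult del: mult_pCons_left)
      also have "\<dots> = (\<Prod>\<psi>\<in>A. [:- h \<psi>, 1:])"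
        by (simp add: map_poly_pCons h.h_0 h.h_1 h.h_uminus)
      also have "\<dots> = (\<Prod>\<psi>\<in>h ` A. [:- \<psi>, 1:])"
        by (simp add: prod.reindex[OF inj])
      finally show ?thesis .
    qed
    have injz: "inj (rot z)"
    proof (rule injI)
      fix f g assume "rot z f = rot z g"
      then have "rot (cnj z * z) f = rot (cnj z * z) g" by (metis rr)
      moreover have "cnj z * z = 1" using zcis[of 1] by (simp add: cis_cnj cis_mult)
      ultimately show "f = g" using rot_1 by metis
    qed
    have "rot z ` Or \<subseteq> Or"
    proof
      fix \<psi> assume "\<psi> \<in> rot z ` Or"
      then obtain k where k: "k < e" "\<psi> = rot (z ^ Suc k) \<phi>"
        by (auto simp: Or_def rr)
      show "\<psi> \<in> Or"
      proof (cases "Suc k < e")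
        case True
        then show ?thesis unfolding Or_def using k(2) by blast
      next
        case False
        then have "Suc k = e" using k by simp
        then have "\<psi> = rot (z ^ 0) \<phi>" using k ze by simp
        then show ?thesis unfolding Or_def using e by blast
      qed
    qed
    then have "rot z ` Or = Or"
      using \<open>finite Or\<close> injz by (metis card_image card_subset_eq inj_on_subset subset_UNIV)
    then have D_inv: "map_poly (rot z) D = D"
      unfolding D_def using map_prod[OF r1[of z] inj_on_subset[OF injz subset_UNIV]] by simp
    \<comment> \<open>Invariance under the generator \<open>rot z\<close> lets \<open>D\<close>
      descend from series in s to series in t.\<close>
    then obtain h1 where h1: "D = map_poly (ram 1 e) h1"
      using map_ram_fixed_imp[OF e] unfolding z_def by metis
    have injc: "inj_on cj Or" by (metis cj_cj inj_onI)
    have cjD: "map_poly cj D = (\<Prod>\<psi>\<in>cj ` Or. [:- \<psi>, 1:])"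
      unfolding D_def by (rule map_prod[OF cj_crhom injc])
    have "(\<Prod>\<psi>\<in>Or \<union> cj ` Or. [:- \<psi>, 1:]) dvd F'"
      by (rule prod_linear_factors_dvd) (use \<open>finite Or\<close> Or_root cjOr_root in auto)
    then have "D * map_poly cj D dvd F'"
      using disj \<open>finite Or\<close> by (simp add: prod.union_disjoint cjD) (simp add: D_def)
    then obtain E where E: "F' = D * map_poly cj D * E" by blast
    have cj_ram_comm: "map_poly cj (map_poly (ram 1 e) p) = map_poly (ram 1 e) (map_poly cj p)" for p
      by (rule poly_eqI) (simp add: cj.coeff_map re.coeff_map cj_ram e)
    have DD0: "D * map_poly cj D \<noteq> 0"
      using D0 by (metis mcj.h_0 mcj_mcj mult_eq_0_iff)
    have cjD_inv: "map_poly (rot z) (map_poly cj D) = map_poly cj D"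
    proof -
      have "map_poly (rot z) (map_poly (ram 1 e) p) = map_poly (ram 1 e) p" for p
        by (rule poly_eqI) (simp add: coeff_map_poly crhom.h_0[OF rot_crhom] re.h_0 rot_ram e ze)
      then show ?thesis by (simp only: h1 cj_ram_comm)
    qed
    \<comment> \<open>\<open>F'\<close> and the factor \<open>D * map_poly cj D\<close> are
      invariant, so cancelling shows that the cofactor \<open>E\<close> is invariant and descends
      too.\<close>
    have "D * map_poly cj D * map_poly (rot z) E = D * map_poly cj D * E"
      using F'_inv[of 1] by (simp add: E crhom.h_mult[OF mr1] D_inv cjD_inv)
    then have "map_poly (rot z) E = E" using DD0 by simp
    then obtain F1 where F1: "E = map_poly (ram 1 e) F1"
      using map_ram_fixed_imp[OF e] unfolding z_def by metis
    have F: "F = h1 * map_poly cj h1 * F1"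
    proof (rule map_ram_inj[OF e])
      show "map_poly (ram 1 e) F = map_poly (ram 1 e) (h1 * map_poly cj h1 * F1)"
        using E by (simp add: F'_def mre.h_mult F1 h1 cj_ram_comm)
    qed
    have h10: "h1 * map_poly cj h1 \<noteq> 0" using less.prems(1) F by auto
    have "h1 * map_poly cj h1 * map_poly cj F1 = h1 * map_poly cj h1 * F1"
      using less.prems(2) by (simp add: F mcj.h_mult mult_ac)
    then have c1: "map_poly cj F1 = F1" using h10 by simp
    have lD: "lead_coeff D = 1" by (simp add: D_def lead_coeff_prod)
    have "lead_coeff (D * map_poly cj D) = 1"
      using lD cj.monic_map(1)[OF lD] by (simp add: lead_coeff_mult)
    have dinj: "degree (map_poly (ram 1 e) p) = degree p \<and> lead_coeff (map_poly (ram 1 e) p) = ram 1 e (lead_coeff p)" for p :: "complex fps poly"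
    proof -
      have "(ram 1 e c = 0) = (c = 0)" for c :: "complex fps" using ram_inj[OF e, of c 0] re.h_0 by auto
      then show ?thesis by (simp add: degree_map_poly re.coeff_map)
    qed
    have "lead_coeff F' = 1"
      using dinj[of F, THEN conjunct2] less.prems(1) re.h_1 by (simp only: F'_def)
    then have "lead_coeff (D * map_poly cj D) * lead_coeff E = 1"
      by (simp only: E lead_coeff_mult)
    then have "lead_coeff E = 1"
      using \<open>lead_coeff (D * map_poly cj D) = 1\<close> by simp
    then have "ram 1 e (lead_coeff F1) = ram 1 e 1"
      using dinj[of F1, THEN conjunct2] by (simp only: F1 re.h_1)
    then have l1: "lead_coeff F1 = 1" by (rule ram_inj[OF e])
    have "degree D > 0"
    proof -
      have "\<phi> \<in> Or" unfolding Or_def by (rule image_eqI[of _ _ 0]) (use e rot_1[of \<phi>] in auto)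
      then have "card Or > 0" using \<open>finite Or\<close> by (auto simp: card_gt_0_iff)
      then show ?thesis by (simp add: D_def degree_prod_eq_sum_degree \<open>finite Or\<close>)
    qed
    then have "degree h1 > 0" using dinj[of h1] by (simp add: h1)
    moreover have "F1 \<noteq> 0" using l1 by auto
    then have "degree F = degree (h1 * map_poly cj h1) + degree F1"
      using h10 F by (simp add: degree_mult_eq)
    moreover have "degree (h1 * map_poly cj h1) = degree h1 + degree (map_poly cj h1)"
      using h10 by (intro degree_mult_eq) auto
    ultimately have "degree F1 < degree F" by linarith
    moreover have "no_real_branch F1"
    proof -
      have "poly (map_poly (ram \<eta> e') F) \<psi> = 0"
        if "e' > 0" "poly (map_poly (ram \<eta> e') F1) \<psi> = 0" for e' \<eta> \<psi>
        using that by (simp add: F crhom.h_mult[OF crhom.map_crhom[OF ram_crhom]])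
      then show ?thesis using less.prems(3) unfolding no_real_branch_def by blast
    qed
    ultimately obtain h2 where "F1 = h2 * map_poly cj h2"
      using less.hyps l1 c1 by blast
    then have "F = (h1 * h2) * map_poly cj (h1 * h2)"
      by (simp add: F mcj.h_mult mult_ac)
    then show ?thesis by blast
  qed
qed

section \<open>Nonnegative real polynomials in one variable\<close>

text \<open>The squares of the top coefficients cannot cancel. Stated over a general domain because
  it is applied both to real coefficients and to real power series.\<close>

lemma degree_sum_two_squares:
  fixes q r :: "'a::idom poly"
  assumes aniso: "\<And>x y :: 'a. x\<^sup>2 + y\<^sup>2 = 0 \<Longrightarrow> x = 0 \<and> y = 0"
  shows "degree (q\<^sup>2 + r\<^sup>2) = 2 * max (degree q) (degree r)"
    and "lead_coeff (q\<^sup>2 + r\<^sup>2) =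
      (coeff q (max (degree q) (degree r)))\<^sup>2 + (coeff r (max (degree q) (degree r)))\<^sup>2"
proof -
  define m where "m = max (degree q) (degree r)"
  have sq: "coeff (p\<^sup>2) (2 * m) = (coeff p m)\<^sup>2" if "degree p \<le> m" for p :: "'a poly"
  proof (cases "degree p = m")
    case True
    then show ?thesis
      using coeff_mult_degree_sum[of p p] by (simp add: power2_eq_square mult_2)
  next
    case False
    then have "degree p < m" using that by simp
    moreover have "degree (p\<^sup>2) \<le> 2 * degree p"
      by (metis degree_power_le mult.commute)
    ultimately show ?thesis by (simp add: coeff_eq_0)
  qed
  have c: "coeff (q\<^sup>2 + r\<^sup>2) (2 * m) = (coeff q m)\<^sup>2 + (coeff r m)\<^sup>2"
    using sq[of q] sq[of r] by (simp add: m_def)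
  have "degree (p\<^sup>2) \<le> 2 * m" if "degree p \<le> m" for p :: "'a poly"
    using degree_power_le[of p 2] that by (simp add: mult.commute)
  then have le: "degree (q\<^sup>2 + r\<^sup>2) \<le> 2 * m"
    by (intro degree_add_le) (simp_all add: m_def)
  have "degree (q\<^sup>2 + r\<^sup>2) = 2 * m"
  proof (cases "m = 0")
    case False
    then have "coeff q m \<noteq> 0 \<or> coeff r m \<noteq> 0"
      unfolding m_def by (metis coeff_0 degree_0 leading_coeff_0_iff max_def)
    then have "coeff (q\<^sup>2 + r\<^sup>2) (2 * m) \<noteq> 0" using c aniso by metis
    then show ?thesis using le by (metis le_antisym le_degree)
  qed (use le in simp)
  then show "degree (q\<^sup>2 + r\<^sup>2) = 2 * max (degree q) (degree r)"
    and "lead_coeff (q\<^sup>2 + r\<^sup>2) =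
      (coeff q (max (degree q) (degree r)))\<^sup>2 + (coeff r (max (degree q) (degree r)))\<^sup>2"
    using c by (simp_all add: m_def)
qed

lemma real_poly_factor_cases:
  fixes p :: "real poly"
  assumes "degree p > 0"
  obtains (linear) a where "[:- a, 1:] dvd p"
  | (quadratic) a b where "b \<noteq> 0" "[:a\<^sup>2 + b\<^sup>2, - 2 * a, 1:] dvd p"
proof -
  interpret c: crhom complex_of_real by standard simp_all
  have "\<not> constant (poly (map_poly complex_of_real p))"
    using assms by (simp add: constant_degree degree_map_poly)
  then obtain z where z: "poly (map_poly complex_of_real p) z = 0"
    using fundamental_theorem_of_algebra by blast
  show ?thesis
  proof (cases "Im z = 0")
    case True
    then have "z = complex_of_real (Re z)" by (simp add: complex_eq_iff)
    then have "poly p (Re z) = 0"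
      using z by (metis of_real_0 of_real_eq_iff c.poly_map)
    then show ?thesis using linear poly_eq_0_iff_dvd by blast
  next
    case False
    interpret mc: crhom "map_poly complex_of_real" by (rule c.map_crhom)
    define a b where "a = Re z" and "b = Im z"
    define Q where "Q = [:a\<^sup>2 + b\<^sup>2, - 2 * a, 1:]"
    have "Q \<noteq> 0" "degree Q = 2" by (simp_all add: Q_def)
    have zab: "z = Complex a b" by (simp add: a_def b_def)
    have Qz: "poly (map_poly complex_of_real Q) z = 0"
      by (simp add: Q_def map_poly_pCons zab complex_eq_iff power2_eq_square algebra_simps)
    \<comment> \<open>The remainder has degree at most 1 and real coefficients, and it vanishes at
      the nonreal \<open>z\<close>; hence it is 0.\<close>
    define r where "r = p mod Q"
    have "degree r \<le> 1"
      using degree_mod_less[OF \<open>Q \<noteq> 0\<close>, of p] \<open>degree Q = 2\<close> by (auto simp: r_def)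
    then have "r = [:coeff r 0, coeff r 1:]"
      by (intro poly_eqI) (auto simp: coeff_pCons coeff_eq_0 split: nat.splits)
    then obtain r0 r1 where r: "r = [:r0, r1:]" by blast
    have "p = p div Q * Q + r" by (simp add: r_def)
    then have "poly (map_poly complex_of_real p) z = poly (map_poly complex_of_real r) z"
      by (metis Qz add_0 mc.h_add mc.h_mult mult_zero_right poly_add poly_mult)
    then have "complex_of_real r0 + z * complex_of_real r1 = 0"
      using z by (simp add: r map_poly_pCons)
    then have "r0 = 0 \<and> r1 = 0"
      using False by (auto simp: complex_eq_iff)
    then have "Q dvd p" using r by (simp add: r_def mod_eq_0_iff_dvd)
    then show ?thesis using quadratic[of b a] False by (simp add: Q_def b_def)
  qed
qed

lemma poly_nonneg_cofinite:
  fixes p :: "real poly"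
  assumes "finite F" "\<And>x. x \<notin> F \<Longrightarrow> poly p x \<ge> 0"
  shows "poly p a \<ge> 0"
proof (rule tendsto_lowerbound)
  show "(poly p \<longlongrightarrow> poly p a) (at a)" using isCont_def poly_isCont by blast
  have "open (- (F - {a}))" using assms(1) by (intro open_Compl finite_imp_closed) simp
  then have "\<forall>\<^sub>F x in at a. x \<in> - (F - {a}) \<and> x \<noteq> a"
    by (intro eventually_conj eventually_at_in_open' eventually_neq_at_within) simp_all
  then show "\<forall>\<^sub>F x in at a. 0 \<le> poly p x"
    by eventually_elim (use assms(2) in auto)
qed simp

lemma two_squares_mult:
  fixes a b c d :: "'a::comm_ring_1"
  shows "(a\<^sup>2 + b\<^sup>2) * (c\<^sup>2 + d\<^sup>2) = (a * c - b * d)\<^sup>2 + (a * d + b * c)\<^sup>2"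
  by (simp add: power2_eq_square algebra_simps)

text \<open>A real root has even multiplicity: the cofactor changes sign there and so vanishes too,
  and a square splits off. A nonreal pair contributes (x - a)^2 + b^2, and sums of two squares are
  closed under products.\<close>

lemma nonneg_poly_two_squares:
  fixes p :: "real poly"
  assumes "\<And>x. poly p x \<ge> 0"
  shows "\<exists>q r. p = q\<^sup>2 + r\<^sup>2"
  using assms
proof (induction "degree p" arbitrary: p rule: less_induct)
  case less
  show ?case
  proof (cases "degree p = 0")
    case True
    then obtain c where c: "p = [:c:]" by (auto elim: degree_eq_zeroE)
    then have "c \<ge> 0" using less.prems[of 0] by simp
    then have "p = [:sqrt c:]\<^sup>2 + 0\<^sup>2" using c by (simp add: power2_eq_square)
    then show ?thesis by blast
  next
    case False
    then have "p \<noteq> 0" by auto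
    from False have "degree p > 0" by simp
    then show ?thesis
    proof (cases rule: real_poly_factor_cases)
      case (linear a)
      then obtain k where k: "p = [:- a, 1:] * k" by blast
      have sgn: "(x - a) * poly k x \<ge> 0" for x
        using less.prems[of x] k by (simp add: algebra_simps)
      have right: "poly k x \<ge> 0" if "x > a" for x
        using sgn[of x] that by (auto simp: zero_le_mult_iff)
      have left: "poly k x \<le> 0" if "x < a" for x
        using sgn[of x] that by (auto simp: zero_le_mult_iff)
      have "poly k a = 0"
      proof (rule antisym)
        show "poly k a \<ge> 0"
        proof (rule tendsto_lowerbound)
          show "(poly k \<longlongrightarrow> poly k a) (at_right a)"
            by (metis isCont_def poly_isCont tendsto_within_subset subset_UNIV)
          show "\<forall>\<^sub>F x in at_right a. 0 \<le> poly k x"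
            using right by (auto simp: eventually_at_filter)
        qed simp
        show "poly k a \<le> 0"
        proof (rule tendsto_upperbound)
          show "(poly k \<longlongrightarrow> poly k a) (at_left a)"
            by (metis isCont_def poly_isCont tendsto_within_subset subset_UNIV)
          show "\<forall>\<^sub>F x in at_left a. poly k x \<le> 0"
            using left by (auto simp: eventually_at_filter)
        qed simp
      qed
      then obtain k' where k': "k = [:- a, 1:] * k'" using poly_eq_0_iff_dvd by blast
      have p: "p = [:- a, 1:]\<^sup>2 * k'" by (simp only: k k' power2_eq_square mult.assoc)
      have "poly k' x \<ge> 0" if "x \<noteq> a" for x
      proof -
        have "0 \<le> (x - a)\<^sup>2 * poly k' x"
          using less.prems[of x] by (simp add: p power2_eq_square algebra_simps)
        then show ?thesis using that by (simp add: zero_le_mult_iff)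
      qed
      then have "poly k' x \<ge> 0" for x using poly_nonneg_cofinite[of "{a}" k'] by simp
      moreover have "degree k' < degree p"
        using \<open>p \<noteq> 0\<close> by (simp add: p degree_mult_eq degree_power_eq)
      ultimately obtain q r where "k' = q\<^sup>2 + r\<^sup>2" using less.hyps by metis
      then have "p = ([:- a, 1:] * q)\<^sup>2 + ([:- a, 1:] * r)\<^sup>2"
        by (simp only: p power_mult_distrib distrib_left)
      then show ?thesis by blast
    next
      case (quadratic a b)
      define Q where "Q = [:a\<^sup>2 + b\<^sup>2, - 2 * a, 1:]"
      obtain k where k: "p = Q * k" using quadratic Q_def by blast
      have Q: "Q = [:- a, 1:]\<^sup>2 + [:b:]\<^sup>2" by (simp add: Q_def power2_eq_square)
      have "poly k x \<ge> 0" for x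
      proof -
        have "poly Q x = (x - a)\<^sup>2 + b\<^sup>2" by (simp add: Q)
        then have "poly Q x > 0" using \<open>b \<noteq> 0\<close> by (simp add: add_nonneg_pos)
        then show ?thesis using less.prems[of x] by (simp add: k zero_le_mult_iff)
      qed
      moreover have "degree k < degree p"
      proof -
        have "degree p = degree Q + degree k"
          using \<open>p \<noteq> 0\<close> k by (metis degree_mult_eq mult_eq_0_iff)
        then show ?thesis by (simp add: Q_def)
      qed
      ultimately obtain q r where "k = q\<^sup>2 + r\<^sup>2" using less.hyps by metis
      then show ?thesis using two_squares_mult k Q by metis
    qed
  qed
qed

lemma nonneg_poly_even_degree:
  fixes p :: "real poly"
  assumes "\<And>x. poly p x \<ge> 0"
  shows "even (degree p)" "lead_coeff p \<ge> 0"
proof -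
  obtain q r where "p = q\<^sup>2 + r\<^sup>2" using nonneg_poly_two_squares assms by blast
  then show "even (degree p)" "lead_coeff p \<ge> 0"
    using degree_sum_two_squares[of q r] by (simp_all add: sum_power2_eq_zero_iff)
qed

text \<open>Elements of \<open>\<real>[t][y]\<close> have \<open>y\<close> as the outer and \<open>t\<close> as the inner variable.\<close>
definition ev2 :: "real poly poly \<Rightarrow> real \<Rightarrow> real \<Rightarrow> real" where
  "ev2 P t y = poly (poly P [:y:]) t"

lemma ev2_add [simp]: "ev2 (P + Q) t y = ev2 P t y + ev2 Q t y"
  and ev2_mult [simp]: "ev2 (P * Q) t y = ev2 P t y * ev2 Q t y"
  and ev2_diff [simp]: "ev2 (P - Q) t y = ev2 P t y - ev2 Q t y"
  and ev2_power [simp]: "ev2 (P ^ n) t y = ev2 P t y ^ n"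
  and ev2_const [simp]: "ev2 [:c:] t y = poly c t"
  and ev2_0 [simp]: "ev2 0 t y = 0"
  and ev2_pCons: "ev2 (pCons c P) t y = poly c t + y * ev2 P t y"
  by (simp_all add: ev2_def)

lemma ev2_poly: "ev2 P t y = poly (map_poly (\<lambda>c. poly c t) P) y"
  by (induction P) (simp_all add: ev2_pCons map_poly_pCons)

lemma ev2_sum: "degree P \<le> n \<Longrightarrow> ev2 P t y = (\<Sum>j\<le>n. poly (coeff P j) t * y ^ j)"
proof -
  assume "degree P \<le> n"
  then have "degree (map_poly (\<lambda>c. poly c t) P) \<le> n"
    by (intro degree_le) (simp add: coeff_map_poly coeff_eq_0)
  then show ?thesis by (simp add: ev2_poly poly_sum_upto coeff_map_poly)
qed

text \<open>Where the leading coefficient does not vanish, fixing t gives a nonnegative polynomial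
  in y of the same degree, and the one-variable result applies.\<close>

lemma psd_lead_coeff:
  assumes "\<And>t y. ev2 P t y \<ge> 0"
  shows "poly (lead_coeff P) t \<ge> 0" "even (degree P)"
proof -
  show "poly (lead_coeff P) t \<ge> 0" for t
  proof (cases "poly (lead_coeff P) t = 0")
    case False
    then have "degree (map_poly (\<lambda>c. poly c t) P) = degree P"
      by (intro le_antisym degree_le le_degree) (simp_all add: coeff_map_poly coeff_eq_0)
    then show ?thesis
      using nonneg_poly_even_degree(2)[of "map_poly (\<lambda>c. poly c t) P"] assms
      by (simp add: coeff_map_poly flip: ev2_poly)
  qed simp
  show "even (degree P)"
  proof (cases "P = 0")
    case False
    then obtain t where "poly (lead_coeff P) t \<noteq> 0" using poly_all_0_iff_0 leading_coeff_0_iff by metis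
    then have "degree (map_poly (\<lambda>c. poly c t) P) = degree P"
      by (intro le_antisym degree_le le_degree) (simp_all add: coeff_map_poly coeff_eq_0)
    then show ?thesis
      using nonneg_poly_even_degree(1)[of "map_poly (\<lambda>c. poly c t) P"] assms
      by (simp flip: ev2_poly)
  qed simp
qed

lemma ev2_smult [simp]: "ev2 (smult c P) t y = poly c t * ev2 P t y"
  by (simp add: ev2_def)

section \<open>Local sums of two squares\<close>

definition cx :: "real poly \<Rightarrow> complex fps" where
  "cx q = fps_of_poly (map_poly complex_of_real q)"

lemma cx_nth: "cx q $ n = complex_of_real (coeff q n)"
  by (simp add: cx_def coeff_map_poly)

lemma cx_crhom: "crhom cx"
proof -
  interpret c: crhom complex_of_real by standard simp_all
  interpret mc: crhom "map_poly complex_of_real" by (rule c.map_crhom)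
  show ?thesis
    by standard (simp_all add: cx_def mc.h_add mc.h_mult fps_of_poly_add fps_of_poly_mult)
qed

interpretation cx: crhom cx by (rule cx_crhom)

lemma dvd_poly_diff:
  fixes p :: "'a::comm_ring_1 poly"
  shows "x - y dvd poly p x - poly p y"
proof (induction p)
  case (pCons a p)
  have "poly (pCons a p) x - poly (pCons a p) y = (x - y) * poly p x + y * (poly p x - poly p y)"
    by (simp add: algebra_simps)
  then show ?case using pCons by (simp add: dvd_add)
qed simp

lemma pcompose_crhom: "crhom (\<lambda>p. p \<circ>\<^sub>p q)"
  by standard (simp_all add: pcompose_add pcompose_mult pcompose_1)

lemma ram_cx:
  assumes "e > 0"
  shows "ram (complex_of_real \<eta>) e (cx p) = cx (p \<circ>\<^sub>p monom \<eta> e)"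
proof (induction p)
  case 0
  then show ?case by (simp add: cx.h_0 ram_def)
next
  case (pCons a p)
  interpret r: crhom "ram (complex_of_real \<eta>) e" using assms by (rule ram_crhom)
  have "pCons a p = [:a:] + [:0, 1:] * p" by simp
  then have split: "cx (pCons a p) = cx [:a:] + cx [:0, 1:] * cx p"
    by (metis cx.h_add cx.h_mult)
  have "ram (complex_of_real \<eta>) e (cx [:a:]) = cx [:a:]"
    by (rule fps_ext) (use assms in \<open>auto simp: ram_nth cx_nth coeff_pCons split: nat.splits\<close>)
  moreover have "ram (complex_of_real \<eta>) e (cx [:0, 1:]) = cx (monom \<eta> e)"
    by (rule fps_ext) (use assms in \<open>auto simp: ram_nth cx_nth coeff_pCons split: nat.splits\<close>)
  ultimately show ?case
    using pCons by (simp add: split r.h_add r.h_mult pcompose_pCons cx.h_add cx.h_mult)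
qed

text \<open>A real branch, truncated to a polynomial q, gives a real curve s ->
  (\<open>\<theta>\<close> s^e, q(s)) along which \<open>M\<close> is of order beyond e * K, against
  the lower bound c s^(e K).\<close>

lemma no_real_branchI:
  fixes M :: "real poly poly"
  assumes "c > 0" "\<delta> > 0"
    and bound: "\<And>t y. 0 < \<bar>t\<bar> \<Longrightarrow> \<bar>t\<bar> < \<delta> \<Longrightarrow> c * \<bar>t\<bar> ^ K \<le> ev2 M t y"
  shows "no_real_branch (map_poly cx M)"
  unfolding no_real_branch_def
proof (intro allI ballI impI notI)
  fix e :: nat and \<eta> :: complex and \<psi>
  assume e: "e > 0" and \<eta>: "\<eta> \<in> {1, - 1}" and real: "cj \<psi> = \<psi>"
    and root: "poly (map_poly (ram \<eta> e) (map_poly cx M)) \<psi> = 0"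
  obtain \<theta> :: real where \<theta>: "\<eta> = complex_of_real \<theta>" "\<bar>\<theta>\<bar> = 1"
    using \<eta> by (metis abs_1 abs_minus_cancel empty_iff insert_iff of_real_1 of_real_minus)
  \<comment> \<open>One more than the order e * K permitted by the bound.\<close>
  define N where "N = e * K + 1"
  define q where "q = (\<Sum>i<N. monom (Re (\<psi> $ i)) i)"
  have cq: "coeff q i = (if i < N then Re (\<psi> $ i) else 0)" for i
    by (simp add: q_def coeff_sum)
  have im: "Im (\<psi> $ i) = 0" for i
    using arg_cong[OF real, of "\<lambda>f. Im (f $ i)"] by (simp add: cj_nth)
  have "\<psi> - cx q = fps_X ^ N * fps_shift N \<psi>"
    by (rule fps_ext) (simp add: fps_X_power_mult_nth cx_nth cq complex_eq_iff im)
  then have X: "fps_X ^ N dvd \<psi> - cx q" by simp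
  define \<sigma> where "\<sigma> = (\<lambda>p :: real poly. p \<circ>\<^sub>p monom \<theta> e)"
  interpret s: crhom \<sigma> unfolding \<sigma>_def by (rule pcompose_crhom)
  interpret r: crhom "ram \<eta> e" using e by (rule ram_crhom)
  define R where "R = poly (map_poly \<sigma> M) q"
  have eq: "map_poly cx (map_poly \<sigma> M) = map_poly (ram \<eta> e) (map_poly cx M)"
    by (rule poly_eqI) (simp only: cx.coeff_map s.coeff_map r.coeff_map, simp add: \<theta>(1) ram_cx[OF e] \<sigma>_def)
  have "cx R = poly (map_poly (ram \<eta> e) (map_poly cx M)) (cx q)"
    unfolding R_def by (simp flip: cx.poly_map add: eq)
  then have "fps_X ^ N dvd - cx R"
    using dvd_trans[OF X dvd_poly_diff[of \<psi> "cx q" "map_poly (ram \<eta> e) (map_poly cx M)"]] root by simp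
  then have "fps_X ^ N dvd cx R" by simp
  then obtain g where "cx R = fps_X ^ N * g" by blast
  then have "coeff R i = 0" if "i < N" for i
    using that cx_nth[of R i] by (simp add: fps_X_power_mult_nth)
  then have "monom 1 N dvd R" by (simp add: monom_1_dvd_iff')
  then obtain R1 where R1: "R = monom 1 N * R1" by blast
  have evR: "poly R s = ev2 M (\<theta> * s ^ e) (poly q s)" for s
  proof -
    interpret p: crhom "\<lambda>p. poly p s" by standard simp_all
    have "poly R s = poly (map_poly (\<lambda>p. poly p s) (map_poly \<sigma> M)) (poly q s)"
      unfolding R_def by (simp add: p.poly_map)
    also have "map_poly (\<lambda>p. poly p s) (map_poly \<sigma> M) = map_poly (\<lambda>p. poly p (\<theta> * s ^ e)) M"
      by (rule poly_eqI) (simp add: coeff_map_poly s.h_0 \<sigma>_def poly_pcompose poly_monom)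
    finally show ?thesis by (simp add: ev2_poly)
  qed
  \<comment> \<open>The bound divided by s^(e K); letting s tend to 0 from the right then
    contradicts c > 0.\<close>
  have "c \<le> s * poly R1 s" if s: "0 < s" "s < min 1 \<delta>" for s
  proof -
    have "s ^ e \<le> s" using s e power_decreasing[of 1 e s] by simp
    then have "\<bar>\<theta> * s ^ e\<bar> = s ^ e" "0 < s ^ e" "s ^ e < \<delta>" using s \<theta>(2) by (auto simp: abs_mult)
    then have "c * (s ^ e) ^ K \<le> poly R s"
      using bound[of "\<theta> * s ^ e" "poly q s"] evR by simp
    also have "poly R s = (s ^ e) ^ K * (s * poly R1 s)"
      by (simp add: R1 N_def poly_monom power_mult)
    finally show ?thesis using \<open>0 < s ^ e\<close> by (simp add: mult.commute)
  qed
  then have "\<forall>\<^sub>F s in at_right 0. c \<le> s * poly R1 s"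
    unfolding eventually_at_right_field using \<open>\<delta> > 0\<close> by (intro exI[of _ "min 1 \<delta>"]) auto
  moreover have "((\<lambda>s. s * poly R1 s) \<longlongrightarrow> 0 * poly R1 0) (at_right 0)"
    by (intro tendsto_mult tendsto_ident_at)
      (metis isCont_def poly_isCont tendsto_within_subset subset_UNIV)
  ultimately have "c \<le> 0 * poly R1 0"
    by (intro tendsto_lowerbound) auto
  then show False using \<open>c > 0\<close> by simp
qed

lemma tcoeff_0_dvd:
  fixes U :: "'a::comm_ring_1 fps poly"
  assumes "tcoeff 0 U = 0"
  obtains U1 where "U = smult fps_X U1"
proof
  show "U = smult fps_X (map_poly (fps_shift 1) U)"
  proof (rule poly_eqI, rule fps_ext)
    fix j n
    have "coeff U j $ 0 = 0" using assms coeff_tcoeff[of 0 U j] by simp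
    then show "coeff U j $ n = coeff (smult fps_X (map_poly (fps_shift 1) U)) j $ n"
      by (cases n) (simp_all add: coeff_map_poly)
  qed
qed

lemma real_poly_sum_squares_eq_0:
  fixes p q :: "real poly"
  assumes "p\<^sup>2 + q\<^sup>2 = 0"
  shows "p = 0 \<and> q = 0"
proof -
  have "(poly p x)\<^sup>2 + (poly q x)\<^sup>2 = 0" for x
    using assms by (metis poly_0 poly_add poly_power)
  then have "poly p x = 0 \<and> poly q x = 0" for x by (simp add: sum_power2_eq_zero_iff)
  then show ?thesis using poly_all_0_iff_0 by blast
qed

text \<open>At t = 0 the two reductions are real polynomials whose squares sum to 0, so both vanish.
  This splits off one factor X from each summand, and X^2 from the sum.\<close>

lemma sum_squares_X_power_dvd:
  fixes U V W :: "real fps poly"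
  assumes "U\<^sup>2 + V\<^sup>2 = smult (fps_X ^ (2 * j)) W"
  shows "\<exists>U' V'. U = smult (fps_X ^ j) U' \<and> V = smult (fps_X ^ j) V'"
  using assms
proof (induction j arbitrary: U V)
  case (Suc j)
  have sq: "tcoeff 0 (p\<^sup>2) = (tcoeff 0 p)\<^sup>2" for p :: "real fps poly"
    by (simp add: power2_eq_square tcoeff_mult)
  have "(tcoeff 0 U)\<^sup>2 + (tcoeff 0 V)\<^sup>2 = tcoeff 0 (U\<^sup>2 + V\<^sup>2)"
    by (rule poly_eqI) (simp add: coeff_tcoeff flip: sq)
  also have "\<dots> = 0"
    unfolding Suc.prems by (rule poly_eqI) (simp add: coeff_tcoeff)
  finally have "tcoeff 0 U = 0" "tcoeff 0 V = 0" using real_poly_sum_squares_eq_0 by blast+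
  then obtain U1 V1 where 1: "U = smult fps_X U1" "V = smult fps_X V1"
    using tcoeff_0_dvd by metis
  have "smult (fps_X ^ 2) (U1\<^sup>2 + V1\<^sup>2) = smult (fps_X ^ 2) (smult (fps_X ^ (2 * j)) W)"
    using Suc.prems by (simp add: 1 smult_power smult_add_right power2_eq_square mult.assoc)
  then have "U1\<^sup>2 + V1\<^sup>2 = smult (fps_X ^ (2 * j)) W"
    by (metis fps_X_neq_zero power_not_zero smult_cancel)
  then obtain U2 V2 where "U1 = smult (fps_X ^ j) U2" "V1 = smult (fps_X ^ j) V2"
    using Suc.IH by blast
  then show ?case using 1 by (intro exI[of _ U2] exI[of _ V2]) simp
qed simp

text \<open>By the previous lemma with \<open>W = 0\<close>, both series are divisible by every
  power of X.\<close>

lemma real_fps_sum_squares_eq_0: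
  fixes f g :: "real fps"
  assumes "f\<^sup>2 + g\<^sup>2 = 0"
  shows "f = 0 \<and> g = 0"
proof -
  have *: "f $ n = 0 \<and> g $ n = 0" for n
  proof -
    have "[:f:]\<^sup>2 + [:g:]\<^sup>2 = smult (fps_X ^ (2 * Suc n)) 0"
      using assms by (simp add: power2_eq_square)
    then obtain U V where "[:f:] = smult (fps_X ^ Suc n) U" "[:g:] = smult (fps_X ^ Suc n) V"
      using sum_squares_X_power_dvd by blast
    then have "f = fps_X ^ Suc n * coeff U 0" "g = fps_X ^ Suc n * coeff V 0"
      by (metis coeff_pCons_0 coeff_smult)+
    then show ?thesis by (simp only: fps_X_power_mult_nth) simp
  qed
  then show ?thesis by (simp add: fps_eq_iff)
qed


lemma coeff_pcompose_scale:
  fixes p :: "'a::comm_ring_1 poly"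
  shows "coeff (p \<circ>\<^sub>p [:0, a:]) j = coeff p j * a ^ j"
proof (induction p arbitrary: j)
  case (pCons b p)
  then show ?case by (cases j) (simp_all add: pcompose_pCons mult_ac)
qed simp

lemma ev2_pcompose_scale: "ev2 (Q \<circ>\<^sub>p [:0, a:]) t y = ev2 Q t (poly a t * y)"
  by (induction Q) (simp_all add: pcompose_pCons ev2_pCons mult_ac)

text \<open>Split off the exact power of t; the cofactor stays away from 0 near t = 0.\<close>

lemma poly_lower_bound_near_0:
  fixes a :: "real poly"
  assumes "a \<noteq> 0"
  obtains c \<delta> j where "c > 0" "\<delta> > 0" "\<And>t. \<bar>t\<bar> < \<delta> \<Longrightarrow> c * \<bar>t\<bar> ^ j \<le> \<bar>poly a t\<bar>"
proof -
  obtain b where b: "a = [:- 0, 1:] ^ order 0 a * b" "\<not> [:- 0, 1:] dvd b"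
    using order_decomp[OF assms] by blast
  have b0: "poly b 0 \<noteq> 0" using b(2) poly_eq_0_iff_dvd[of b 0] by simp
  have "(\<lambda>t. \<bar>poly b t\<bar>) \<midarrow>0\<rightarrow> \<bar>poly b 0\<bar>"
    by (intro tendsto_rabs) (metis isCont_def poly_isCont)
  then have "\<forall>\<^sub>F t in at 0. \<bar>poly b 0\<bar> / 2 < \<bar>poly b t\<bar>"
    by (rule order_tendstoD) (use b0 in simp)
  then obtain \<delta> where \<delta>: "\<delta> > 0" "\<And>t. t \<noteq> 0 \<Longrightarrow> \<bar>t\<bar> < \<delta> \<Longrightarrow> \<bar>poly b 0\<bar> / 2 < \<bar>poly b t\<bar>"
    by (auto simp: eventually_at dist_real_def)
  have le: "\<bar>poly b 0\<bar> / 2 \<le> \<bar>poly b t\<bar>" if "\<bar>t\<bar> < \<delta>" for t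
    using \<delta>(2)[of t] that by (cases "t = 0") auto
  have "\<bar>poly b 0\<bar> / 2 * \<bar>t\<bar> ^ order 0 a \<le> \<bar>poly a t\<bar>" if "\<bar>t\<bar> < \<delta>" for t
    by (subst b(1)) (use mult_right_mono[OF le[OF that], of "\<bar>t\<bar> ^ order 0 a"] in
      \<open>simp add: poly_power abs_mult power_abs mult.commute\<close>)
  then show ?thesis using that[of "\<bar>poly b 0\<bar> / 2" \<delta> "order 0 a"] b0 \<delta>(1) by simp
qed

text \<open>Write h = U + i V with real coefficients; then h times its conjugate is U^2 + V^2.
  \<open>E\<close> embeds real series into complex ones, so that the identity can be pulled
  back.\<close>

lemma complex_fps_poly_norm_eq_two_squares:
  fixes h :: "complex fps poly" and M :: "real poly poly"
  assumes "map_poly cx M = h * map_poly cj h"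
  obtains U V where "map_poly fps_of_poly M = U\<^sup>2 + V\<^sup>2"
proof -
  define E where "E f = Abs_fps (\<lambda>n. complex_of_real (f $ n))" for f
  interpret E: crhom E
  proof
    show "E (f * g) = E f * E g" for f g
      by (rule fps_ext) (simp add: E_def fps_mult_nth)
  qed (simp_all add: E_def fps_eq_iff)
  interpret mE: crhom "map_poly E" by (rule E.map_crhom)
  define U where "U = map_poly (\<lambda>f. Abs_fps (\<lambda>n. Re (f $ n))) h"
  define V where "V = map_poly (\<lambda>f. Abs_fps (\<lambda>n. Im (f $ n))) h"
  define I where "I = fps_const \<i>"
  have I2: "I * I = - 1" by (simp add: I_def)
  have cU: "coeff U j = Abs_fps (\<lambda>n. Re (coeff h j $ n))" for j
    unfolding U_def by (subst coeff_map_poly) (simp_all add: fps_eq_iff)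
  have cV: "coeff V j = Abs_fps (\<lambda>n. Im (coeff h j $ n))" for j
    unfolding V_def by (subst coeff_map_poly) (simp_all add: fps_eq_iff)
  have h: "h = map_poly E U + smult I (map_poly E V)"
    by (rule poly_eqI, rule fps_ext)
      (simp add: E.coeff_map cU cV E_def I_def complex_eq_iff)
  have hc: "map_poly cj h = map_poly E U - smult I (map_poly E V)"
    by (rule poly_eqI, rule fps_ext)
      (simp add: E.coeff_map cj.coeff_map cj_nth cU cV E_def I_def complex_eq_iff)
  have "map_poly cx M = (map_poly E U)\<^sup>2 - smult (I * I) ((map_poly E V)\<^sup>2)"
    unfolding assms h hc[unfolded h] by (simp add: power2_eq_square algebra_simps)
  also have "\<dots> = map_poly E (U\<^sup>2 + V\<^sup>2)"
    by (simp add: I2 mE.h_add mE.h_power)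
  finally have eq: "map_poly cx M = map_poly E (U\<^sup>2 + V\<^sup>2)" .
  have "map_poly fps_of_poly M = U\<^sup>2 + V\<^sup>2"
  proof (rule poly_eqI, rule fps_ext)
    fix j n
    have "cx (coeff M j) $ n = E (coeff (U\<^sup>2 + V\<^sup>2) j) $ n"
      using eq by (metis cx.coeff_map E.coeff_map)
    then have "coeff (coeff M j) n = coeff (U\<^sup>2 + V\<^sup>2) j $ n"
      by (simp only: cx_nth E_def fps_nth_Abs_fps of_real_eq_iff)
    then show "coeff (map_poly fps_of_poly M) j $ n = coeff (U\<^sup>2 + V\<^sup>2) j $ n"
      by (simp add: coeff_map_poly)
  qed
  then show ?thesis using that by blast
qed

lemma fps_poly_truncate:
  fixes U :: "real fps poly"
  obtains u W where "U = map_poly fps_of_poly u + smult (fps_X ^ N) W" "degree u \<le> degree U"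
proof
  define u where "u = map_poly (\<lambda>f. \<Sum>i<N. monom (f $ i) i) U"
  have cu: "coeff u j = (\<Sum>i<N. monom (coeff U j $ i) i)" for j
    unfolding u_def by (subst coeff_map_poly) simp_all
  show "U = map_poly fps_of_poly u + smult (fps_X ^ N) (map_poly (fps_shift N) U)"
    by (rule poly_eqI, rule fps_ext)
      (simp add: coeff_map_poly fps_X_power_mult_nth cu coeff_sum)
  show "degree u \<le> degree U"
    by (rule degree_le) (simp add: cu coeff_eq_0)
qed

lemma fps_of_poly_crhom: "crhom (fps_of_poly :: 'a::comm_ring_1 poly \<Rightarrow> 'a fps)"
  by standard (simp_all add: fps_of_poly_add fps_of_poly_mult)

interpretation fop: crhom "fps_of_poly :: real poly \<Rightarrow> real fps" by (rule fps_of_poly_crhom)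
interpretation mfop: crhom "map_poly (fps_of_poly :: real poly \<Rightarrow> real fps)" by (rule fop.map_crhom)

text \<open>With \<open>a\<close> the leading coefficient and \<open>n = 2 * d\<close>, the polynomial \<open>a ^ (n - 1) * P\<close> is monic in
  \<open>a * y\<close>. Since \<open>a \<ge> 0\<close> is itself a sum of two squares, so is \<open>a ^ n * P\<close>, and over the reals \<open>a ^ d\<close> must
  divide both summands.\<close>
lemma real_fps_poly_two_squares:
  fixes P :: "real poly poly"
  assumes psd: "\<And>t y. ev2 P t y \<ge> 0" and deg: "degree P = 2 * d" "d > 0"
    and "c > 0" "\<delta> > 0" and bound: "\<And>t y. \<bar>t\<bar> < \<delta> \<Longrightarrow> c * \<bar>t\<bar> ^ k \<le> ev2 P t y"
  shows "\<exists>U V. map_poly fps_of_poly P = U\<^sup>2 + V\<^sup>2"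
proof -
  define n where "n = 2 * d"
  have n: "n > 0" "degree P = n" using deg by (simp_all add: n_def)
  define a where "a = lead_coeff P"
  have a0: "a \<noteq> 0" using n by (auto simp: a_def)
  have apos: "poly a t \<ge> 0" for t unfolding a_def by (rule psd_lead_coeff(1)) (rule psd)
  obtain s1 s2 where s: "a = s1\<^sup>2 + s2\<^sup>2" using nonneg_poly_two_squares[of a] apos by blast
  define M where "M = monom 1 n + (\<Sum>j<n. monom (coeff P j * a ^ (n - 1 - j)) j)"
  have cM: "coeff M j = (if j = n then 1 else if j < n then coeff P j * a ^ (n - 1 - j) else 0)" for j
    by (auto simp: M_def coeff_sum)
  have dM: "degree M = n"
    by (intro le_antisym degree_le le_degree) (simp_all add: cM)
  have MP: "M \<circ>\<^sub>p [:0, a:] = smult (a ^ (n - 1)) P"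
  proof (rule poly_eqI)
    fix j
    consider "j < n" | "j = n" | "j > n" by linarith
    then show "coeff (M \<circ>\<^sub>p [:0, a:]) j = coeff (smult (a ^ (n - 1)) P) j"
    proof cases
      case 1
      then have "a ^ (n - 1) = a ^ (n - 1 - j) * a ^ j" by (simp flip: power_add)
      then show ?thesis using 1 by (simp add: coeff_pcompose_scale cM)
    next
      case 2
      have "a ^ n = a ^ (n - 1) * a" using n by (metis power_minus_mult)
      then show ?thesis using 2 n by (simp add: coeff_pcompose_scale cM a_def)
    next
      case 3
      then show ?thesis using n by (simp add: coeff_pcompose_scale cM coeff_eq_0)
    qed
  qed
  have evM: "ev2 M t (poly a t * y) = poly a t ^ (n - 1) * ev2 P t y" for t y
    using arg_cong[OF MP, of "\<lambda>Q. ev2 Q t y"]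
    by (simp add: ev2_pcompose_scale)
  obtain c0 \<delta>0 j where c0: "c0 > 0" "\<delta>0 > 0" "\<And>t. \<bar>t\<bar> < \<delta>0 \<Longrightarrow> c0 * \<bar>t\<bar> ^ j \<le> \<bar>poly a t\<bar>"
    using poly_lower_bound_near_0[OF a0] by metis
  \<comment> \<open>For t near 0 and not 0 the value a(t) is positive, and M(t, y) = a^(n-1) P(t, y
    / a) is a product of two factors bounded below by powers of |t|.\<close>
  have "no_real_branch (map_poly cx M)"
  proof (rule no_real_branchI)
    show "c0 ^ (n - 1) * c > 0" "min \<delta> \<delta>0 > 0" using c0 assms by simp_all
    fix t y :: real assume t: "0 < \<bar>t\<bar>" "\<bar>t\<bar> < min \<delta> \<delta>0"
    have le: "c0 * \<bar>t\<bar> ^ j \<le> poly a t" using c0(3)[of t] t apos[of t] by simp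
    have "c0 * \<bar>t\<bar> ^ j > 0" using c0 t by simp
    then have at: "poly a t > 0" using le by linarith
    have "c0 ^ (n - 1) * c * \<bar>t\<bar> ^ (j * (n - 1) + k) = (c0 * \<bar>t\<bar> ^ j) ^ (n - 1) * (c * \<bar>t\<bar> ^ k)"
      by (simp add: power_mult_distrib power_add power_mult)
    also have "\<dots> \<le> poly a t ^ (n - 1) * ev2 P t (y / poly a t)"
      using le \<open>c0 * \<bar>t\<bar> ^ j > 0\<close> bound[of t] t \<open>c > 0\<close> at by (intro mult_mono power_mono) auto
    also have "\<dots> = ev2 M t y" using evM[of t "y / poly a t"] at by simp
    finally show "c0 ^ (n - 1) * c * \<bar>t\<bar> ^ (j * (n - 1) + k) \<le> ev2 M t y" .
  qed
  moreover have "lead_coeff (map_poly cx M) = 1"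
    using cx.monic_map(1)[of M] dM by (simp add: cM)
  moreover have "map_poly cj (map_poly cx M) = map_poly cx M"
    by (rule poly_eqI, rule fps_ext) (simp add: cj.coeff_map cx.coeff_map cj_nth cx_nth)
  ultimately obtain h where "map_poly cx M = h * map_poly cj h"
    using conjugate_factorization by blast
  then obtain U V where UV: "map_poly fps_of_poly M = U\<^sup>2 + V\<^sup>2"
    by (rule complex_fps_poly_norm_eq_two_squares)
  define A where "A = fps_of_poly a"
  define Pf where "Pf = map_poly fps_of_poly P"
  interpret sc: crhom "\<lambda>p. p \<circ>\<^sub>p [:0, A:]" by (rule pcompose_crhom)
  have "map_poly fps_of_poly (M \<circ>\<^sub>p [:0, a:]) = map_poly fps_of_poly M \<circ>\<^sub>p [:0, A:]"
    by (rule poly_eqI)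
      (simp add: fop.coeff_map coeff_pcompose_scale fop.h_mult fop.h_power A_def)
  then have "smult (A ^ (n - 1)) Pf = (U\<^sup>2 + V\<^sup>2) \<circ>\<^sub>p [:0, A:]"
    unfolding MP Pf_def by (simp add: map_poly_smult fop.h_mult fop.h_power A_def UV)
  then have 1: "smult (A ^ (n - 1)) Pf = (U \<circ>\<^sub>p [:0, A:])\<^sup>2 + (V \<circ>\<^sub>p [:0, A:])\<^sup>2"
    by (simp only: sc.h_add sc.h_power)
  have A: "A = (fps_of_poly s1)\<^sup>2 + (fps_of_poly s2)\<^sup>2"
    by (simp only: A_def s fop.h_add fop.h_power)
  \<comment> \<open>One more factor \<open>A\<close>, itself a sum of two squares, raises the odd
    exponent n - 1 to n = 2 d, so that the multiplier becomes a square.\<close>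
  have "A ^ n = A * A ^ (n - 1)" using n(1) by (metis Suc_diff_1 power_Suc)
  then have "smult (A ^ n) Pf = [:A:] * smult (A ^ (n - 1)) Pf" by (simp add: mult.commute)
  also have "\<dots> = ([:fps_of_poly s1:]\<^sup>2 + [:fps_of_poly s2:]\<^sup>2) *
      ((U \<circ>\<^sub>p [:0, A:])\<^sup>2 + (V \<circ>\<^sub>p [:0, A:])\<^sup>2)"
    unfolding 1 by (subst A) (simp add: power2_eq_square)
  finally obtain U2 V2 where 2: "smult (A ^ n) Pf = U2\<^sup>2 + V2\<^sup>2"
    unfolding two_squares_mult by blast
  have "A \<noteq> 0" using a0 by (simp add: A_def)
  then have "A ^ d \<noteq> 0" by simp
  define J where "J = subdegree (A ^ d)"
  define w where "w = fps_shift J (A ^ d)"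
  \<comment> \<open>Dividing by A^d means dividing by X^J, which real anisotropy allows, and by the
    unit \<open>w\<close>.\<close>
  have Ad: "A ^ d = fps_X ^ J * w"
    using subdegree_decompose[of "A ^ d"] by (simp add: J_def w_def mult.commute)
  have w0: "w $ 0 \<noteq> 0" using \<open>A ^ d \<noteq> 0\<close> by (simp add: w_def J_def)
  have An: "A ^ n = (A ^ d)\<^sup>2" by (simp add: n_def power_even_eq)
  have "U2\<^sup>2 + V2\<^sup>2 = smult (fps_X ^ (2 * J)) (smult (w\<^sup>2) Pf)"
    unfolding 2[symmetric] An Ad by (simp add: power_mult_distrib power_even_eq)
  then obtain U3 V3 where 3: "U2 = smult (fps_X ^ J) U3" "V2 = smult (fps_X ^ J) V3"
    using sum_squares_X_power_dvd by blast
  have ww: "w * inverse w = 1" using w0 inverse_mult_eq_1' by blast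
  have cancel: "smult (A ^ d) (smult (inverse w) Q) = smult (fps_X ^ J) Q" for Q
    unfolding Ad by (simp add: mult.assoc ww)
  have "smult ((A ^ d)\<^sup>2) Pf = (smult (A ^ d) (smult (inverse w) U3))\<^sup>2 + (smult (A ^ d) (smult (inverse w) V3))\<^sup>2"
    unfolding cancel using 2 An 3 by simp
  also have "\<dots> = smult ((A ^ d)\<^sup>2) ((smult (inverse w) U3)\<^sup>2 + (smult (inverse w) V3)\<^sup>2)"
    by (simp only: smult_power smult_add_right)
  finally have "Pf = (smult (inverse w) U3)\<^sup>2 + (smult (inverse w) V3)\<^sup>2"
    using \<open>A ^ d \<noteq> 0\<close> by (metis power_not_zero smult_cancel)
  then show ?thesis unfolding Pf_def by blast
qed

text \<open>Truncate the series expression at t^N. The bound d on the y-degrees comes from the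
  absence of cancellation in U^2 + V^2, and truncation does not raise degrees.\<close>

lemma local_two_squares:
  fixes P :: "real poly poly"
  assumes psd: "\<And>t y. ev2 P t y \<ge> 0" and deg: "degree P = 2 * d"
    and "c > 0" "\<delta> > 0" and bound: "\<And>t y. \<bar>t\<bar> < \<delta> \<Longrightarrow> c * \<bar>t\<bar> ^ k \<le> ev2 P t y"
  shows "\<exists>u v. [:monom 1 N:] dvd P - (u\<^sup>2 + v\<^sup>2) \<and> degree u \<le> d \<and> degree v \<le> d"
proof (cases "d = 0")
  case True
  then obtain a where a: "P = [:a:]" using deg by (auto elim: degree_eq_zeroE)
  then obtain s1 s2 where "a = s1\<^sup>2 + s2\<^sup>2"
    using nonneg_poly_two_squares[of a] psd by auto
  then have "P - ([:s1:]\<^sup>2 + [:s2:]\<^sup>2) = 0" using a by (simp add: power2_eq_square)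
  then show ?thesis by (intro exI[of _ "[:s1:]"] exI[of _ "[:s2:]"]) simp
next
  case False
  then obtain U V where UV: "map_poly fps_of_poly P = U\<^sup>2 + V\<^sup>2"
    using real_fps_poly_two_squares[OF psd deg _ assms(3,4) bound] by blast
  have "degree (map_poly fps_of_poly P) = 2 * d"
    using deg by (subst degree_map_poly) auto
  then have dUV: "degree U \<le> d" "degree V \<le> d"
    using degree_sum_two_squares(1)[OF real_fps_sum_squares_eq_0, of U V] UV by auto
  obtain u U1 where u: "U = map_poly fps_of_poly u + smult (fps_X ^ N) U1" "degree u \<le> degree U"
    by (rule fps_poly_truncate)
  obtain v V1 where v: "V = map_poly fps_of_poly v + smult (fps_X ^ N) V1" "degree v \<le> degree V"
    by (rule fps_poly_truncate)
  have sq: "\<exists>W. (p + smult x q)\<^sup>2 = p\<^sup>2 + smult x W" for p q :: "real fps poly" and x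
    by (intro exI[of _ "2 * p * q + smult x (q\<^sup>2)"]) (simp add: power2_eq_square algebra_simps smult_add_right)
  obtain W1 where W1: "U\<^sup>2 = (map_poly fps_of_poly u)\<^sup>2 + smult (fps_X ^ N) W1"
    unfolding u using sq by blast
  obtain W2 where W2: "V\<^sup>2 = (map_poly fps_of_poly v)\<^sup>2 + smult (fps_X ^ N) W2"
    unfolding v using sq by blast
  define R where "R = P - (u\<^sup>2 + v\<^sup>2)"
  have "map_poly fps_of_poly R = smult (fps_X ^ N) (W1 + W2)"
    by (simp add: R_def mfop.h_diff mfop.h_add mfop.h_power UV W1 W2 smult_add_right)
  then have c: "fps_of_poly (coeff R j) = fps_X ^ N * coeff (W1 + W2) j" for j
    by (metis fop.coeff_map coeff_smult)
  have "monom 1 N dvd coeff R j" for j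
  proof -
    have "coeff (coeff R j) i = 0" if "i < N" for i
      using arg_cong[OF c[of j], of "\<lambda>f. f $ i"] that by (simp add: fps_X_power_mult_nth)
    then show ?thesis by (simp add: monom_1_dvd_iff')
  qed
  then have "[:monom 1 N:] dvd R" by (simp add: const_poly_dvd_iff)
  then show ?thesis using u(2) v(2) dUV unfolding R_def by (meson order.trans)
qed

lemma local_two_squares_at:
  fixes P :: "real poly poly"
  assumes psd: "\<And>t y. ev2 P t y \<ge> 0" and deg: "degree P = 2 * d"
    and "c > 0" "\<delta> > 0" and bound: "\<And>t y. \<bar>t - r\<bar> < \<delta> \<Longrightarrow> c * \<bar>t - r\<bar> ^ k \<le> ev2 P t y"
  shows "\<exists>u v. [:[:- r, 1:] ^ N:] dvd P - (u\<^sup>2 + v\<^sup>2) \<and> degree u \<le> d \<and> degree v \<le> d"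
proof -
  define \<sigma> where "\<sigma> = (\<lambda>s p :: real poly. p \<circ>\<^sub>p [:s, 1:])"
  have hom: "crhom (\<sigma> s)" for s unfolding \<sigma>_def by (rule pcompose_crhom)
  have mhom: "crhom (map_poly (\<sigma> s))" for s by (rule crhom.map_crhom[OF hom])
  have deg_map: "degree (map_poly (\<sigma> s) p) = degree p" for s p
  proof (rule degree_map_poly)
    show "\<sigma> s x \<noteq> 0" if "x \<noteq> 0" for x
      using that by (auto simp: \<sigma>_def pcompose_eq_0_iff)
  qed
  have inv: "map_poly (\<sigma> (- r)) (map_poly (\<sigma> r) p) = p" for p
  proof (rule poly_eqI)
    fix j
    have "q \<circ>\<^sub>p [:r, 1:] \<circ>\<^sub>p [:- r, 1:] = q" for q :: "real poly"
      by (simp flip: pcompose_assoc add: pcompose_pCons)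
    then show "coeff (map_poly (\<sigma> (- r)) (map_poly (\<sigma> r) p)) j = coeff p j"
      by (simp add: crhom.coeff_map[OF hom]) (simp add: \<sigma>_def)
  qed
  define P' where "P' = map_poly (\<sigma> r) P"
  have ev: "ev2 P' t y = ev2 P (t + r) y" for t y
    unfolding P'_def ev2_poly
    by (subst map_poly_map_poly) (simp_all add: o_def \<sigma>_def poly_pcompose add.commute)
  have "\<exists>u v. [:monom 1 N:] dvd P' - (u\<^sup>2 + v\<^sup>2) \<and> degree u \<le> d \<and> degree v \<le> d"
  proof (rule local_two_squares)
    show "ev2 P' t y \<ge> 0" for t y using psd ev by simp
    show "degree P' = 2 * d" using deg deg_map by (simp add: P'_def)
    show "c * \<bar>t\<bar> ^ k \<le> ev2 P' t y" if "\<bar>t\<bar> < \<delta>" for t y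
      using bound[of "t + r" y] that ev by simp
  qed (use assms in auto)
  then obtain u v Q where uv: "P' - (u\<^sup>2 + v\<^sup>2) = [:monom 1 N:] * Q" "degree u \<le> d" "degree v \<le> d"
    by blast
  interpret m: crhom "map_poly (\<sigma> (- r))" by (rule mhom)
  have "P - ((map_poly (\<sigma> (- r)) u)\<^sup>2 + (map_poly (\<sigma> (- r)) v)\<^sup>2) = map_poly (\<sigma> (- r)) ([:monom 1 N:] * Q)"
    using arg_cong[OF uv(1), of "map_poly (\<sigma> (- r))"]
    by (simp only: m.h_diff m.h_add m.h_power P'_def inv)
  also have "\<dots> = map_poly (\<sigma> (- r)) [:monom 1 N:] * map_poly (\<sigma> (- r)) Q"
    by (rule m.h_mult)
  also have "map_poly (\<sigma> (- r)) [:monom 1 N:] = [:[:- r, 1:] ^ N:]"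
    by (simp add: map_poly_pCons \<sigma>_def monom_altdef crhom.h_power[OF pcompose_crhom] pcompose_pCons)
  finally show ?thesis using uv deg_map by (metis dvd_triv_left)
qed

text \<open>Only the representatives u and v are interpolated. The Bezout idempotents lie in R[t],
  so the mixture keeps the bound on the degree in y.\<close>

lemma crt_two_squares:
  fixes P :: "real poly poly"
  assumes cop: "coprime m1 m2"
    and 1: "[:m1:] dvd P - (u1\<^sup>2 + v1\<^sup>2)" "degree u1 \<le> d" "degree v1 \<le> d"
    and 2: "[:m2:] dvd P - (u2\<^sup>2 + v2\<^sup>2)" "degree u2 \<le> d" "degree v2 \<le> d"
  shows "\<exists>u v. [:m1 * m2:] dvd P - (u\<^sup>2 + v\<^sup>2) \<and> degree u \<le> d \<and> degree v \<le> d"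
proof -
  obtain s t where st: "s * m1 + t * m2 = 1"
    using cop bezout_coefficients_fst_snd[of m1 m2] by (metis coprime_iff_gcd_eq_1)
  define mix where "mix a b = smult (t * m2) a + smult (s * m1) b" for a b :: "real poly poly"
  have m1: "mix a b - a = [:m1:] * (smult s (b - a))" for a b
  proof -
    have "t * m2 = 1 - s * m1" using st by (simp add: algebra_simps)
    then show ?thesis by (simp add: mix_def smult_diff_left smult_diff_right mult.commute)
  qed
  have m2: "mix a b - b = [:m2:] * (smult t (a - b))" for a b
  proof -
    have "s * m1 = 1 - t * m2" using st by (simp add: algebra_simps)
    then show ?thesis by (simp add: mix_def smult_diff_left smult_diff_right mult.commute)
  qed
  have sq: "[:m:] dvd a\<^sup>2 - b\<^sup>2" if "[:m:] dvd a - b" for m and a b :: "real poly poly"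
    using that by (metis dvd_mult2 square_diff_square_factored power2_eq_square mult.commute)
  define u v where "u = mix u1 u2" and "v = mix v1 v2"
  have "[:m1:] dvd u - u1" "[:m1:] dvd v - v1" "[:m2:] dvd u - u2" "[:m2:] dvd v - v2"
    unfolding u_def v_def m1 m2 by (rule dvd_triv_left)+
  then have s: "[:m1:] dvd u\<^sup>2 - u1\<^sup>2" "[:m1:] dvd v\<^sup>2 - v1\<^sup>2" "[:m2:] dvd u\<^sup>2 - u2\<^sup>2" "[:m2:] dvd v\<^sup>2 - v2\<^sup>2"
    using sq by blast+
  define R where "R = P - (u\<^sup>2 + v\<^sup>2)"
  have "R = (P - (u1\<^sup>2 + v1\<^sup>2)) - (u\<^sup>2 - u1\<^sup>2) - (v\<^sup>2 - v1\<^sup>2)" by (simp add: R_def)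
  then obtain R1 where R1: "R = [:m1:] * R1" using 1(1) s by (metis dvd_diff dvd_def)
  have "R = (P - (u2\<^sup>2 + v2\<^sup>2)) - (u\<^sup>2 - u2\<^sup>2) - (v\<^sup>2 - v2\<^sup>2)" by (simp add: R_def)
  then obtain R2 where R2: "R = [:m2:] * R2" using 2(1) s by (metis dvd_diff dvd_def)
  have "R = smult (s * m1 + t * m2) R" by (simp add: st)
  also have "\<dots> = smult (s * m1) ([:m2:] * R2) + smult (t * m2) ([:m1:] * R1)"
    using R1 R2 by (metis smult_add_left)
  also have "\<dots> = [:m1 * m2:] * (smult s R2 + smult t R1)"
    by (simp add: smult_add_right mult_ac)
  finally have "[:m1 * m2:] dvd R" by (metis dvd_triv_left)
  moreover have "degree u \<le> d" "degree v \<le> d"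
    unfolding u_def v_def mix_def
    by (intro degree_add_le order.trans[OF degree_smult_le] 1 2)+
  ultimately show ?thesis unfolding R_def by blast
qed

lemma two_squares_mod_roots:
  fixes P :: "real poly poly"
  assumes "finite S"
    and "\<And>r. r \<in> S \<Longrightarrow> \<exists>u v. [:[:- r, 1:] ^ N:] dvd P - (u\<^sup>2 + v\<^sup>2) \<and> degree u \<le> d \<and> degree v \<le> d"
  shows "\<exists>u v. [:(\<Prod>r\<in>S. [:- r, 1:]) ^ N:] dvd P - (u\<^sup>2 + v\<^sup>2) \<and> degree u \<le> d \<and> degree v \<le> d"
  using assms
proof (induction S rule: finite_induct)
  case empty
  have "[:1:] dvd P - (0\<^sup>2 + 0\<^sup>2)" by (simp flip: one_pCons)
  then show ?case by (intro exI[of _ 0]) simp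
next
  case (insert r S)
  obtain u1 v1 where 1: "[:[:- r, 1:] ^ N:] dvd P - (u1\<^sup>2 + v1\<^sup>2)" "degree u1 \<le> d" "degree v1 \<le> d"
    using insert.prems by blast
  obtain u2 v2 where 2: "[:(\<Prod>r\<in>S. [:- r, 1:]) ^ N:] dvd P - (u2\<^sup>2 + v2\<^sup>2)" "degree u2 \<le> d" "degree v2 \<le> d"
    using insert by blast
  have "coprime [:- r, 1:] (\<Prod>r\<in>S. [:- r, 1:])"
  proof (rule prod_coprime_right)
    fix s assume "s \<in> S"
    then have "r \<noteq> s" using insert.hyps by auto
    then have "\<not> [:- r, 1:] dvd [:- s, 1:]"
      using poly_eq_0_iff_dvd[of "[:- s, 1:]" r] by simp
    then show "coprime [:- r, 1:] [:- s, 1:]"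
      using prime_elem_linear_field_poly[of 1 "- r"] by (simp add: prime_elem_imp_coprime)
  qed
  then have "coprime ([:- r, 1:] ^ N) ((\<Prod>r\<in>S. [:- r, 1:]) ^ N)" by simp
  from crt_two_squares[OF this 1 2] show ?case
    by (simp only: prod.insert[OF insert.hyps] power_mult_distrib)
qed

section \<open>A Lojasiewicz inequality\<close>

lemma prime_factor_positive_degree:
  fixes g :: "real poly poly"
  assumes "degree g > 0"
  obtains p where "prime_elem p" "p dvd g" "degree p > 0"
proof -
  have "g \<noteq> 0" using assms by auto
  then obtain A where A: "\<And>x. x \<in># A \<Longrightarrow> prime_elem x" "normalize (prod_mset A) = normalize g"
    using prime_factorization_exists by metis
  have ex: "\<exists>x\<in>#A. degree x > 0"
  proof (rule ccontr)
    assume "\<not> (\<exists>x\<in>#A. degree x > 0)"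
    then have "\<forall>x\<in>#A. degree x = 0" by simp
    then have "degree (prod_mset A) = 0"
    proof (induction A)
      case (add x A)
      have "degree (x * prod_mset A) \<le> degree x + degree (prod_mset A)" by (rule degree_mult_le)
      then show ?case using add by simp
    qed simp
    moreover have "g dvd prod_mset A" using A(2) by (simp add: associated_iff_dvd)
    moreover have "prod_mset A \<noteq> 0" using A(2) \<open>g \<noteq> 0\<close> by (metis normalize_eq_0_iff)
    ultimately show False using assms dvd_imp_degree_le[of g "prod_mset A"] by simp
  qed
  then obtain x where x: "x \<in># A" "degree x > 0" by blast
  have "x dvd g" using A(2) dvd_prod_mset[OF x(1)] by (metis dvd_normalize_iff)
  then show ?thesis using that A(1) x by blast
qed

text \<open>R[t][y] is not a principal ideal ring, so a nonzero element g of least y-degree in the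
  ideal of P and its derivative replaces the gcd. A prime factor of g of positive y-degree divides
  every ideal element up to a factor from R[t], hence divides P and its derivative, and so occurs
  twice in P.\<close>

lemma squarefree_bezout:
  fixes P :: "real poly poly"
  assumes deg: "degree P > 0" and sqf: "\<And>p. degree p > 0 \<Longrightarrow> \<not> p\<^sup>2 dvd P"
  shows "\<exists>A B r. r \<noteq> 0 \<and> A * P + B * pderiv P = [:r:]"
proof -
  define I where "I = {A * P + B * pderiv P | A B. True}"
  have "P \<in> I" unfolding I_def by (intro CollectI exI[of _ 1] exI[of _ 0]) simp
  have "pderiv P \<in> I" unfolding I_def by (intro CollectI exI[of _ 0] exI[of _ 1]) simp
  define n where "n = (LEAST n. \<exists>g\<in>I. g \<noteq> 0 \<and> degree g = n)"
  have "P \<noteq> 0" using deg by auto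
  then have "\<exists>n. \<exists>g\<in>I. g \<noteq> 0 \<and> degree g = n" using \<open>P \<in> I\<close> by blast
  then have "\<exists>g\<in>I. g \<noteq> 0 \<and> degree g = n" unfolding n_def by (rule LeastI_ex)
  then obtain g where g: "g \<in> I" "g \<noteq> 0" "degree g = n" by blast
  have min: "n \<le> degree h" if "h \<in> I" "h \<noteq> 0" for h
    unfolding n_def using that by (intro Least_le) blast
  show ?thesis
  proof (cases "n = 0")
    case True
    then obtain r where "g = [:r:]" using g(3) by (auto elim: degree_eq_zeroE)
    moreover obtain A B where "g = A * P + B * pderiv P" using g(1) unfolding I_def by blast
    ultimately have "A * P + B * pderiv P = [:r:]" "r \<noteq> 0" using g(2) by auto
    then show ?thesis by blast
  next
    case False
    then obtain p where p: "prime_elem p" "p dvd g" "degree p > 0"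
      using prime_factor_positive_degree g(3) by blast
    have dvd: "p dvd f" if "f \<in> I" for f
    proof -
      \<comment> \<open>Division by g is possible only after scaling f by a power c of the leading
        coefficient of g; a prime of positive y-degree cannot divide c.\<close>
      obtain q r where qr: "pseudo_divmod f g = (q, r)" by force
      define c where "c = lead_coeff g ^ (Suc (degree f) - degree g)"
      have eq: "smult c f = g * q + r" and r: "r = 0 \<or> degree r < degree g"
        using pseudo_divmod[OF g(2) qr] by (simp_all add: c_def)
      obtain A1 B1 A2 B2 where "f = A1 * P + B1 * pderiv P" "g = A2 * P + B2 * pderiv P"
        using \<open>f \<in> I\<close> g(1) unfolding I_def by blast
      then have "r = ([:c:] * A1 - q * A2) * P + ([:c:] * B1 - q * B2) * pderiv P"
        using eq by (simp add: algebra_simps smult_add_right)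
      then have "r \<in> I" unfolding I_def by blast
      then have "r = 0" using min[of r] r g(3) not_le by blast
      then have "p dvd [:c:] * f" using eq p(2) by simp
      moreover have "\<not> p dvd [:c:]"
      proof
        assume "p dvd [:c:]"
        moreover have "[:c:] \<noteq> 0" using g(2) by (simp add: c_def)
        ultimately show False using p(3) dvd_imp_degree_le[of p "[:c:]"] by simp
      qed
      ultimately show "p dvd f" using p(1) prime_elem_dvd_mult_iff by blast
    qed
    obtain k where k: "P = p * k" using dvd[OF \<open>P \<in> I\<close>] by blast
    have "p dvd pderiv p * k + p * pderiv k"
      using dvd[OF \<open>pderiv P \<in> I\<close>] by (simp add: k pderiv_mult mult.commute add.commute)
    then have "p dvd pderiv p * k" by (simp add: dvd_add_left_iff)
    moreover have "\<not> p dvd pderiv p"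
    proof
      assume "p dvd pderiv p"
      moreover have "pderiv p \<noteq> 0" using p(3) by (simp add: pderiv_eq_0_iff)
      ultimately have "degree p \<le> degree (pderiv p)" by (rule dvd_imp_degree_le)
      then show False using p(3) by (simp add: degree_pderiv)
    qed
    ultimately have "p dvd k" using p(1) prime_elem_dvd_mult_iff by blast
    then have "p\<^sup>2 dvd P" by (simp add: k power2_eq_square mult_dvd_mono)
    then show ?thesis using sqf p(3) by blast
  qed
qed

text \<open>Dividing is immediate away from the zeros of p. Continuity in y covers the fibres on
  which p is not identically 0, and continuity in t covers the remaining finitely many.\<close>

lemma psd_divide_square:
  assumes "\<And>t y. ev2 (p\<^sup>2 * P) t y \<ge> 0" "p \<noteq> 0"
  shows "ev2 P t y \<ge> 0"
proof -
  have "ev2 P t y \<ge> 0" if t: "poly (lead_coeff p) t \<noteq> 0" for t y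
  proof -
    define q where "q = map_poly (\<lambda>c. poly c t) p"
    have "coeff q (degree p) \<noteq> 0" using t by (simp add: q_def coeff_map_poly)
    then have "q \<noteq> 0" by auto
    have "poly (map_poly (\<lambda>c. poly c t) P) x \<ge> 0" if "x \<notin> {x. poly q x = 0}" for x
    proof -
      have "0 \<le> (poly q x)\<^sup>2 * ev2 P t x" using assms(1)[of t x] by (simp add: q_def flip: ev2_poly)
      then show ?thesis using that by (simp add: zero_le_mult_iff ev2_poly)
    qed
    then show ?thesis
      unfolding ev2_poly by (rule poly_nonneg_cofinite[OF poly_roots_finite[OF \<open>q \<noteq> 0\<close>]])
  qed
  then have "poly (poly P [:y:]) x \<ge> 0" if "x \<notin> {x. poly (lead_coeff p) x = 0}" for x
    using that by (simp add: ev2_def)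
  moreover have "finite {x. poly (lead_coeff p) x = 0}"
    by (rule poly_roots_finite) (use assms(2) in simp)
  ultimately show ?thesis unfolding ev2_def using poly_nonneg_cofinite by blast
qed

lemma poly_growth_bound:
  fixes q :: "real poly"
  obtains C \<kappa> where "C > 0" "\<And>t. \<bar>poly q t\<bar> \<le> C * (1 + t\<^sup>2) ^ \<kappa>"
proof -
  have "\<exists>C>0. \<exists>\<kappa>. \<forall>t. \<bar>poly q t\<bar> \<le> C * (1 + t\<^sup>2) ^ \<kappa>"
  proof (induction q)
    case 0
    then show ?case by (intro exI[of _ 1]) simp
  next
    case (pCons a q)
    then obtain C \<kappa> where C: "C > 0" "\<And>t. \<bar>poly q t\<bar> \<le> C * (1 + t\<^sup>2) ^ \<kappa>" by blast
    have "\<bar>poly (pCons a q) t\<bar> \<le> (\<bar>a\<bar> + C) * (1 + t\<^sup>2) ^ Suc \<kappa>" for t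
    proof -
      have t: "\<bar>t\<bar> \<le> 1 + t\<^sup>2"
        using zero_le_power2[of "\<bar>t\<bar> - 1"] by (simp add: power2_diff)
      have "\<bar>poly (pCons a q) t\<bar> \<le> \<bar>a\<bar> * 1 + \<bar>t\<bar> * \<bar>poly q t\<bar>"
        by (simp add: abs_mult[symmetric] abs_triangle_ineq)
      also have "\<dots> \<le> \<bar>a\<bar> * (1 + t\<^sup>2) ^ Suc \<kappa> + (1 + t\<^sup>2) * (C * (1 + t\<^sup>2) ^ \<kappa>)"
        using t C by (intro add_mono mult_mono one_le_power) auto
      finally show ?thesis by (simp add: algebra_simps)
    qed
    then show ?case
      using C(1) by (intro exI[of _ "\<bar>a\<bar> + C"] conjI exI[of _ "Suc \<kappa>"] allI) simp_all
  qed
  then show ?thesis using that by blast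
qed

lemma poly2_growth_bound:
  obtains C \<kappa> where "C > 0" "\<And>t y. \<bar>ev2 Q t y\<bar> \<le> C * (1 + t\<^sup>2) ^ \<kappa> * (1 + y\<^sup>2) ^ \<kappa>"
proof -
  have "\<exists>C>0. \<exists>\<kappa>. \<forall>t y. \<bar>ev2 Q t y\<bar> \<le> C * (1 + t\<^sup>2) ^ \<kappa> * (1 + y\<^sup>2) ^ \<kappa>"
  proof (induction Q)
    case 0
    then show ?case by (intro exI[of _ 1]) simp
  next
    case (pCons a Q)
    then obtain C \<kappa> where C: "C > 0" "\<And>t y. \<bar>ev2 Q t y\<bar> \<le> C * (1 + t\<^sup>2) ^ \<kappa> * (1 + y\<^sup>2) ^ \<kappa>" by blast
    obtain D \<mu> where D: "D > 0" "\<And>t. \<bar>poly a t\<bar> \<le> D * (1 + t\<^sup>2) ^ \<mu>"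
      using poly_growth_bound by blast
    define \<nu> where "\<nu> = max \<mu> (Suc \<kappa>)"
    have "\<bar>ev2 (pCons a Q) t y\<bar> \<le> (D + C) * (1 + t\<^sup>2) ^ \<nu> * (1 + y\<^sup>2) ^ \<nu>" for t y
    proof -
      have y: "\<bar>y\<bar> \<le> 1 + y\<^sup>2"
        using zero_le_power2[of "\<bar>y\<bar> - 1"] by (simp add: power2_diff)
      have "\<bar>ev2 (pCons a Q) t y\<bar> \<le> \<bar>poly a t\<bar> * 1 + \<bar>y\<bar> * \<bar>ev2 Q t y\<bar>"
        by (simp add: ev2_pCons abs_mult[symmetric] abs_triangle_ineq)
      also have "\<dots> \<le> (D * (1 + t\<^sup>2) ^ \<mu>) * (1 + y\<^sup>2) ^ \<nu> + (1 + y\<^sup>2) * (C * (1 + t\<^sup>2) ^ \<kappa> * (1 + y\<^sup>2) ^ \<kappa>)"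
        using y C D by (intro add_mono mult_mono one_le_power) auto
      also have "\<dots> = (D * (1 + t\<^sup>2) ^ \<mu>) * (1 + y\<^sup>2) ^ \<nu> + C * (1 + t\<^sup>2) ^ \<kappa> * (1 + y\<^sup>2) ^ Suc \<kappa>"
        by (simp add: algebra_simps)
      also have "\<dots> \<le> (D * (1 + t\<^sup>2) ^ \<nu>) * (1 + y\<^sup>2) ^ \<nu> + C * (1 + t\<^sup>2) ^ \<nu> * (1 + y\<^sup>2) ^ \<nu>"
        using C(1) D(1) by (intro add_mono mult_mono power_increasing order.refl) (auto simp: \<nu>_def)
      finally show ?thesis by (simp add: algebra_simps)
    qed
    then show ?case using C(1) D(1) by (intro exI[of _ "D + C"]) auto
  qed
  then show ?thesis using that by blast
qed

text \<open>The quotient attains its minimum on the compact interval, either at the boundary or at a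
  critical point; the equation is the vanishing derivative cleared of denominators.\<close>

lemma minimum_dichotomy:
  fixes p :: "real poly"
  assumes "L \<ge> 0"
  shows "\<exists>y0. \<bar>y0\<bar> \<le> L \<and> (\<forall>y. \<bar>y\<bar> \<le> L \<longrightarrow> poly p y0 / (1 + y0\<^sup>2) ^ d \<le> poly p y / (1 + y\<^sup>2) ^ d) \<and>
    (\<bar>y0\<bar> = L \<or> poly (pderiv p) y0 * (1 + y0\<^sup>2) = poly p y0 * (2 * real d * y0))"
proof -
  define h where "h y = poly p y / (1 + y\<^sup>2) ^ d" for y
  have pos: "1 + y\<^sup>2 > 0" for y :: real by (simp add: add_pos_nonneg)
  have nz: "(1 + y\<^sup>2) ^ d \<noteq> 0" for y :: real using pos[of y] by simp
  have "continuous_on {-L..L} h"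
    unfolding h_def using nz by (intro continuous_intros) auto
  then obtain y0 where y0: "y0 \<in> {-L..L}" "\<And>y. y \<in> {-L..L} \<Longrightarrow> h y0 \<le> h y"
    using continuous_attains_inf[of "{-L..L}" h] assms by auto
  show ?thesis
  proof (intro exI[of _ y0] conjI allI impI)
    show "\<bar>y0\<bar> \<le> L" using y0(1) by auto
    show "poly p y0 / (1 + y0\<^sup>2) ^ d \<le> poly p y / (1 + y\<^sup>2) ^ d" if "\<bar>y\<bar> \<le> L" for y
      using y0(2)[of y] that by (simp add: h_def abs_le_iff)
    show "\<bar>y0\<bar> = L \<or> poly (pderiv p) y0 * (1 + y0\<^sup>2) = poly p y0 * (2 * real d * y0)"
    proof (cases "\<bar>y0\<bar> = L")
      case False
      then have lt: "\<bar>y0\<bar> < L" using y0(1) by auto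
      define D where "D = (poly (pderiv p) y0 * (1 + y0\<^sup>2) ^ d - poly p y0 * (d * (2 * y0 * (1 + y0\<^sup>2) ^ (d - 1)))) /
          ((1 + y0\<^sup>2) ^ d * (1 + y0\<^sup>2) ^ d)"
      have "(h has_real_derivative D) (at y0)"
        unfolding h_def D_def using nz[of y0]
        by (auto intro!: derivative_eq_intros poly_DERIV)
      moreover have "\<forall>y. \<bar>y0 - y\<bar> < L - \<bar>y0\<bar> \<longrightarrow> h y0 \<le> h y"
      proof (intro allI impI)
        fix y assume "\<bar>y0 - y\<bar> < L - \<bar>y0\<bar>"
        then have "y \<in> {-L..L}" by (simp add: abs_if split: if_splits)
        then show "h y0 \<le> h y" by (rule y0(2))
      qed
      ultimately have "D = 0" using DERIV_local_min lt by (metis diff_gt_0_iff_gt)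
      then have eq1: "poly (pderiv p) y0 * (1 + y0\<^sup>2) ^ d = poly p y0 * (d * (2 * y0 * (1 + y0\<^sup>2) ^ (d - 1)))"
        using pos[of y0] by (simp add: D_def)
      have eq2: "(1 + y0\<^sup>2) ^ d * (2 * real d * y0) = (1 + y0\<^sup>2) * (d * (2 * y0 * (1 + y0\<^sup>2) ^ (d - 1)))"
        by (cases d) simp_all
      have "(1 + y0\<^sup>2) ^ d * (poly (pderiv p) y0 * (1 + y0\<^sup>2)) = poly p y0 * ((1 + y0\<^sup>2) ^ d * (2 * real d * y0))"
      proof -
        have "(1 + y0\<^sup>2) ^ d * (poly (pderiv p) y0 * (1 + y0\<^sup>2)) = (poly (pderiv p) y0 * (1 + y0\<^sup>2) ^ d) * (1 + y0\<^sup>2)"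
          by (simp only: mult_ac)
        then show ?thesis unfolding eq1 eq2 by (simp only: mult_ac)
      qed
      then have "(1 + y0\<^sup>2) ^ d * (poly (pderiv p) y0 * (1 + y0\<^sup>2)) = (1 + y0\<^sup>2) ^ d * (poly p y0 * (2 * real d * y0))"
        by (simp only: mult_ac)
      then show ?thesis using pos[of y0] by simp
    qed simp
  qed
qed

lemma ev2_pderiv: "ev2 (pderiv P) t y = poly (pderiv (map_poly (\<lambda>c. poly c t) P)) y"
proof -
  have "map_poly (\<lambda>c. poly c t) (pderiv P) = pderiv (map_poly (\<lambda>c. poly c t) P)"
    by (rule poly_eqI) (simp add: coeff_pderiv coeff_map_poly)
  then show ?thesis by (simp add: ev2_poly)
qed

text \<open>For |y| >= 1 the lower terms are at most C (1 + t^2)^\<open>\<kappa>\<close> |y|^(2 d -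
  1), which is half the leading term once a |y| is large. The power \<open>2 ^ (d + 1)\<close>
  combines that half with (1 + y^2)^d <= 2^d y^(2 d).\<close>

lemma leading_term_dominates:
  fixes P :: "real poly poly"
  assumes psd: "\<And>t y. ev2 P t y \<ge> 0" and deg: "degree P = 2 * d" "d > 0"
  obtains C \<kappa> where "C > 0"
    "\<And>t y. \<lbrakk>\<bar>y\<bar> \<ge> 1; C * (1 + t\<^sup>2) ^ \<kappa> \<le> poly (lead_coeff P) t * \<bar>y\<bar>\<rbrakk> \<Longrightarrow>
        poly (lead_coeff P) t / 2 ^ (d + 1) * (1 + y\<^sup>2) ^ d \<le> ev2 P t y"
proof -
  define R where "R = P - monom (lead_coeff P) (2 * d)"
  have cR: "coeff R j = (if j < 2 * d then coeff P j else 0)" for j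
    using deg(1) by (auto simp: R_def coeff_eq_0)
  then have dR: "degree R \<le> 2 * d - 1" using deg(2) by (intro degree_le) auto
  have "\<exists>C. C \<ge> 0 \<and> (\<exists>\<kappa>. \<forall>t. (\<Sum>j\<le>n. \<bar>poly (coeff R j) t\<bar>) \<le> C * (1 + t\<^sup>2) ^ \<kappa>)" for n
  proof (induction n)
    case 0
    obtain C \<kappa> where "C > 0" "\<And>t. \<bar>poly (coeff R 0) t\<bar> \<le> C * (1 + t\<^sup>2) ^ \<kappa>"
      using poly_growth_bound by blast
    then show ?case by (intro exI[of _ C] conjI exI[of _ \<kappa>]) simp_all
  next
    case (Suc n)
    then obtain C \<kappa> where C: "C \<ge> 0" "\<And>t. (\<Sum>j\<le>n. \<bar>poly (coeff R j) t\<bar>) \<le> C * (1 + t\<^sup>2) ^ \<kappa>" by blast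
    obtain D \<mu> where D: "D > 0" "\<And>t. \<bar>poly (coeff R (Suc n)) t\<bar> \<le> D * (1 + t\<^sup>2) ^ \<mu>"
      using poly_growth_bound by blast
    have "(\<Sum>j\<le>Suc n. \<bar>poly (coeff R j) t\<bar>) \<le> (C + D) * (1 + t\<^sup>2) ^ max \<kappa> \<mu>" for t
    proof -
      have "(\<Sum>j\<le>Suc n. \<bar>poly (coeff R j) t\<bar>) \<le> C * (1 + t\<^sup>2) ^ \<kappa> + D * (1 + t\<^sup>2) ^ \<mu>"
        using C(2)[of t] D(2)[of t] by simp
      also have "\<dots> \<le> C * (1 + t\<^sup>2) ^ max \<kappa> \<mu> + D * (1 + t\<^sup>2) ^ max \<kappa> \<mu>"
        using C D by (intro add_mono mult_left_mono power_increasing) auto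
      finally show ?thesis by (simp add: algebra_simps)
    qed
    then show ?case using C(1) D(1) by (intro exI[of _ "C + D"]) auto
  qed
  then obtain C \<kappa> where C: "C \<ge> 0" "\<And>t. (\<Sum>j\<le>2 * d - 1. \<bar>poly (coeff R j) t\<bar>) \<le> C * (1 + t\<^sup>2) ^ \<kappa>"
    by blast
  show ?thesis
  proof (rule that[of "2 * C + 1" \<kappa>])
    show "2 * C + 1 > 0" using C by simp
    fix t y :: real
    define a where "a = poly (lead_coeff P) t"
    assume y: "\<bar>y\<bar> \<ge> 1" and "(2 * C + 1) * (1 + t\<^sup>2) ^ \<kappa> \<le> poly (lead_coeff P) t * \<bar>y\<bar>"
    have ay: "2 * (C * (1 + t\<^sup>2) ^ \<kappa>) \<le> a * \<bar>y\<bar>"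
    proof -
      have "(2 * C + 1) * (1 + t\<^sup>2) ^ \<kappa> = 2 * (C * (1 + t\<^sup>2) ^ \<kappa>) + (1 + t\<^sup>2) ^ \<kappa>"
        by (simp add: algebra_simps)
      moreover have "(1 + t\<^sup>2) ^ \<kappa> \<ge> 0" by simp
      ultimately show ?thesis
        using \<open>(2 * C + 1) * (1 + t\<^sup>2) ^ \<kappa> \<le> poly (lead_coeff P) t * \<bar>y\<bar>\<close>
        unfolding a_def by linarith
    qed
    have a0: "a \<ge> 0" unfolding a_def by (rule psd_lead_coeff(1)) (rule psd)
    have "\<bar>ev2 R t y\<bar> \<le> (\<Sum>j\<le>2 * d - 1. \<bar>poly (coeff R j) t * y ^ j\<bar>)"
      by (subst ev2_sum[OF dR]) (rule sum_abs)
    also have "\<dots> \<le> (\<Sum>j\<le>2 * d - 1. \<bar>poly (coeff R j) t\<bar> * \<bar>y\<bar> ^ (2 * d - 1))"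
      using y by (intro sum_mono) (simp add: abs_mult power_abs mult_left_mono power_increasing)
    also have "\<dots> \<le> C * (1 + t\<^sup>2) ^ \<kappa> * \<bar>y\<bar> ^ (2 * d - 1)"
      using C(2)[of t] by (simp add: sum_distrib_right[symmetric] mult_right_mono)
    also have "\<dots> \<le> a * \<bar>y\<bar> / 2 * \<bar>y\<bar> ^ (2 * d - 1)"
      using ay by (intro mult_right_mono) auto
    also have "\<dots> = a / 2 * (y\<^sup>2) ^ d"
    proof -
      have "\<bar>y\<bar> * \<bar>y\<bar> ^ (2 * d - 1) = \<bar>y\<bar> ^ (2 * d)"
        using deg(2) by (metis Suc_diff_1 power_Suc nat_0_less_mult_iff zero_less_numeral)
      then show ?thesis by (simp add: power_mult)
    qed
    finally have R: "\<bar>ev2 R t y\<bar> \<le> a / 2 * (y\<^sup>2) ^ d" .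
    have "ev2 P t y = a * (y\<^sup>2) ^ d + ev2 R t y"
    proof -
      have "ev2 (monom (lead_coeff P) (2 * d)) t y = a * (y\<^sup>2) ^ d"
        by (simp add: ev2_def poly_monom a_def power_mult flip: poly_power)
          (simp add: poly_const_pow[symmetric] poly_power)
      then show ?thesis by (simp add: R_def)
    qed
    then have "a / 2 * (y\<^sup>2) ^ d \<le> ev2 P t y" using R by linarith
    moreover have "a / 2 * ((1 + y\<^sup>2) / 2) ^ d \<le> a / 2 * (y\<^sup>2) ^ d"
    proof -
      have "1 \<le> y\<^sup>2" using y by (metis one_le_power power2_abs)
      then show ?thesis using a0 by (intro mult_left_mono power_mono) auto
    qed
    ultimately show "a / 2 ^ (d + 1) * (1 + y\<^sup>2) ^ d \<le> ev2 P t y"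
      by (simp add: power_divide)
  qed
qed

text \<open>At a minimiser \<open>y0\<close> of \<open>P / (1 + y\<^sup>2) ^ d\<close> the derivative of \<open>P\<close> in \<open>y\<close> is a multiple of \<open>P\<close>, so the
  Bezout identity bounds \<open>P\<close> from below by a multiple of \<open>r\<close>; for large \<open>y\<close> the leading term dominates.\<close>
lemma lojasiewicz_bound:
  fixes P :: "real poly poly"
  assumes psd: "\<And>t y. ev2 P t y \<ge> 0" and deg: "degree P = 2 * d" "d > 0"
    and bezout: "A * P + B * pderiv P = [:r:]" "r \<noteq> 0"
  obtains \<epsilon> w \<kappa> where "\<epsilon> > 0" "w \<noteq> 0"
    "\<And>t y. \<epsilon> * (poly w t)\<^sup>2 * (1 + y\<^sup>2) ^ d \<le> ev2 P t y * (1 + t\<^sup>2) ^ \<kappa>"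
proof -
  define a where "a = lead_coeff P"
  have "P \<noteq> 0" using deg by auto
  then have a0: "a \<noteq> 0" by (simp only: a_def leading_coeff_0_iff not_False_eq_True)
  have apos: "poly a t \<ge> 0" for t unfolding a_def by (rule psd_lead_coeff(1)) (rule psd)
  obtain C1 \<kappa>1 where C1: "C1 > 0"
    "\<And>t y. \<lbrakk>\<bar>y\<bar> \<ge> 1; C1 * (1 + t\<^sup>2) ^ \<kappa>1 \<le> poly a t * \<bar>y\<bar>\<rbrakk> \<Longrightarrow>
        poly a t / 2 ^ (d + 1) * (1 + y\<^sup>2) ^ d \<le> ev2 P t y"
    using leading_term_dominates[OF psd deg] unfolding a_def by metis
  obtain CA \<kappa>A where CA: "CA > 0" "\<And>t y. \<bar>ev2 A t y\<bar> \<le> CA * (1 + t\<^sup>2) ^ \<kappa>A * (1 + y\<^sup>2) ^ \<kappa>A"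
    using poly2_growth_bound by blast
  obtain CB \<kappa>B where CB: "CB > 0" "\<And>t y. \<bar>ev2 B t y\<bar> \<le> CB * (1 + t\<^sup>2) ^ \<kappa>B * (1 + y\<^sup>2) ^ \<kappa>B"
    using poly2_growth_bound by blast
  define C2 \<kappa>2 where "C2 = CA + 2 * d * CB" and "\<kappa>2 = max \<kappa>A \<kappa>B"
  have "C2 > 0" using CA CB deg by (simp add: C2_def add_pos_nonneg)
  \<comment> \<open>The powers of 1 + y0^2 to be controlled: \<open>\<kappa>2\<close> from the
    Bezout cofactors and \<open>d\<close> from the weight.\<close>
  define m where "m = \<kappa>2 + d"
  define T where "T = ([:1, 0, 1:] :: real poly)"
  have T: "poly T t = 1 + t\<^sup>2" for t by (simp add: T_def power2_eq_square)
  \<comment> \<open>Bounds (1 + y0^2) a^2 for |y0| <= L, by L^2 <= 2 + 2 (C1 (1 +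
    t^2)^\<open>\<kappa>1\<close> / a)^2.\<close>
  define B3 where "B3 = 3 * a\<^sup>2 + smult (2 * C1\<^sup>2) (T ^ (2 * \<kappa>1))"
  \<comment> \<open>\<open>G1\<close> is what the estimate at a critical point requires to be
    bounded, \<open>G2\<close> what the estimate by the leading term requires; \<open>D\<close> and
    \<open>\<kappa>\<close> serve both.\<close>
  define G1 where "G1 = smult C2 (r * a\<^sup>2 * T ^ \<kappa>2 * B3 ^ m)"
  define G2 where "G2 = smult (2 ^ (d + 1)) (r\<^sup>2 * a ^ (2 * m + 1))"
  obtain D1 \<mu>1 where D1: "D1 > 0" "\<And>t. \<bar>poly G1 t\<bar> \<le> D1 * (1 + t\<^sup>2) ^ \<mu>1"
    using poly_growth_bound by blast
  obtain D2 \<mu>2 where D2: "D2 > 0" "\<And>t. \<bar>poly G2 t\<bar> \<le> D2 * (1 + t\<^sup>2) ^ \<mu>2"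
    using poly_growth_bound by blast
  define D \<kappa> where "D = D1 + D2" and "\<kappa> = max \<mu>1 \<mu>2"
  have D: "D > 0" using D1 D2 by (simp add: D_def)
  have G: "\<bar>poly G1 t\<bar> \<le> D * (1 + t\<^sup>2) ^ \<kappa>" "\<bar>poly G2 t\<bar> \<le> D * (1 + t\<^sup>2) ^ \<kappa>" for t
  proof -
    have "D1 * (1 + t\<^sup>2) ^ \<mu>1 \<le> D * (1 + t\<^sup>2) ^ \<kappa>" "D2 * (1 + t\<^sup>2) ^ \<mu>2 \<le> D * (1 + t\<^sup>2) ^ \<kappa>"
      using D1 D2 by (auto simp: D_def \<kappa>_def intro!: mult_mono power_increasing)
    then show "\<bar>poly G1 t\<bar> \<le> D * (1 + t\<^sup>2) ^ \<kappa>" "\<bar>poly G2 t\<bar> \<le> D * (1 + t\<^sup>2) ^ \<kappa>"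
      using D1(2)[of t] D2(2)[of t] by linarith+
  qed
  \<comment> \<open>In w^2 the factor a^(2 m) absorbs (1 + y0^2)^m through \<open>B3\<close>. Where
    r or a vanishes, w vanishes and only P >= 0 is claimed.\<close>
  define w where "w = r * a ^ (m + 1)"
  have main: "1 / D * (poly w t)\<^sup>2 * (1 + y\<^sup>2) ^ d \<le> ev2 P t y * (1 + t\<^sup>2) ^ \<kappa>" for t y
  proof (cases "poly a t = 0 \<or> poly r t = 0")
    case True
    then have "poly w t = 0" by (auto simp: w_def)
    then show ?thesis using psd by simp
  next
    case False
    define \<alpha> \<rho> \<tau> where "\<alpha> = poly a t" and "\<rho> = \<bar>poly r t\<bar>" and "\<tau> = 1 + t\<^sup>2"
    have \<alpha>: "\<alpha> > 0" using False apos[of t] by (simp add: \<alpha>_def)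
    have \<rho>: "\<rho> > 0" using False by (simp add: \<rho>_def)
    have \<tau>: "\<tau> \<ge> 1" by (simp add: \<tau>_def)
    have w2: "(poly w t)\<^sup>2 = \<rho>\<^sup>2 * \<alpha> ^ (2 * m + 2)"
      by (simp add: w_def \<rho>_def \<alpha>_def power_mult_distrib poly_power power_even_eq[of _ "m + 1", simplified])
    \<comment> \<open>Chosen so that |y| >= L satisfies both conditions of the leading-term
      estimate.\<close>
    define L where "L = 1 + C1 * \<tau> ^ \<kappa>1 / \<alpha>"
    have L1: "L \<ge> 1" using C1(1) \<alpha> \<tau> by (simp add: L_def)
    have far: "\<alpha> / 2 ^ (d + 1) \<le> ev2 P t y / (1 + y\<^sup>2) ^ d" if "\<bar>y\<bar> \<ge> L" for y
    proof -
      have "C1 * \<tau> ^ \<kappa>1 \<le> \<alpha> * L" using \<alpha> by (simp add: L_def field_simps)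
      also have "\<dots> \<le> \<alpha> * \<bar>y\<bar>" using that \<alpha> by simp
      finally have "\<alpha> / 2 ^ (d + 1) * (1 + y\<^sup>2) ^ d \<le> ev2 P t y"
        using C1(2)[of y t] that L1 by (simp add: \<alpha>_def \<tau>_def)
      moreover have "(1 + y\<^sup>2) ^ d > 0" by (intro zero_less_power) (simp add: add_pos_nonneg)
      ultimately show ?thesis by (simp add: pos_le_divide_eq)
    qed
    have goal1: "1 / D * (poly w t)\<^sup>2 \<le> \<alpha> / 2 ^ (d + 1) * \<tau> ^ \<kappa>"
    proof -
      have "poly G2 t = 2 ^ (d + 1) * (\<rho>\<^sup>2 * \<alpha> ^ (2 * m + 1))"
        by (simp add: G2_def \<rho>_def \<alpha>_def poly_power)
      then have "2 ^ (d + 1) * (\<rho>\<^sup>2 * \<alpha> ^ (2 * m + 1)) \<le> D * \<tau> ^ \<kappa>"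
        using G(2)[of t] by (simp add: \<tau>_def)
      then have "\<alpha> * (2 ^ (d + 1) * (\<rho>\<^sup>2 * \<alpha> ^ (2 * m + 1))) \<le> \<alpha> * (D * \<tau> ^ \<kappa>)"
        using \<alpha> by (intro mult_left_mono) auto
      then show ?thesis using D by (simp add: w2 field_simps)
    qed
    have "L \<ge> 0" using L1 by simp
    from minimum_dichotomy[OF this, of "map_poly (\<lambda>c. poly c t) P" d]
    obtain y0 where y0: "\<bar>y0\<bar> \<le> L"
      "\<And>y. \<bar>y\<bar> \<le> L \<Longrightarrow> ev2 P t y0 / (1 + y0\<^sup>2) ^ d \<le> ev2 P t y / (1 + y\<^sup>2) ^ d"
      "\<bar>y0\<bar> = L \<or> ev2 (pderiv P) t y0 * (1 + y0\<^sup>2) = ev2 P t y0 * (2 * real d * y0)"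
      unfolding ev2_pderiv[symmetric] unfolding ev2_poly[symmetric] by (elim exE conjE) (rule that; simp)
    have near: "1 / D * (poly w t)\<^sup>2 \<le> ev2 P t y0 / (1 + y0\<^sup>2) ^ d * \<tau> ^ \<kappa>"
      using y0(3)
    proof
      assume "\<bar>y0\<bar> = L"
      then show ?thesis
        using goal1 mult_right_mono[OF far[of y0], of "\<tau> ^ \<kappa>"] \<tau> by simp
    next
      assume crit: "ev2 (pderiv P) t y0 * (1 + y0\<^sup>2) = ev2 P t y0 * (2 * real d * y0)"
      define \<upsilon> where "\<upsilon> = 1 + y0\<^sup>2"
      have \<upsilon>: "\<upsilon> \<ge> 1" by (simp add: \<upsilon>_def)
      define p where "p = ev2 P t y0"
      have p0: "p \<ge> 0" using psd by (simp add: p_def)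
      have y\<upsilon>: "\<bar>y0\<bar> \<le> \<upsilon>"
        unfolding \<upsilon>_def using zero_le_power2[of "\<bar>y0\<bar> - 1"] by (simp add: power2_diff)
      have "\<bar>ev2 (pderiv P) t y0\<bar> * \<upsilon> = p * (2 * d * \<bar>y0\<bar>)"
        using arg_cong[OF crit, of abs] \<upsilon> p0 by (simp add: abs_mult flip: p_def \<upsilon>_def)
      also have "\<dots> \<le> p * (2 * d * \<upsilon>)" using y\<upsilon> p0 by (intro mult_left_mono) auto
      finally have dP: "\<bar>ev2 (pderiv P) t y0\<bar> \<le> p * (2 * d)" using \<upsilon> by simp
      have Ab: "\<bar>ev2 A t y0\<bar> \<le> CA * (\<tau> ^ \<kappa>2 * \<upsilon> ^ \<kappa>2)"
      proof -
        have "\<bar>ev2 A t y0\<bar> \<le> CA * (\<tau> ^ \<kappa>A * \<upsilon> ^ \<kappa>A)" using CA(2)[of t y0] by (simp add: \<tau>_def \<upsilon>_def)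
        also have "\<dots> \<le> CA * (\<tau> ^ \<kappa>2 * \<upsilon> ^ \<kappa>2)"
          using CA(1) \<tau> \<upsilon> by (intro mult_mono power_increasing) (auto simp: \<kappa>2_def)
        finally show ?thesis .
      qed
      have Bb: "\<bar>ev2 B t y0\<bar> \<le> CB * (\<tau> ^ \<kappa>2 * \<upsilon> ^ \<kappa>2)"
      proof -
        have "\<bar>ev2 B t y0\<bar> \<le> CB * (\<tau> ^ \<kappa>B * \<upsilon> ^ \<kappa>B)" using CB(2)[of t y0] by (simp add: \<tau>_def \<upsilon>_def)
        also have "\<dots> \<le> CB * (\<tau> ^ \<kappa>2 * \<upsilon> ^ \<kappa>2)"
          using CB(1) \<tau> \<upsilon> by (intro mult_mono power_increasing) (auto simp: \<kappa>2_def)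
        finally show ?thesis .
      qed
      have "poly r t = ev2 A t y0 * p + ev2 B t y0 * ev2 (pderiv P) t y0"
        using arg_cong[OF bezout(1), of "\<lambda>Q. ev2 Q t y0"] by (simp add: p_def)
      then have "\<rho> \<le> \<bar>ev2 A t y0\<bar> * p + \<bar>ev2 B t y0\<bar> * \<bar>ev2 (pderiv P) t y0\<bar>"
        using abs_triangle_ineq[of "ev2 A t y0 * p" "ev2 B t y0 * ev2 (pderiv P) t y0"] p0
        by (simp add: \<rho>_def abs_mult)
      also have "\<dots> \<le> CA * (\<tau> ^ \<kappa>2 * \<upsilon> ^ \<kappa>2) * p + CB * (\<tau> ^ \<kappa>2 * \<upsilon> ^ \<kappa>2) * (p * (2 * d))"
        using Ab Bb dP p0 CB(1) \<tau> \<upsilon> by (intro add_mono mult_mono) auto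
      also have "\<dots> = C2 * \<tau> ^ \<kappa>2 * \<upsilon> ^ \<kappa>2 * p" by (simp add: C2_def algebra_simps)
      finally have \<rho>p: "\<rho> \<le> C2 * \<tau> ^ \<kappa>2 * \<upsilon> ^ \<kappa>2 * p" .
      define \<beta> where "\<beta> = poly B3 t"
      have \<beta>: "\<beta> = 3 * \<alpha>\<^sup>2 + 2 * C1\<^sup>2 * (\<tau> ^ \<kappa>1)\<^sup>2"
        by (simp add: \<beta>_def B3_def \<alpha>_def \<tau>_def T poly_power power_even_eq)
      have \<upsilon>\<beta>: "\<upsilon> * \<alpha>\<^sup>2 \<le> \<beta>"
      proof -
        have "y0\<^sup>2 \<le> L\<^sup>2" using power_mono[OF y0(1), of 2] by simp
        moreover have "L\<^sup>2 \<le> 2 + 2 * (C1 * \<tau> ^ \<kappa>1 / \<alpha>)\<^sup>2"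
          unfolding L_def using zero_le_power2[of "1 - C1 * \<tau> ^ \<kappa>1 / \<alpha>"]
          by (simp only: power2_sum power2_diff) simp
        ultimately have "\<upsilon> \<le> 3 + 2 * (C1 * \<tau> ^ \<kappa>1 / \<alpha>)\<^sup>2" by (simp add: \<upsilon>_def)
        then have "\<upsilon> * \<alpha>\<^sup>2 \<le> (3 + 2 * (C1 * \<tau> ^ \<kappa>1 / \<alpha>)\<^sup>2) * \<alpha>\<^sup>2"
          by (intro mult_right_mono) auto
        also have "\<dots> = 3 * \<alpha>\<^sup>2 + 2 * (C1 * \<tau> ^ \<kappa>1 / \<alpha> * \<alpha>)\<^sup>2"
          by (simp only: distrib_right power_mult_distrib mult.assoc)
        also have "\<dots> = \<beta>" using \<alpha> by (simp add: \<beta> power_mult_distrib)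
        finally show ?thesis .
      qed
      have m_eq: "\<upsilon> ^ \<kappa>2 * \<upsilon> ^ d = \<upsilon> ^ m" by (simp add: m_def power_add)
      have "\<upsilon> ^ m * \<alpha> ^ (2 * m) \<le> \<beta> ^ m"
        using power_mono[OF \<upsilon>\<beta>, of m] \<upsilon> by (simp add: power_mult_distrib power_mult)
      have "poly G1 t = C2 * (poly r t * \<alpha>\<^sup>2 * \<tau> ^ \<kappa>2 * \<beta> ^ m)"
        by (simp add: G1_def \<alpha>_def \<tau>_def \<beta>_def T poly_power)
      then have "\<bar>poly G1 t\<bar> = C2 * (\<rho> * \<alpha>\<^sup>2 * \<tau> ^ \<kappa>2 * \<beta> ^ m)"
        using \<open>C2 > 0\<close> \<tau> by (simp add: abs_mult \<rho>_def power_abs) (simp add: \<beta>)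
      then have G1: "C2 * (\<rho> * \<alpha>\<^sup>2 * \<tau> ^ \<kappa>2 * \<beta> ^ m) \<le> D * \<tau> ^ \<kappa>"
        using G(1)[of t] by (simp add: \<tau>_def)
      have "(poly w t)\<^sup>2 * \<upsilon> ^ d = \<rho> * (\<rho> * \<alpha>\<^sup>2 * \<alpha> ^ (2 * m) * \<upsilon> ^ d)"
        unfolding w2 by (simp add: power_add power2_eq_square mult_ac)
      also have "\<dots> \<le> (C2 * \<tau> ^ \<kappa>2 * \<upsilon> ^ \<kappa>2 * p) * (\<rho> * \<alpha>\<^sup>2 * \<alpha> ^ (2 * m) * \<upsilon> ^ d)"
        using \<rho>p \<rho> \<alpha> \<upsilon> by (intro mult_right_mono) auto
      also have "\<dots> = p * (C2 * (\<rho> * \<alpha>\<^sup>2 * \<tau> ^ \<kappa>2 * (\<upsilon> ^ m * \<alpha> ^ (2 * m))))"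
        by (simp add: mult_ac flip: m_eq)
      also have "\<dots> \<le> p * (C2 * (\<rho> * \<alpha>\<^sup>2 * \<tau> ^ \<kappa>2 * \<beta> ^ m))"
        using p0 \<open>C2 > 0\<close> \<rho> \<tau> \<open>\<upsilon> ^ m * \<alpha> ^ (2 * m) \<le> \<beta> ^ m\<close> by (intro mult_left_mono) auto
      also have "\<dots> \<le> p * (D * \<tau> ^ \<kappa>)"
        using G1 p0 by (intro mult_left_mono) auto
      finally have "(poly w t)\<^sup>2 * \<upsilon> ^ d \<le> p * (D * \<tau> ^ \<kappa>)" .
      moreover have "\<upsilon> ^ d > 0" using \<upsilon> by simp
      ultimately have "(poly w t)\<^sup>2 / D \<le> p * \<tau> ^ \<kappa> / \<upsilon> ^ d"
        using D by (simp add: pos_divide_le_eq pos_le_divide_eq mult_ac)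
      then show ?thesis by (simp add: p_def \<upsilon>_def)
    qed
    have "1 / D * (poly w t)\<^sup>2 \<le> ev2 P t y / (1 + y\<^sup>2) ^ d * \<tau> ^ \<kappa>"
    proof (cases "\<bar>y\<bar> \<le> L")
      case True
      have "0 \<le> \<tau> ^ \<kappa>" using \<tau> by simp
      from mult_right_mono[OF y0(2)[OF True] this] near show ?thesis by linarith
    next
      case False
      have "0 \<le> \<tau> ^ \<kappa>" using \<tau> by simp
      from mult_right_mono[OF far this, of y] goal1 False show ?thesis by linarith
    qed
    moreover have "(1 + y\<^sup>2) ^ d > 0" by (intro zero_less_power) (simp add: add_pos_nonneg)
    ultimately have "1 / D * (poly w t)\<^sup>2 * (1 + y\<^sup>2) ^ d \<le> ev2 P t y / (1 + y\<^sup>2) ^ d * \<tau> ^ \<kappa> * (1 + y\<^sup>2) ^ d"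
      by (intro mult_right_mono) auto
    also have "\<dots> = ev2 P t y * \<tau> ^ \<kappa>"
      using \<open>(1 + y\<^sup>2) ^ d > 0\<close>
      by (metis (no_types) mult.commute nonzero_mult_div_cancel_left order_less_irrefl times_divide_eq_right)
    finally show ?thesis by (simp add: \<tau>_def)
  qed
  show ?thesis
    by (rule that[OF _ _ main]) (use D bezout(2) a0 in \<open>simp_all add: w_def\<close>)
qed

section \<open>Polynomial functions on the cylinder\<close>

abbreviation rpf :: "(complex \<Rightarrow> real) \<Rightarrow> bool" where
  "rpf \<equiv> real_polynomial_function"

text \<open>This parametrisation misses exactly the point \<open>-1\<close> of the circle.\<close>
definition zt :: "real \<Rightarrow> complex" where
  "zt t = Complex ((1 - t\<^sup>2) / (1 + t\<^sup>2)) (2 * t / (1 + t\<^sup>2))"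

lemma one_plus_square_pos [simp]: "1 + (t::real)\<^sup>2 > 0" "1 + (t::real)\<^sup>2 \<noteq> 0"
proof -
  show "1 + t\<^sup>2 > 0" by (simp add: add_pos_nonneg)
  then show "1 + t\<^sup>2 \<noteq> 0" by linarith
qed

text \<open>The functions 1, t^2 and t, divided by 1 + t^2, are polynomial on the circle: the source
  of the translation between circle functions and polynomials in t.\<close>

lemma zt_half:
  "(1 + Re (zt t)) / 2 * (1 + t\<^sup>2) = 1"
  "(1 - Re (zt t)) / 2 * (1 + t\<^sup>2) = t\<^sup>2"
  "Im (zt t) / 2 * (1 + t\<^sup>2) = t"
proof -
  have "Re (zt t) * (1 + t\<^sup>2) = 1 - t\<^sup>2" by (simp add: zt_def)
  then show "(1 + Re (zt t)) / 2 * (1 + t\<^sup>2) = 1" "(1 - Re (zt t)) / 2 * (1 + t\<^sup>2) = t\<^sup>2"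
    by (simp_all add: algebra_simps)
  have "Im (zt t) * (1 + t\<^sup>2) = 2 * t" by (simp add: zt_def)
  then show "Im (zt t) / 2 * (1 + t\<^sup>2) = t" by (simp only: times_divide_eq_left)
qed

lemma norm_zt [simp]: "norm (zt t) = 1"
proof -
  have "(1 - t\<^sup>2)\<^sup>2 + (2 * t)\<^sup>2 = (1 + t\<^sup>2)\<^sup>2" by (simp add: power2_eq_square algebra_simps)
  then have "((1 - t\<^sup>2) / (1 + t\<^sup>2))\<^sup>2 + (2 * t / (1 + t\<^sup>2))\<^sup>2 = 1"
    by (simp add: power_divide flip: add_divide_distrib)
  then show ?thesis by (simp add: zt_def cmod_def)
qed

lemma zt_surj:
  assumes "norm z = 1" "z \<noteq> - 1"
  obtains t where "z = zt t"
proof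
  define x y where "x = Re z" and "y = Im z"
  have xy: "x\<^sup>2 + y\<^sup>2 = 1" using assms(1) by (simp add: cmod_def x_def y_def)
  have x1: "1 + x \<noteq> 0"
  proof
    assume "1 + x = 0"
    then have "x = - 1" by simp
    then have "y = 0" using xy by simp
    then show False using assms(2) \<open>x = - 1\<close> by (simp add: x_def y_def complex_eq_iff)
  qed
  define t where "t = y / (1 + x)"
  have t: "t * (1 + x) = y" using x1 by (simp add: t_def)
  have "(1 + t\<^sup>2) * (1 + x)\<^sup>2 = (1 + x)\<^sup>2 + y\<^sup>2" using t by (simp add: algebra_simps flip: power_mult_distrib)
  also have "\<dots> = 2 * (1 + x)" using xy by (simp add: power2_eq_square algebra_simps)
  finally have "((1 + t\<^sup>2) * (1 + x)) * (1 + x) = 2 * (1 + x)" by (simp add: power2_eq_square mult_ac)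
  then have T: "(1 + t\<^sup>2) * (1 + x) = 2" using x1 by (metis mult_right_cancel)
  have "x * (1 + t\<^sup>2) = 1 - t\<^sup>2" using T by (simp add: algebra_simps)
  moreover have "y * (1 + t\<^sup>2) = t * ((1 + t\<^sup>2) * (1 + x))" using t by (simp add: mult_ac)
  then have "y * (1 + t\<^sup>2) = 2 * t" by (simp add: T)
  ultimately have "x = (1 - t\<^sup>2) / (1 + t\<^sup>2)" "y = 2 * t / (1 + t\<^sup>2)"
    by (simp_all add: eq_divide_eq)
  then have "z = zt t" by (simp only: zt_def complex_eq_iff complex.sel x_def y_def)
  then show "z = zt (Im z / (1 + Re z))" by (simp only: t_def x_def y_def)
qed

lemma rpf_Re [intro]: "rpf Re" and rpf_Im [intro]: "rpf Im"
  by (auto intro: bounded_linear_Re bounded_linear_Im)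

text \<open>The missing point -1 is the limit of \<open>zt n\<close> for n to infinity, so
  continuity covers it.\<close>

lemma circle_nonneg:
  assumes "rpf c" "\<And>t. c (zt t) \<ge> 0" "norm z = 1"
  shows "c z \<ge> 0"
proof (cases "z = - 1")
  case False
  then show ?thesis using zt_surj[of z] assms by metis
next
  case True
  have "(\<lambda>n. (1 - (real n)\<^sup>2) / (1 + (real n)\<^sup>2)) \<longlonglongrightarrow> - 1"
    "(\<lambda>n. 2 * real n / (1 + (real n)\<^sup>2)) \<longlonglongrightarrow> 0"
    by real_asymp+
  then have "(\<lambda>n. zt (real n)) \<longlonglongrightarrow> Complex (- 1) 0"
    unfolding zt_def by (intro tendsto_Complex)
  moreover have "Complex (- 1) 0 = z" using True by (simp add: complex_eq_iff)
  ultimately have "(\<lambda>n. c (zt (real n))) \<longlonglongrightarrow> c z"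
    using continuous_real_polymonial_function[OF assms(1), of z] by (metis isCont_tendsto_compose)
  then show ?thesis
    by (rule LIMSEQ_le_const) (use assms(2) in auto)
qed

lemma circle_eqI:
  assumes "rpf c" "rpf d" "\<And>t. c (zt t) = d (zt t)" "norm z = 1"
  shows "c z = d z"
proof (rule antisym)
  show "c z \<le> d z"
    using circle_nonneg[of "\<lambda>z. d z - c z" z] assms by (simp add: real_polynomial_function_diff)
  show "d z \<le> c z"
    using circle_nonneg[of "\<lambda>z. c z - d z" z] assms by (simp add: real_polynomial_function_diff)
qed

text \<open>Write q = a + b t + t^2 q' and divide by 1 + t^2 once for every two degrees in t. The
  converse is \<open>pull_poly\<close>: circle functions are exactly the quotients q / (1 + t^2)^m
  with deg q <= 2 m.\<close>

lemma push_poly: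
  fixes q :: "real poly"
  assumes "degree q \<le> 2 * m"
  shows "\<exists>c. rpf c \<and> (\<forall>t. c (zt t) * (1 + t\<^sup>2) ^ m = poly q t)"
  using assms
proof (induction m arbitrary: q)
  case 0
  then obtain a where "q = [:a:]" by (auto elim: degree_eq_zeroE)
  then show ?case by (intro exI[of _ "\<lambda>z. a"]) auto
next
  case (Suc m)
  obtain a b q' where q: "q = pCons a (pCons b q')" by (metis pCons_cases)
  have "degree q' \<le> 2 * m" using Suc.prems by (auto simp: q split: if_splits)
  then obtain c where c: "rpf c" "\<And>t. c (zt t) * (1 + t\<^sup>2) ^ m = poly q' t" using Suc.IH by blast
  define c' where "c' z = a * ((1 + Re z) / 2) ^ Suc m + b * (Im z / 2) * ((1 + Re z) / 2) ^ m + (1 - Re z) / 2 * c z" for z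
  have "rpf c'" unfolding c'_def using c(1) by (intro real_polynomial_function.intros(2-4)
    real_polynomial_function_power real_polynomial_function_divide real_polynomial_function_diff rpf_Re rpf_Im)
  moreover have "c' (zt t) * (1 + t\<^sup>2) ^ Suc m = poly q t" for t
  proof -
    define A B X T where "A = (1 + Re (zt t)) / 2" and "B = Im (zt t) / 2" and "X = (1 - Re (zt t)) / 2" and "T = 1 + t\<^sup>2"
    have AT: "A * T = 1" "B * T = t" "X * T = t\<^sup>2" using zt_half[of t] by (simp_all add: A_def B_def X_def T_def)
    have "c' (zt t) * T ^ Suc m = a * (A * T) ^ Suc m + b * (B * T) * (A * T) ^ m + X * T * (c (zt t) * T ^ m)"
      by (simp add: c'_def A_def[symmetric] B_def[symmetric] X_def[symmetric] power_mult_distrib algebra_simps)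
    also have "\<dots> = a + b * t + t\<^sup>2 * poly q' t" using c(2)[of t] AT by (simp add: T_def)
    also have "\<dots> = poly q t" by (simp add: q power2_eq_square algebra_simps)
    finally show ?thesis by (simp add: T_def)
  qed
  ultimately show ?case by blast
qed

lemma degree_times_weight:
  fixes q :: "real poly"
  assumes "degree q \<le> 2 * m"
  shows "degree (q * [:1, 0, 1:] ^ k) \<le> 2 * (m + k)"
proof -
  have "degree (q * [:1, 0, 1:] ^ k) \<le> degree q + degree ([:1, 0, 1:] ^ k :: real poly)"
    by (rule degree_mult_le)
  also have "\<dots> = degree q + 2 * k" by (simp add: degree_power_eq)
  finally show ?thesis using assms by simp
qed

lemma poly_weight: "poly [:1, 0, 1:] t = 1 + (t::real)\<^sup>2"
  by (simp add: power2_eq_square)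

lemma pull_poly:
  assumes "rpf c"
  shows "\<exists>q m. degree q \<le> 2 * m \<and> (\<forall>t. c (zt t) * (1 + t\<^sup>2) ^ m = poly q t)"
  using assms
proof (induction rule: real_polynomial_function.induct)
  case (linear f)
  then interpret bounded_linear f .
  define q where "q = [:f 1, 2 * f \<i>, - f 1:]"
  have "f (zt t) * (1 + t\<^sup>2) ^ 1 = poly q t" for t
  proof -
    have "zt t = Re (zt t) *\<^sub>R 1 + Im (zt t) *\<^sub>R \<i>" by (simp add: complex_eq_iff)
    then have "f (zt t) = Re (zt t) * f 1 + Im (zt t) * f \<i>"
      by (metis add scaleR real_scaleR_def)
    moreover have "Re (zt t) * (1 + t\<^sup>2) = 1 - t\<^sup>2" "Im (zt t) * (1 + t\<^sup>2) = 2 * t"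
      by (simp_all add: zt_def)
    ultimately have "f (zt t) * (1 + t\<^sup>2) = (1 - t\<^sup>2) * f 1 + 2 * t * f \<i>"
      by algebra
    then show ?thesis by (simp add: q_def power2_eq_square algebra_simps)
  qed
  moreover have "degree q \<le> 2 * 1" by (simp add: q_def)
  ultimately show ?case by blast
next
  case (const c)
  show ?case by (intro exI[of _ "[:c:]"] exI[of _ 0]) simp
next
  case (add f g)
  then obtain q m q' m' where q: "degree q \<le> 2 * m" "\<And>t. f (zt t) * (1 + t\<^sup>2) ^ m = poly q t"
    and q': "degree q' \<le> 2 * m'" "\<And>t. g (zt t) * (1 + t\<^sup>2) ^ m' = poly q' t" by blast
  define r where "r = q * [:1, 0, 1:] ^ m' + q' * [:1, 0, 1:] ^ m"
  have "degree r \<le> 2 * (m + m')"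
    unfolding r_def using degree_times_weight[OF q(1), of m'] degree_times_weight[OF q'(1), of m]
    by (intro degree_add_le) (simp_all add: add.commute)
  moreover have "(f (zt t) + g (zt t)) * (1 + t\<^sup>2) ^ (m + m') = poly r t" for t
  proof -
    have "poly r t = f (zt t) * (1 + t\<^sup>2) ^ m * (1 + t\<^sup>2) ^ m' + g (zt t) * (1 + t\<^sup>2) ^ m' * (1 + t\<^sup>2) ^ m"
      by (simp only: r_def poly_add poly_mult poly_power poly_weight q(2) q'(2))
    then show ?thesis by (simp add: power_add algebra_simps)
  qed
  ultimately show ?case by blast
next
  case (mult f g)
  then obtain q m q' m' where q: "degree q \<le> 2 * m" "\<And>t. f (zt t) * (1 + t\<^sup>2) ^ m = poly q t"
    and q': "degree q' \<le> 2 * m'" "\<And>t. g (zt t) * (1 + t\<^sup>2) ^ m' = poly q' t" by blast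
  have "degree (q * q') \<le> 2 * (m + m')"
    using degree_mult_le[of q q'] q(1) q'(1) by simp
  moreover have "(f (zt t) * g (zt t)) * (1 + t\<^sup>2) ^ (m + m') = poly (q * q') t" for t
    by (simp add: power_add algebra_simps flip: q(2) q'(2))
  ultimately show ?case by blast
qed

text \<open>Restrictions to the cylinder of polynomials in \<open>Re z\<close>, \<open>Im z\<close> and \<open>y\<close>, of degree at most \<open>n\<close> in \<open>y\<close>.\<close>
definition cyl :: "nat \<Rightarrow> (complex \<Rightarrow> real \<Rightarrow> real) \<Rightarrow> bool" where
  "cyl n f \<longleftrightarrow> (\<exists>p. (\<forall>j. rpf (\<lambda>z. coeff (p z) j)) \<and> (\<forall>z. degree (p z) \<le> n) \<and> (\<forall>z y. f z y = poly (p z) y))"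

lemma cylI:
  assumes "\<And>j. rpf (\<lambda>z. coeff (p z) j)" "\<And>z. degree (p z) \<le> n" "\<And>z y. f z y = poly (p z) y"
  shows "cyl n f"
  using assms unfolding cyl_def by blast

lemma cyl_add [intro]:
  assumes "cyl n f" "cyl n g"
  shows "cyl n (\<lambda>z y. f z y + g z y)"
proof -
  obtain p where p: "\<And>j. rpf (\<lambda>z. coeff (p z) j)" "\<And>z. degree (p z) \<le> n" "\<And>z y. f z y = poly (p z) y"
    using assms(1) unfolding cyl_def by blast
  obtain q where q: "\<And>j. rpf (\<lambda>z. coeff (q z) j)" "\<And>z. degree (q z) \<le> n" "\<And>z y. g z y = poly (q z) y"
    using assms(2) unfolding cyl_def by blast
  show ?thesis
    by (rule cylI[where p = "\<lambda>z. p z + q z"])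
      (use p q in \<open>auto intro!: degree_add_le\<close>)
qed

lemma cyl_mult [intro]:
  assumes "cyl n f" "cyl m g"
  shows "cyl (n + m) (\<lambda>z y. f z y * g z y)"
proof -
  obtain p where p: "\<And>j. rpf (\<lambda>z. coeff (p z) j)" "\<And>z. degree (p z) \<le> n" "\<And>z y. f z y = poly (p z) y"
    using assms(1) unfolding cyl_def by blast
  obtain q where q: "\<And>j. rpf (\<lambda>z. coeff (q z) j)" "\<And>z. degree (q z) \<le> m" "\<And>z y. g z y = poly (q z) y"
    using assms(2) unfolding cyl_def by blast
  show ?thesis
  proof (rule cylI[where p = "\<lambda>z. p z * q z"])
    show "rpf (\<lambda>z. coeff (p z * q z) j)" for j
      unfolding coeff_mult using p(1) q(1) by (intro real_polynomial_function_sum real_polynomial_function.intros(4)) auto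
    show "degree (p z * q z) \<le> n + m" for z
      using degree_mult_le[of "p z" "q z"] p(2)[of z] q(2)[of z] by linarith
  qed (use p q in auto)
qed

lemma cyl_const_z:
  assumes "degree p \<le> n"
  shows "cyl n (\<lambda>z y. poly p y)"
  by (rule cylI[where p = "\<lambda>z. p"]) (use assms in auto)

lemma cyl_rpf:
  assumes "rpf c"
  shows "cyl 0 (\<lambda>z y. c z)"
proof (rule cylI[where p = "\<lambda>z. [:c z:]"])
  show "rpf (\<lambda>z. coeff [:c z:] j)" for j using assms by (cases j) auto
qed simp_all

lemma cyl_scale:
  assumes "rpf c" "cyl n f"
  shows "cyl n (\<lambda>z y. c z * f z y)"
  using cyl_mult[OF cyl_rpf[OF assms(1)] assms(2)] by simp

lemma cyl_slice:
  assumes "cyl n f"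
  shows "rpf (\<lambda>z. f z y)"
proof -
  obtain p where p: "\<And>j. rpf (\<lambda>z. coeff (p z) j)" "\<And>z. degree (p z) \<le> n" "\<And>z y. f z y = poly (p z) y"
    using assms unfolding cyl_def by blast
  have "rpf (\<lambda>z. \<Sum>j\<le>n. coeff (p z) j * y ^ j)"
    using p(1) by (intro real_polynomial_function_sum real_polynomial_function.intros(4) real_polynomial_function.intros(2)) auto
  then show ?thesis by (simp only: p(3) poly_sum_upto[OF p(2)])
qed

lemma cyl_weight: "cyl (2 * d) (\<lambda>z y. (1 + y\<^sup>2) ^ d)"
proof -
  have "degree ([:1, 0, 1:] ^ d :: real poly) \<le> 2 * d" by (simp add: degree_power_eq mult.commute)
  from cyl_const_z[OF this] show ?thesis by (simp only: poly_power poly_weight)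
qed

lemma push_cyl:
  assumes "\<And>j. degree (coeff P j) \<le> 2 * m" "degree P \<le> n"
  obtains f where "cyl n f" "\<And>t y. f (zt t) y * (1 + t\<^sup>2) ^ m = ev2 P t y"
proof -
  obtain c where c: "\<And>j. rpf (c j)" "\<And>j t. c j (zt t) * (1 + t\<^sup>2) ^ m = poly (coeff P j) t"
    using push_poly[OF assms(1)] by metis
  define p where "p z = (\<Sum>j\<le>n. monom (c j z) j)" for z
  have cp: "coeff (p z) j = (if j \<le> n then c j z else 0)" for z j by (simp add: p_def coeff_sum)
  have dp: "degree (p z) \<le> n" for z by (rule degree_le) (simp add: cp)
  show ?thesis
  proof (rule that[of "\<lambda>z. poly (p z)"])
    show "cyl n (\<lambda>z. poly (p z))"
    proof (rule cylI[where p = p])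
      show "rpf (\<lambda>z. coeff (p z) j)" for j
        using c(1) by (cases "j \<le> n") (simp_all add: cp real_polynomial_function.intros(2))
    qed (use dp in auto)
    show "poly (p (zt t)) y * (1 + t\<^sup>2) ^ m = ev2 P t y" for t y
      by (simp add: poly_sum_upto[OF dp] ev2_sum[OF assms(2)] cp c(2)[symmetric] sum_distrib_left mult_ac)
  qed
qed

text \<open>Every sufficiently large exponent works, so that several functions can share one and its
  size can be prescribed.\<close>

lemma pull_cyl:
  assumes "cyl n f"
  obtains m0 where "\<And>m. m \<ge> m0 \<Longrightarrow> \<exists>P. degree P \<le> n \<and> (\<forall>j. degree (coeff P j) \<le> 2 * m) \<and>
    (\<forall>t y. f (zt t) y * (1 + t\<^sup>2) ^ m = ev2 P t y)"
proof -
  obtain p where p: "\<And>j. rpf (\<lambda>z. coeff (p z) j)" "\<And>z. degree (p z) \<le> n" "\<And>z y. f z y = poly (p z) y"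
    using assms unfolding cyl_def by blast
  obtain q \<mu> where q: "\<And>j. degree (q j) \<le> 2 * \<mu> j" "\<And>j t. coeff (p (zt t)) j * (1 + t\<^sup>2) ^ \<mu> j = poly (q j) t"
    using pull_poly[OF p(1)] by metis
  define m0 where "m0 = (\<Sum>j\<le>n. \<mu> j)"
  have \<mu>: "\<mu> j \<le> m0" if "j \<le> n" for j unfolding m0_def using that by (intro member_le_sum) auto
  show ?thesis
  proof (rule that[of m0])
    fix m assume m: "m \<ge> m0"
    define P where "P = (\<Sum>j\<le>n. monom (q j * [:1, 0, 1:] ^ (m - \<mu> j)) j)"
    have cP: "coeff P j = (if j \<le> n then q j * [:1, 0, 1:] ^ (m - \<mu> j) else 0)" for j
      by (simp add: P_def coeff_sum)
    have dP: "degree P \<le> n" by (rule degree_le) (simp add: cP)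
    have "degree (coeff P j) \<le> 2 * m" for j
    proof (cases "j \<le> n")
      case True
      then have "\<mu> j + (m - \<mu> j) = m" using \<mu>[OF True] m by simp
      then show ?thesis using degree_times_weight[OF q(1)[of j], of "m - \<mu> j"] True by (simp only: cP if_True)
    qed (simp add: cP)
    moreover have "f (zt t) y * (1 + t\<^sup>2) ^ m = ev2 P t y" for t y
    proof -
      have "poly (coeff P j) t = coeff (p (zt t)) j * (1 + t\<^sup>2) ^ m" if "j \<le> n" for j
      proof -
        have "(1 + t\<^sup>2) ^ m = (1 + t\<^sup>2) ^ \<mu> j * (1 + t\<^sup>2) ^ (m - \<mu> j)"
          using \<mu>[OF that] m by (simp flip: power_add)
        then show ?thesis
          using that by (simp only: cP if_True poly_mult poly_power poly_weight q(2)[symmetric] mult.assoc)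
      qed
      then show ?thesis
        by (simp add: p(3) poly_sum_upto[OF p(2)] ev2_sum[OF dP] sum_distrib_left mult_ac)
    qed
    ultimately show "\<exists>P. degree P \<le> n \<and> (\<forall>j. degree (coeff P j) \<le> 2 * m) \<and> (\<forall>t y. f (zt t) y * (1 + t\<^sup>2) ^ m = ev2 P t y)"
      using dP by blast
  qed
qed

section \<open>Sums of squares of functions on the cylinder\<close>

lemmas rpf_intros = real_polynomial_function.intros(2-4) real_polynomial_function_diff
  real_polynomial_function_power real_polynomial_function_divide real_polynomial_function_sum

text \<open>The identity is demanded for \<open>norm z = 1\<close> only; this stands for equality in
  the coordinate ring, since the summands are functions on the whole plane times the line.\<close>

definition sosC :: "(complex \<Rightarrow> real \<Rightarrow> real) \<Rightarrow> bool" where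
  "sosC f \<longleftrightarrow> (\<exists>gs. (\<forall>g\<in>set gs. \<exists>n. cyl n g) \<and>
    (\<forall>z y. norm z = 1 \<longrightarrow> f z y = (\<Sum>g\<leftarrow>gs. (g z y)\<^sup>2)))"

lemma sosC_cong:
  assumes "\<And>z y. norm z = 1 \<Longrightarrow> f z y = g z y"
  shows "sosC f \<longleftrightarrow> sosC g"
  using assms unfolding sosC_def by simp

lemma sosC_square: "cyl n g \<Longrightarrow> sosC (\<lambda>z y. (g z y)\<^sup>2)"
  unfolding sosC_def by (intro exI[of _ "[g]"]) auto

lemma sosC_add:
  assumes "sosC f" "sosC g"
  shows "sosC (\<lambda>z y. f z y + g z y)"
proof -
  obtain fs gs where "\<forall>h\<in>set fs. \<exists>n. cyl n h" "\<forall>z y. norm z = 1 \<longrightarrow> f z y = (\<Sum>h\<leftarrow>fs. (h z y)\<^sup>2)"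
    "\<forall>h\<in>set gs. \<exists>n. cyl n h" "\<forall>z y. norm z = 1 \<longrightarrow> g z y = (\<Sum>h\<leftarrow>gs. (h z y)\<^sup>2)"
    using assms unfolding sosC_def by blast
  then show ?thesis
    unfolding sosC_def by (intro exI[of _ "fs @ gs"]) auto
qed

lemma sosC_0: "sosC (\<lambda>z y. 0)"
  unfolding sosC_def by (intro exI[of _ "[]"]) simp

lemma sosC_sum:
  assumes "\<And>i. i \<in> I \<Longrightarrow> sosC (f i)"
  shows "sosC (\<lambda>z y. \<Sum>i\<in>I. f i z y)"
  using assms
proof (induction I rule: infinite_finite_induct)
  case (insert i I)
  then show ?case using sosC_add[of "f i" "\<lambda>z y. \<Sum>i\<in>I. f i z y"] by simp
qed (simp_all add: sosC_0)

lemma sosC_square_mult: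
  assumes "cyl n h" "sosC f"
  shows "sosC (\<lambda>z y. (h z y)\<^sup>2 * f z y)"
proof -
  obtain gs where gs: "\<forall>g\<in>set gs. \<exists>n. cyl n g" "\<forall>z y. norm z = 1 \<longrightarrow> f z y = (\<Sum>g\<leftarrow>gs. (g z y)\<^sup>2)"
    using assms(2) unfolding sosC_def by blast
  define hs where "hs = map (\<lambda>g z y. h z y * g z y) gs"
  have "\<forall>g\<in>set hs. \<exists>n. cyl n g" using gs(1) assms(1) cyl_mult by (fastforce simp: hs_def)
  moreover have "(h z y)\<^sup>2 * f z y = (\<Sum>g\<leftarrow>hs. (g z y)\<^sup>2)" if "norm z = 1" for z y
    using gs(2) that by (simp add: hs_def o_def power_mult_distrib sum_list_const_mult)
  ultimately show ?thesis unfolding sosC_def by blast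
qed

lemma sosC_mult:
  assumes "sosC f" "sosC g"
  shows "sosC (\<lambda>z y. f z y * g z y)"
proof -
  obtain hs where hs: "\<forall>h\<in>set hs. \<exists>n. cyl n h" "\<forall>z y. norm z = 1 \<longrightarrow> f z y = (\<Sum>h\<leftarrow>hs. (h z y)\<^sup>2)"
    using assms(1) unfolding sosC_def by blast
  have "sosC (\<lambda>z y. (\<Sum>h\<leftarrow>hs. (h z y)\<^sup>2) * g z y)"
    using hs(1)
  proof (induction hs)
    case Nil
    then show ?case by (simp add: sosC_0)
  next
    case (Cons h hs)
    then obtain n where "cyl n h" by auto
    from sosC_add[OF sosC_square_mult[OF this assms(2)] Cons.IH] Cons.prems
    show ?case by (simp add: distrib_right)
  qed
  moreover have "sosC (\<lambda>z y. f z y * g z y) \<longleftrightarrow> sosC (\<lambda>z y. (\<Sum>h\<leftarrow>hs. (h z y)\<^sup>2) * g z y)"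
    by (rule sosC_cong) (simp add: hs(2))
  ultimately show ?thesis by blast
qed

lemma sosC_nonneg_poly:
  assumes "\<And>y. poly p y \<ge> 0"
  shows "sosC (\<lambda>z y. poly p y)"
proof -
  obtain q r where "p = q\<^sup>2 + r\<^sup>2" using nonneg_poly_two_squares assms by blast
  then show ?thesis
    using sosC_add[OF sosC_square[OF cyl_const_z[OF order.refl, of q]] sosC_square[OF cyl_const_z[OF order.refl, of r]]]
    by simp
qed

text \<open>The case of the circle alone: the one-variable theorem gives two squares in t, and since
  squares cannot cancel, their degrees are small enough to come from circle functions.\<close>

lemma sosC_nonneg_rpf:
  assumes "rpf c" "\<And>z. norm z = 1 \<Longrightarrow> c z \<ge> 0"
  shows "sosC (\<lambda>z y. c z)"
proof -
  obtain q m where q: "degree q \<le> 2 * m" "\<And>t. c (zt t) * (1 + t\<^sup>2) ^ m = poly q t"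
    using pull_poly[OF assms(1)] by blast
  \<comment> \<open>Doubles the exponent of 1 + t^2, so that each of the two square roots can be
    divided by (1 + t^2)^m.\<close>
  define q' where "q' = q * [:1, 0, 1:] ^ m"
  have q': "poly q' t = c (zt t) * ((1 + t\<^sup>2) ^ m)\<^sup>2" for t
    unfolding q'_def by (simp only: poly_mult poly_power poly_weight q(2)[symmetric] power2_eq_square mult.assoc)
  then have "poly q' t \<ge> 0" for t using assms(2) by simp
  then obtain u v where uv: "q' = u\<^sup>2 + v\<^sup>2" using nonneg_poly_two_squares by blast
  have "2 * max (degree u) (degree v) = degree q'"
    using degree_sum_two_squares(1)[of u v] uv by (simp add: sum_power2_eq_zero_iff)
  also have "\<dots> \<le> 2 * (m + m)" unfolding q'_def by (rule degree_times_weight) (rule q(1))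
  finally have "degree u \<le> 2 * m" "degree v \<le> 2 * m" by auto
  then obtain a b where a: "rpf a" "\<And>t. a (zt t) * (1 + t\<^sup>2) ^ m = poly u t"
    and b: "rpf b" "\<And>t. b (zt t) * (1 + t\<^sup>2) ^ m = poly v t"
    using push_poly by metis
  have "c (zt t) = (a (zt t))\<^sup>2 + (b (zt t))\<^sup>2" for t
  proof -
    have "c (zt t) * ((1 + t\<^sup>2) ^ m)\<^sup>2 = ((a (zt t))\<^sup>2 + (b (zt t))\<^sup>2) * ((1 + t\<^sup>2) ^ m)\<^sup>2"
      unfolding q'[symmetric] uv by (simp add: a(2)[symmetric] b(2)[symmetric] power_mult_distrib distrib_right)
    moreover have "((1 + t\<^sup>2) ^ m)\<^sup>2 \<noteq> 0" by simp
    ultimately show ?thesis by (metis mult_right_cancel)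
  qed
  moreover have "rpf (\<lambda>z. (a z)\<^sup>2 + (b z)\<^sup>2)" by (intro rpf_intros a(1) b(1))
  ultimately have eq: "c z = (a z)\<^sup>2 + (b z)\<^sup>2" if "norm z = 1" for z
    using circle_eqI[OF assms(1), of "\<lambda>z. (a z)\<^sup>2 + (b z)\<^sup>2"] that by simp
  have "sosC (\<lambda>z y. c z) \<longleftrightarrow> sosC (\<lambda>z y. (a z)\<^sup>2 + (b z)\<^sup>2)"
    by (rule sosC_cong) (rule eq)
  then show ?thesis
    using sosC_add[OF sosC_square[OF cyl_rpf[OF a(1)]] sosC_square[OF cyl_rpf[OF b(1)]]] by blast
qed

lemma geometric_le_power:
  fixes x :: real
  assumes "x \<ge> 0"
  shows "(\<Sum>i\<le>d. x ^ i) \<le> (1 + x) ^ d"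
proof (induction d)
  case (Suc d)
  have "x * x ^ d \<le> x * (1 + x) ^ d" using assms by (intro mult_left_mono power_mono) auto
  then show ?case using Suc by (simp add: algebra_simps)
qed simp

text \<open>The linear term is absorbed by
  \<open>\<eta> (1 + y\<^sup>2) + e y = (\<eta> + e / 2) / 2 * (1 + y)\<^sup>2 + (\<eta> - e / 2) / 2 * (1 - y)\<^sup>2\<close>.\<close>
lemma sosC_small_coeffs:
  assumes e: "\<And>j. rpf (e j)" "\<And>j z. norm z = 1 \<Longrightarrow> \<bar>e j z\<bar> \<le> \<eta>"
  shows "sosC (\<lambda>z y. (\<Sum>j\<le>2 * d. e j z * y ^ j) + 3 * \<eta> * (\<Sum>i<d. (y\<^sup>2) ^ i) + 2 * \<eta> * (y\<^sup>2) ^ d)"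
proof (induction d)
  case 0
  have "sosC (\<lambda>z y. e 0 z + 2 * \<eta>)"
  proof (rule sosC_nonneg_rpf)
    show "rpf (\<lambda>z. e 0 z + 2 * \<eta>)" by (intro rpf_intros e(1))
    show "e 0 z + 2 * \<eta> \<ge> 0" if "norm z = 1" for z using e(2)[OF that, of 0] by (simp add: abs_le_iff)
  qed
  then show ?case by simp
next
  case (Suc d)
  \<comment> \<open>The odd coefficient is absorbed at cost \<open>\<eta>\<close> (1 + y^2) y^(2 d),
    the next even one at cost \<open>\<eta>\<close> y^(2 d + 2). This raises the old top weight from
    2 \<open>\<eta>\<close> to 3 \<open>\<eta>\<close> and gives the new top the weight 2
    \<open>\<eta>\<close>.\<close>
  define a b c where "a z = (\<eta> + e (2 * d + 1) z / 2) / 2" and "b z = (\<eta> - e (2 * d + 1) z / 2) / 2"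
    and "c z = \<eta> + e (2 * d + 2) z" for z
  have rpfs: "rpf a" "rpf b" "rpf c"
    unfolding a_def b_def c_def by (intro rpf_intros e(1))+
  have nn: "a z \<ge> 0" "b z \<ge> 0" "c z \<ge> 0" if "norm z = 1" for z
    using e(2)[OF that, of "2 * d + 1"] e(2)[OF that, of "2 * d + 2"] by (auto simp: a_def b_def c_def abs_le_iff)
  have sq: "sosC (\<lambda>z y. poly (p\<^sup>2) y)" for p by (rule sosC_nonneg_poly) simp
  have 1: "sosC (\<lambda>z y. a z * poly ((monom 1 d * [:1, 1:])\<^sup>2) y)"
    by (rule sosC_mult[OF sosC_nonneg_rpf sq]) (use rpfs nn in auto)
  have 2: "sosC (\<lambda>z y. b z * poly ((monom 1 d * [:1, - 1:])\<^sup>2) y)"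
    by (rule sosC_mult[OF sosC_nonneg_rpf sq]) (use rpfs nn in auto)
  have 3: "sosC (\<lambda>z y. c z * poly ((monom 1 (Suc d))\<^sup>2) y)"
    by (rule sosC_mult[OF sosC_nonneg_rpf sq]) (use rpfs nn in auto)
  have "sosC (\<lambda>z y. ((\<Sum>j\<le>2 * d. e j z * y ^ j) + 3 * \<eta> * (\<Sum>i<d. (y\<^sup>2) ^ i) + 2 * \<eta> * (y\<^sup>2) ^ d) +
     (a z * poly ((monom 1 d * [:1, 1:])\<^sup>2) y + (b z * poly ((monom 1 d * [:1, - 1:])\<^sup>2) y + c z * poly ((monom 1 (Suc d))\<^sup>2) y)))"
    by (intro sosC_add Suc 1 2 3)
  moreover have "((\<Sum>j\<le>2 * d. e j z * y ^ j) + 3 * \<eta> * (\<Sum>i<d. (y\<^sup>2) ^ i) + 2 * \<eta> * (y\<^sup>2) ^ d) +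
     (a z * poly ((monom 1 d * [:1, 1:])\<^sup>2) y + (b z * poly ((monom 1 d * [:1, - 1:])\<^sup>2) y + c z * poly ((monom 1 (Suc d))\<^sup>2) y))
    = (\<Sum>j\<le>2 * Suc d. e j z * y ^ j) + 3 * \<eta> * (\<Sum>i<Suc d. (y\<^sup>2) ^ i) + 2 * \<eta> * (y\<^sup>2) ^ Suc d" for z y
  proof -
    define Y where "Y = (y\<^sup>2) ^ d"
    have Y: "(y ^ d)\<^sup>2 = Y" "y ^ (2 * d) = Y" by (simp_all add: Y_def power_mult power2_eq_square power_mult_distrib)
    have "poly ((monom 1 d * [:1, c:])\<^sup>2) y = Y * (1 + y * c)\<^sup>2" for c
      by (simp only: poly_power poly_mult poly_monom power_mult_distrib mult_1 Y(1)) simp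
    from this[of 1] this[of "- 1"]
    have p: "poly ((monom 1 d * [:1, 1:])\<^sup>2) y = Y * (1 + y)\<^sup>2" "poly ((monom 1 d * [:1, - 1:])\<^sup>2) y = Y * (1 - y)\<^sup>2"
      by simp_all
    have p3: "poly ((monom 1 (Suc d))\<^sup>2) y = Y * y\<^sup>2"
      by (simp add: poly_monom power_mult_distrib Y(1))
    have s: "(\<Sum>j\<le>2 * Suc d. e j z * y ^ j) = (\<Sum>j\<le>2 * d. e j z * y ^ j) + e (2 * d + 1) z * (Y * y) + e (2 * d + 2) z * (Y * y\<^sup>2)"
    proof -
      have "y ^ (2 * d + 1) = Y * y" "y ^ (2 * d + 2) = Y * y\<^sup>2" by (simp_all only: power_add Y(2) power_one_right)
      moreover have "{..2 * Suc d} = insert (2 * d + 2) (insert (2 * d + 1) {..2 * d})" by auto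
      ultimately show ?thesis by simp
    qed
    have S: "(\<Sum>i<Suc d. (y\<^sup>2) ^ i) = (\<Sum>i<d. (y\<^sup>2) ^ i) + Y" "(y\<^sup>2) ^ Suc d = Y * y\<^sup>2"
      by (simp_all add: Y_def)
    have key: "(E + 3 * (2 * g) * F + 2 * (2 * g) * Y) + ((g + h) * (Y * (1 + y)\<^sup>2) +
        ((g - h) * (Y * (1 - y)\<^sup>2) + (2 * g + e2) * (Y * y\<^sup>2))) =
        (E + (4 * h) * (Y * y) + e2 * (Y * y\<^sup>2)) + 3 * (2 * g) * (F + Y) + 2 * (2 * g) * (Y * y\<^sup>2)" for E F g h e2
      by algebra
    have ab: "a z = \<eta> / 2 + e (2 * d + 1) z / 4" "b z = \<eta> / 2 - e (2 * d + 1) z / 4"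
      "2 * (\<eta> / 2) = \<eta>" "4 * (e (2 * d + 1) z / 4) = e (2 * d + 1) z"
      by (simp_all add: a_def b_def add_divide_distrib diff_divide_distrib)
    show ?thesis
      unfolding p p3 s S Y_def[symmetric] ab(1,2) c_def
      using key[where g = "\<eta> / 2" and h = "e (2 * d + 1) z / 4", unfolded ab(3,4)] .
  qed
  ultimately show ?case by (simp only:)
qed

text \<open>The weight of the previous lemma is at most 3 \<open>\<eta>\<close> (1 + y^2)^d by
  \<open>geometric_le_power\<close>, and the difference is a nonnegative polynomial in y
  alone.\<close>

lemma sosC_small_perturbation:
  assumes "\<eta> > 0"
    and p: "\<And>j. rpf (\<lambda>z. coeff (p z) j)" "\<And>z. degree (p z) \<le> 2 * d" "\<And>z y. f z y = poly (p z) y"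
    and small: "\<And>j z. norm z = 1 \<Longrightarrow> \<bar>coeff (p z) j\<bar> \<le> \<eta>"
  shows "sosC (\<lambda>z y. f z y + 3 * \<eta> * (1 + y\<^sup>2) ^ d)"
proof -
  define S where "S y = 3 * \<eta> * (\<Sum>i<d. (y\<^sup>2) ^ i) + 2 * \<eta> * (y\<^sup>2) ^ d" for y :: real
  define q where "q = smult (3 * \<eta>) ([:1, 0, 1:] ^ d - (\<Sum>i<d. [:0, 0, 1:] ^ i)) - smult (2 * \<eta>) ([:0, 0, 1:] ^ d)"
  have q: "poly q y = 3 * \<eta> * (1 + y\<^sup>2) ^ d - S y" for y
    by (simp add: q_def S_def poly_sum poly_power power2_eq_square algebra_simps)
  have "poly q y \<ge> 0" for y
  proof -
    have "(\<Sum>i<d. (y\<^sup>2) ^ i) + (y\<^sup>2) ^ d \<le> (1 + y\<^sup>2) ^ d"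
      using geometric_le_power[of "y\<^sup>2" d] by (simp add: lessThan_Suc_atMost[symmetric])
    then have "3 * \<eta> * ((\<Sum>i<d. (y\<^sup>2) ^ i) + (y\<^sup>2) ^ d) \<le> 3 * \<eta> * (1 + y\<^sup>2) ^ d"
      using assms(1) by (intro mult_left_mono) auto
    moreover have "\<eta> * (y\<^sup>2) ^ d \<ge> 0" using assms(1) by simp
    ultimately show ?thesis unfolding q S_def by (simp add: algebra_simps)
  qed
  then have "sosC (\<lambda>z y. ((\<Sum>j\<le>2 * d. coeff (p z) j * y ^ j) + 3 * \<eta> * (\<Sum>i<d. (y\<^sup>2) ^ i) + 2 * \<eta> * (y\<^sup>2) ^ d) + poly q y)"
    by (intro sosC_add sosC_small_coeffs sosC_nonneg_poly p(1) small)
  moreover have "((\<Sum>j\<le>2 * d. coeff (p z) j * y ^ j) + 3 * \<eta> * (\<Sum>i<d. (y\<^sup>2) ^ i) + 2 * \<eta> * (y\<^sup>2) ^ d) + poly q y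
     = f z y + 3 * \<eta> * (1 + y\<^sup>2) ^ d" for z y
    by (simp add: q S_def p(3) poly_sum_upto[OF p(2)])
  ultimately show ?thesis by simp
qed

section \<open>Approximation on the circle\<close>

lemma compact_circle: "compact (sphere (0::complex) 1)"
  by simp

lemma rpf_continuous: "rpf c \<Longrightarrow> continuous_on S c"
  using continuous_real_polymonial_function continuous_at_imp_continuous_on by blast

lemma rpf_bounded_circle:
  assumes "rpf c"
  obtains B where "B > 0" "\<And>z. norm z = 1 \<Longrightarrow> \<bar>c z\<bar> \<le> B"
proof -
  have "compact (c ` sphere 0 1)"
    by (rule compact_continuous_image[OF rpf_continuous[OF assms] compact_circle])
  then obtain B where B: "\<And>x. x \<in> c ` sphere 0 1 \<Longrightarrow> \<bar>x\<bar> \<le> B"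
    by (metis bounded_real compact_imp_bounded)
  show ?thesis
    by (rule that[of "max B 1"]) (use B in \<open>auto simp: le_max_iff_disj\<close>)
qed

lemma coeffs_bounded_circle:
  assumes "\<And>j. rpf (\<lambda>z. coeff (p z) j)" "\<And>z. degree (p z) \<le> n"
  obtains B where "B > 0" "\<And>j z. norm z = 1 \<Longrightarrow> \<bar>coeff (p z) j\<bar> \<le> B"
proof -
  have "\<exists>B>0. \<forall>z. norm z = 1 \<longrightarrow> \<bar>coeff (p z) j\<bar> \<le> B" for j
    using rpf_bounded_circle[OF assms(1)[of j]] by metis
  then obtain B where B: "\<And>j. B j > 0" "\<And>j z. norm z = 1 \<Longrightarrow> \<bar>coeff (p z) j\<bar> \<le> B j" by metis
  define M where "M = (\<Sum>j\<le>n. B j)"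
  have le: "B j \<le> M" if "j \<le> n" for j
    unfolding M_def using that B(1) by (intro member_le_sum) (auto simp: less_imp_le)
  show ?thesis
  proof (rule that[of M])
    show "M > 0" using le[of 0] B(1)[of 0] by simp
    fix j z assume z: "norm (z::complex) = 1"
    show "\<bar>coeff (p z) j\<bar> \<le> M"
    proof (cases "j \<le> n")
      case True
      then show ?thesis using B(2)[OF z, of j] le[OF True] by linarith
    next
      case False
      then have "coeff (p z) j = 0" using assms(2)[of z] by (intro coeff_eq_0) simp
      then show ?thesis using \<open>M > 0\<close> by simp
    qed
  qed
qed

lemma cyl_bound:
  assumes "cyl (2 * d) f"
  obtains C where "C > 0" "\<And>z y. norm z = 1 \<Longrightarrow> \<bar>f z y\<bar> \<le> C * (1 + y\<^sup>2) ^ d"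
proof -
  obtain p where p: "\<And>j. rpf (\<lambda>z. coeff (p z) j)" "\<And>z. degree (p z) \<le> 2 * d" "\<And>z y. f z y = poly (p z) y"
    using assms unfolding cyl_def by blast
  obtain B where B: "B > 0" "\<And>j z. norm z = 1 \<Longrightarrow> \<bar>coeff (p z) j\<bar> \<le> B"
    using coeffs_bounded_circle[of p "2 * d"] p(1,2) by blast
  have yj: "\<bar>y ^ j\<bar> \<le> (1 + y\<^sup>2) ^ d" if "j \<le> 2 * d" for y :: real and j
  proof -
    have m: "\<bar>y ^ j\<bar> \<le> max 1 (\<bar>y\<bar> ^ (2 * d))"
    proof (cases "\<bar>y\<bar> \<le> 1")
      case True
      then show ?thesis by (simp add: power_abs power_le_one le_max_iff_disj)
    next
      case False
      then show ?thesis using that by (simp add: power_abs power_increasing le_max_iff_disj)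
    qed
    have "\<bar>y\<bar> ^ (2 * d) \<le> (1 + y\<^sup>2) ^ d" by (simp add: power_mult power_mono)
    moreover have "1 \<le> (1 + y\<^sup>2) ^ d" by (rule one_le_power) simp
    ultimately have "max 1 (\<bar>y\<bar> ^ (2 * d)) \<le> (1 + y\<^sup>2) ^ d" by simp
    with m show ?thesis by (rule order.trans)
  qed
  have "\<bar>f z y\<bar> \<le> B * (2 * d + 1) * (1 + y\<^sup>2) ^ d" if "norm z = 1" for z y
  proof -
    have "\<bar>f z y\<bar> \<le> (\<Sum>j\<le>2 * d. \<bar>coeff (p z) j * y ^ j\<bar>)"
      by (simp only: p(3) poly_sum_upto[OF p(2)] sum_abs)
    also have "\<dots> \<le> (\<Sum>j\<le>2 * d. B * (1 + y\<^sup>2) ^ d)"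
    proof (rule sum_mono)
      fix j assume "j \<in> {..2 * d}"
      then have "\<bar>y ^ j\<bar> \<le> (1 + y\<^sup>2) ^ d" using yj by simp
      then show "\<bar>coeff (p z) j * y ^ j\<bar> \<le> B * (1 + y\<^sup>2) ^ d"
        unfolding abs_mult using B(1) B(2)[OF that] by (intro mult_mono) auto
    qed
    also have "\<dots> = B * (2 * d + 1) * (1 + y\<^sup>2) ^ d" by simp
    finally show ?thesis .
  qed
  then show ?thesis using that[of "B * (2 * d + 1)"] B(1) by simp
qed

text \<open>Normalised hat functions around a finite net form a continuous partition of unity.
  Approximating their square roots, not the functions themselves, makes the polynomial weights
  squares.\<close>

lemma rpf_partition_of_unity:
  fixes c :: "nat \<Rightarrow> complex \<Rightarrow> real"
  assumes c: "\<And>j. j \<le> n \<Longrightarrow> rpf (c j)" and "\<eta> > 0"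
  obtains R g where "finite R" "R \<subseteq> sphere 0 1" "\<And>r. r \<in> R \<Longrightarrow> rpf (g r)"
    "\<And>j z. j \<le> n \<Longrightarrow> norm z = 1 \<Longrightarrow> \<bar>c j z - (\<Sum>r\<in>R. (g r z)\<^sup>2 * c j r)\<bar> \<le> \<eta>"
proof -
  define X where "X = sphere (0::complex) 1"
  have X: "compact X" "X \<noteq> {}" by (auto simp: X_def)
  have "\<exists>B>0. \<forall>z. norm z = 1 \<longrightarrow> \<bar>c j z\<bar> \<le> B" if "j \<le> n" for j
    using rpf_bounded_circle[OF c[OF that]] by metis
  then obtain B where B: "\<And>j. j \<le> n \<Longrightarrow> B j > 0" "\<And>j z. j \<le> n \<Longrightarrow> norm z = 1 \<Longrightarrow> \<bar>c j z\<bar> \<le> B j" by metis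
  define M where "M = (\<Sum>j\<le>n. B j)"
  have BM: "B j \<le> M" if "j \<le> n" for j
    unfolding M_def using that B(1) by (intro member_le_sum) (auto simp: less_imp_le)
  have M: "M > 0" using BM[of 0] B(1)[of 0] by simp
  have cM: "\<bar>c j z\<bar> \<le> M" if "j \<le> n" "norm z = 1" for j z
    using B(2)[OF that] BM[OF that(1)] by linarith
  have "\<exists>\<delta>>0. \<forall>x\<in>X. \<forall>x'\<in>X. dist x' x < \<delta> \<longrightarrow> dist (c j x') (c j x) < \<eta> / 2" if "j \<le> n" for j
    using compact_uniformly_continuous[OF rpf_continuous[OF c[OF that]] X(1)] \<open>\<eta> > 0\<close>
    unfolding uniformly_continuous_on_def by (meson half_gt_zero)
  then obtain \<Delta> where \<Delta>: "\<And>j. j \<le> n \<Longrightarrow> \<Delta> j > 0"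
    "\<And>j x x'. j \<le> n \<Longrightarrow> x \<in> X \<Longrightarrow> x' \<in> X \<Longrightarrow> dist x' x < \<Delta> j \<Longrightarrow> dist (c j x') (c j x) < \<eta> / 2"
    by metis
  define \<delta> where "\<delta> = Min (\<Delta> ` {..n})"
  have \<delta>: "\<delta> > 0" "\<And>j. j \<le> n \<Longrightarrow> \<delta> \<le> \<Delta> j" using \<Delta>(1) by (auto simp: \<delta>_def)
  have cover: "X \<subseteq> (\<Union>r\<in>X. ball r \<delta>)" using \<delta>(1) by auto
  obtain R where R: "R \<subseteq> X" "finite R" "X \<subseteq> (\<Union>r\<in>R. ball r \<delta>)"
    by (rule compactE_image[OF X(1) _ cover]) auto
  have "R \<noteq> {}" using R(3) X(2) by auto
  define \<phi> where "\<phi> r z = max 0 (\<delta> - dist z r)" for r z :: complex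
  define S where "S z = (\<Sum>r\<in>R. \<phi> r z)" for z
  have S: "S z > 0" if zX: "z \<in> X" for z
  proof -
    obtain r where r: "r \<in> R" "dist r z < \<delta>" using R(3) zX by auto
    have "\<phi> r z \<le> S z" unfolding S_def using r(1) R(2) by (intro member_le_sum) (auto simp: \<phi>_def)
    then show ?thesis using r(2) by (simp add: \<phi>_def dist_commute)
  qed
  define \<rho> where "\<rho> r z = \<phi> r z / S z" for r z
  have sum1: "(\<Sum>r\<in>R. \<rho> r z) = 1" if "z \<in> X" for z
    using S[OF that] by (simp add: \<rho>_def S_def flip: sum_divide_distrib)
  have \<rho>0: "\<rho> r z \<ge> 0" if "z \<in> X" for r z using S[OF that] by (simp add: \<rho>_def \<phi>_def)
  have \<rho>1: "\<rho> r z \<le> 1" if "z \<in> X" "r \<in> R" for r z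
    using sum1[OF that(1)] member_le_sum[of r R "\<lambda>r. \<rho> r z"] that R(2) \<rho>0[OF that(1)] by simp
  have nz: "(\<Sum>r\<in>R. max 0 (\<delta> - dist z r)) \<noteq> 0" if "z \<in> X" for z
    using S[OF that] by (simp add: S_def \<phi>_def)
  have cont: "continuous_on X (\<lambda>z. sqrt (\<rho> r z))" for r
    unfolding \<rho>_def S_def \<phi>_def using nz by (intro continuous_intros) auto
  define N where "N = real (card R)"
  have N: "N > 0" using \<open>R \<noteq> {}\<close> R(2) by (simp add: N_def card_gt_0_iff)
  \<comment> \<open>Replacing each weight by g^2 costs at most 3 \<open>\<tau>\<close>; over N
    points, with values bounded by M, the total 3 \<open>\<tau>\<close> N M stays within
    \<open>\<eta>\<close> / 2. The other half is for uniform continuity.\<close>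
  define \<tau> where "\<tau> = min 1 (\<eta> / (6 * N * M))"
  have \<tau>: "\<tau> > 0" "\<tau> \<le> 1" "3 * \<tau> * N * M \<le> \<eta> / 2"
  proof -
    show "\<tau> > 0" "\<tau> \<le> 1" using \<open>\<eta> > 0\<close> N M by (auto simp: \<tau>_def)
    have "\<tau> \<le> \<eta> / (6 * N * M)" by (simp add: \<tau>_def)
    then have "\<tau> * (6 * N * M) \<le> \<eta>" using N M by (simp add: pos_le_divide_eq)
    then show "3 * \<tau> * N * M \<le> \<eta> / 2" by (simp add: mult_ac)
  qed
  have "\<exists>g. rpf g \<and> (\<forall>x\<in>X. \<bar>sqrt (\<rho> r x) - g x\<bar> < \<tau>)" for r
    using Stone_Weierstrass_real_polynomial_function[OF X(1) cont \<tau>(1)] by metis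
  then obtain g where g: "\<And>r. rpf (g r)" "\<And>r x. x \<in> X \<Longrightarrow> \<bar>sqrt (\<rho> r x) - g r x\<bar> < \<tau>" by metis
  have sq: "\<bar>\<rho> r z - (g r z)\<^sup>2\<bar> \<le> 3 * \<tau>" if "z \<in> X" "r \<in> R" for r z
  proof -
    define s where "s = sqrt (\<rho> r z)"
    have s: "0 \<le> s" "s \<le> 1" "\<rho> r z = s\<^sup>2" using \<rho>0[OF that(1)] \<rho>1[OF that] by (auto simp: s_def)
    have gs: "\<bar>s - g r z\<bar> < \<tau>" using g(2)[OF that(1)] by (simp add: s_def)
    have "\<bar>s + g r z\<bar> \<le> 3" using gs s \<tau>(2) by linarith
    then have "\<bar>s - g r z\<bar> * \<bar>s + g r z\<bar> \<le> \<tau> * 3" using gs by (intro mult_mono) auto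
    moreover have "\<rho> r z - (g r z)\<^sup>2 = (s - g r z) * (s + g r z)"
      by (simp add: s(3) power2_eq_square algebra_simps)
    ultimately show ?thesis by (simp add: abs_mult)
  qed
  show ?thesis
  proof (rule that[of R g])
    show "finite R" "R \<subseteq> sphere 0 1" using R by (auto simp: X_def)
    show "rpf (g r)" for r by (rule g(1))
    fix j z assume j: "j \<le> n" and "norm (z::complex) = 1"
    then have z: "z \<in> X" by (simp add: X_def)
    have "c j z = (\<Sum>r\<in>R. \<rho> r z * c j z)" using sum1[OF z] by (simp flip: sum_distrib_right)
    then have "c j z - (\<Sum>r\<in>R. (g r z)\<^sup>2 * c j r) =
        (\<Sum>r\<in>R. \<rho> r z * (c j z - c j r)) + (\<Sum>r\<in>R. (\<rho> r z - (g r z)\<^sup>2) * c j r)"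
      by (simp add: algebra_simps sum_subtractf flip: sum.distrib)
    moreover have "\<bar>\<Sum>r\<in>R. \<rho> r z * (c j z - c j r)\<bar> \<le> \<eta> / 2"
    proof -
      have "\<bar>\<Sum>r\<in>R. \<rho> r z * (c j z - c j r)\<bar> \<le> (\<Sum>r\<in>R. \<rho> r z * (\<eta> / 2))"
      proof (rule order.trans[OF sum_abs], rule sum_mono)
        fix r assume r: "r \<in> R"
        show "\<bar>\<rho> r z * (c j z - c j r)\<bar> \<le> \<rho> r z * (\<eta> / 2)"
        proof (cases "dist z r < \<delta>")
          case True
          then have "dist (c j z) (c j r) < \<eta> / 2" using \<Delta>(2)[OF j, of r z] \<delta>(2)[OF j] r R(1) z by auto
          then show ?thesis
            unfolding abs_mult using \<rho>0[OF z, of r] by (intro mult_mono) (auto simp: dist_real_def)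
        next
          case False
          then have "\<rho> r z = 0" by (simp add: \<rho>_def \<phi>_def)
          then show ?thesis by simp
        qed
      qed
      also have "\<dots> = \<eta> / 2" by (simp only: sum_distrib_right[symmetric] sum1[OF z] mult_1)
      finally show ?thesis .
    qed
    moreover have "\<bar>\<Sum>r\<in>R. (\<rho> r z - (g r z)\<^sup>2) * c j r\<bar> \<le> \<eta> / 2"
    proof -
      have "\<bar>\<Sum>r\<in>R. (\<rho> r z - (g r z)\<^sup>2) * c j r\<bar> \<le> (\<Sum>r\<in>R. 3 * \<tau> * M)"
      proof (rule order.trans[OF sum_abs], rule sum_mono)
        fix r assume r: "r \<in> R"
        have "norm r = 1" using r R(1) by (auto simp: X_def)
        then show "\<bar>(\<rho> r z - (g r z)\<^sup>2) * c j r\<bar> \<le> 3 * \<tau> * M"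
          unfolding abs_mult using sq[OF z r] cM[OF j] \<tau>(1) by (intro mult_mono) auto
      qed
      also have "\<dots> = 3 * \<tau> * N * M" by (simp add: N_def)
      finally show ?thesis using \<tau>(3) by linarith
    qed
    ultimately show "\<bar>c j z - (\<Sum>r\<in>R. (g r z)\<^sup>2 * c j r)\<bar> \<le> \<eta>" by linarith
  qed
qed

text \<open>The slices of k at the points of the net are nonnegative in y, hence sums of squares,
  and they get square weights. What remains has small coefficients and is absorbed by the
  \<open>\<epsilon>\<close> term.\<close>

lemma sosC_nonneg_plus_eps:
  assumes k: "cyl (2 * d) k" and nn: "\<And>z y. norm z = 1 \<Longrightarrow> k z y \<ge> 0" and "\<epsilon> > 0"
  shows "sosC (\<lambda>z y. k z y + \<epsilon> * (1 + y\<^sup>2) ^ d)"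
proof -
  obtain p where p: "\<And>j. rpf (\<lambda>z. coeff (p z) j)" "\<And>z. degree (p z) \<le> 2 * d" "\<And>z y. k z y = poly (p z) y"
    using k unfolding cyl_def by blast
  define \<eta> where "\<eta> = \<epsilon> / 3"
  have \<eta>: "\<eta> > 0" "3 * \<eta> = \<epsilon>" using \<open>\<epsilon> > 0\<close> by (simp_all add: \<eta>_def)
  obtain R g where R: "finite R" "R \<subseteq> sphere 0 1" "\<And>r. r \<in> R \<Longrightarrow> rpf (g r)"
    and approx: "\<And>j z. j \<le> 2 * d \<Longrightarrow> norm z = 1 \<Longrightarrow> \<bar>coeff (p z) j - (\<Sum>r\<in>R. (g r z)\<^sup>2 * coeff (p r) j)\<bar> \<le> \<eta>"
    using rpf_partition_of_unity[of "2 * d" "\<lambda>j z. coeff (p z) j" \<eta>] p(1) \<eta>(1) by blast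
  define q where "q z = p z - (\<Sum>r\<in>R. smult ((g r z)\<^sup>2) (p r))" for z
  have cq: "coeff (q z) j = coeff (p z) j - (\<Sum>r\<in>R. (g r z)\<^sup>2 * coeff (p r) j)" for z j
    by (simp add: q_def coeff_sum)
  have q1: "rpf (\<lambda>z. coeff (q z) j)" for j
    unfolding cq by (intro rpf_intros p(1) R(1,3))
  have q2: "degree (q z) \<le> 2 * d" for z
  proof (rule degree_le, intro allI impI)
    fix i assume "2 * d < i"
    then have "coeff (p w) i = 0" for w by (intro coeff_eq_0 le_less_trans[OF p(2)])
    then show "coeff (q z) i = 0" by (simp add: cq)
  qed
  have q3: "\<bar>coeff (q z) j\<bar> \<le> \<eta>" if "norm z = 1" for j z
  proof (cases "j \<le> 2 * d")
    case True
    then show ?thesis using approx[OF True that] by (simp add: cq)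
  next
    case False
    then have "coeff (q z) j = 0" using q2[of z] by (intro coeff_eq_0) simp
    then show ?thesis using \<eta>(1) by simp
  qed
  have "sosC (\<lambda>z y. poly (q z) y + 3 * \<eta> * (1 + y\<^sup>2) ^ d)"
    by (rule sosC_small_perturbation[where p = q]) (use q1 q2 q3 \<eta>(1) in auto)
  moreover have "sosC (\<lambda>z y. \<Sum>r\<in>R. (g r z)\<^sup>2 * poly (p r) y)"
  proof (rule sosC_sum)
    fix r assume r: "r \<in> R"
    have "poly (p r) y \<ge> 0" for y using nn[of r y] r R(2) by (auto simp: p(3))
    then show "sosC (\<lambda>z y. (g r z)\<^sup>2 * poly (p r) y)"
      by (intro sosC_square_mult[OF cyl_rpf[OF R(3)[OF r]]] sosC_nonneg_poly)
  qed
  ultimately have "sosC (\<lambda>z y. (poly (q z) y + 3 * \<eta> * (1 + y\<^sup>2) ^ d) + (\<Sum>r\<in>R. (g r z)\<^sup>2 * poly (p r) y))"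
    by (rule sosC_add)
  moreover have "(poly (q z) y + 3 * \<eta> * (1 + y\<^sup>2) ^ d) + (\<Sum>r\<in>R. (g r z)\<^sup>2 * poly (p r) y) = k z y + \<epsilon> * (1 + y\<^sup>2) ^ d" for z y
    by (simp add: q_def p(3) poly_sum \<eta>(2))
  ultimately show ?thesis by simp
qed

section \<open>Functions with finitely many zeros\<close>

text \<open>\<open>\<rho>\<close> is a circle function in the coordinate t: it vanishes exactly on
  \<open>S\<close> and tends to 1 at infinity. In the third claim the factors other than that of r
  are bounded by 2 (1 + s^2).\<close>

lemma weighted_root_product:
  fixes S :: "real set"
  assumes "finite S"
  defines "\<rho> \<equiv> \<lambda>t. \<Prod>s\<in>S. (t - s)\<^sup>2 / (1 + t\<^sup>2)"
  shows "\<rho> t * (1 + t\<^sup>2) ^ card S = (poly (\<Prod>s\<in>S. [:- s, 1:]) t)\<^sup>2"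
    and "\<rho> t \<ge> 0"
    and "r \<in> S \<Longrightarrow> \<exists>c>0. \<forall>t. c * \<rho> t * (1 + t\<^sup>2) \<le> (t - r)\<^sup>2"
proof -
  show "\<rho> t * (1 + t\<^sup>2) ^ card S = (poly (\<Prod>s\<in>S. [:- s, 1:]) t)\<^sup>2"
    by (simp add: \<rho>_def prod_dividef poly_prod prod_power_distrib)
  show nn: "\<rho> t \<ge> 0" unfolding \<rho>_def by (intro prod_nonneg) simp
  assume r: "r \<in> S"
  define B where "B = (\<Prod>s\<in>S - {r}. 2 * (1 + s\<^sup>2))"
  have B: "B > 0"
    unfolding B_def by (intro prod_pos mult_pos_pos one_plus_square_pos(1)) simp
  have "1 / B * \<rho> t * (1 + t\<^sup>2) \<le> (t - r)\<^sup>2" for t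
  proof -
    have le: "(t - s)\<^sup>2 / (1 + t\<^sup>2) \<le> 2 * (1 + s\<^sup>2)" for s
    proof -
      have "(t - s)\<^sup>2 \<le> 2 * t\<^sup>2 + 2 * s\<^sup>2"
        using zero_le_power2[of "t + s"] by (simp add: power2_sum power2_diff)
      also have "\<dots> \<le> 2 * (1 + s\<^sup>2) * (1 + t\<^sup>2)"
        using zero_le_power2[of "s * t"] by (simp add: power_mult_distrib algebra_simps)
      finally show ?thesis by (simp add: pos_divide_le_eq)
    qed
    have "\<rho> t = (t - r)\<^sup>2 / (1 + t\<^sup>2) * (\<Prod>s\<in>S - {r}. (t - s)\<^sup>2 / (1 + t\<^sup>2))"
      unfolding \<rho>_def using assms(1) r by (rule prod.remove)
    also have "\<dots> \<le> (t - r)\<^sup>2 / (1 + t\<^sup>2) * B"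
      unfolding B_def using le by (intro mult_left_mono prod_mono) auto
    finally have "\<rho> t * (1 + t\<^sup>2) \<le> (t - r)\<^sup>2 / (1 + t\<^sup>2) * B * (1 + t\<^sup>2)"
      by (intro mult_right_mono) auto
    also have "\<dots> = (t - r)\<^sup>2 * B" by simp
    finally show ?thesis using B by (simp add: pos_divide_le_eq)
  qed
  then show "\<exists>c>0. \<forall>t. c * \<rho> t * (1 + t\<^sup>2) \<le> (t - r)\<^sup>2"
    using B by (intro exI[of _ "1 / B"]) simp
qed

lemma quadratic_weight_bound:
  fixes a b :: real
  assumes "b \<noteq> 0"
  shows "\<exists>c>0. \<forall>t. c * (1 + t\<^sup>2) \<le> (t - a)\<^sup>2 + b\<^sup>2"
proof -
  define C where "C = 2 + (1 + 2 * a\<^sup>2) / b\<^sup>2"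
  have C: "C > 0" unfolding C_def by (intro add_pos_nonneg) auto
  have "1 / C * (1 + t\<^sup>2) \<le> (t - a)\<^sup>2 + b\<^sup>2" for t
  proof -
    have "1 + t\<^sup>2 \<le> 2 * (t - a)\<^sup>2 + (1 + 2 * a\<^sup>2)"
      using zero_le_power2[of "t - 2 * a"] by (simp add: power2_diff power_mult_distrib)
    also have "\<dots> \<le> (2 * (t - a)\<^sup>2 + (1 + 2 * a\<^sup>2)) + (2 * b\<^sup>2 + (1 + 2 * a\<^sup>2) / b\<^sup>2 * (t - a)\<^sup>2)"
      by simp
    also have "\<dots> = C * ((t - a)\<^sup>2 + b\<^sup>2)"
      using assms by (simp add: C_def distrib_left distrib_right)
    finally show ?thesis using C by (simp add: pos_divide_le_eq mult.commute)
  qed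
  then show ?thesis using C by (intro exI[of _ "1 / C"]) simp
qed

text \<open>A linear factor of w costs one power of \<open>\<rho>\<close>; a factor without real
  root is comparable to 1 + t^2. The exponent \<open>degree w\<close> makes the bound sharp at
  infinity.\<close>

lemma poly_bound_by_roots:
  fixes w :: "real poly" and S :: "real set"
  assumes "finite S"
  defines "\<rho> \<equiv> \<lambda>t. \<Prod>s\<in>S. (t - s)\<^sup>2 / (1 + t\<^sup>2)"
  assumes "w \<noteq> 0" "\<And>t. poly w t = 0 \<Longrightarrow> t \<in> S"
  shows "\<exists>c>0. \<exists>k. \<forall>t. c * \<rho> t ^ k * (1 + t\<^sup>2) ^ degree w \<le> (poly w t)\<^sup>2"
  using assms(3,4)
proof (induction "degree w" arbitrary: w rule: less_induct)
  case less
  have \<rho>0: "\<rho> t \<ge> 0" for t unfolding \<rho>_def by (rule weighted_root_product(2)[OF assms(1)])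
  show ?case
  proof (cases "degree w = 0")
    case True
    then obtain a where "w = [:a:]" by (auto elim: degree_eq_zeroE)
    then show ?thesis using less.prems(1) by (intro exI[of _ "a\<^sup>2"] conjI exI[of _ 0]) auto
  next
    case False
    then have "degree w > 0" by simp
    then show ?thesis
    proof (cases rule: real_poly_factor_cases)
      case (linear a)
      then obtain w' where w': "w = [:- a, 1:] * w'" by blast
      have "w' \<noteq> 0" using w' less.prems(1) by auto
      have dw: "degree w = Suc (degree w')" using \<open>w' \<noteq> 0\<close> unfolding w' by (subst degree_mult_eq) auto
      have pw: "poly w t = (t - a) * poly w' t" for t by (simp add: w' algebra_simps)
      have "a \<in> S" using less.prems(2)[of a] pw by simp
      then obtain c1 where c1: "c1 > 0" "\<And>t. c1 * \<rho> t * (1 + t\<^sup>2) \<le> (t - a)\<^sup>2"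
        using weighted_root_product(3)[OF assms(1)] unfolding \<rho>_def by blast
      obtain c k where c: "c > 0" "\<And>t. c * \<rho> t ^ k * (1 + t\<^sup>2) ^ degree w' \<le> (poly w' t)\<^sup>2"
        using less.hyps[of w'] dw \<open>w' \<noteq> 0\<close> less.prems(2) pw by auto
      have "c1 * c * \<rho> t ^ Suc k * (1 + t\<^sup>2) ^ degree w \<le> (poly w t)\<^sup>2" for t
      proof -
        have "c1 * c * \<rho> t ^ Suc k * (1 + t\<^sup>2) ^ degree w = (c1 * \<rho> t * (1 + t\<^sup>2)) * (c * \<rho> t ^ k * (1 + t\<^sup>2) ^ degree w')"
          by (simp add: dw mult_ac)
        also have "\<dots> \<le> (t - a)\<^sup>2 * (poly w' t)\<^sup>2"
          using c1 c \<rho>0[of t] by (intro mult_mono) auto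
        finally show ?thesis by (simp add: pw power_mult_distrib)
      qed
      then show ?thesis using c c1 by (intro exI[of _ "c1 * c"] conjI exI[of _ "Suc k"]) auto
    next
      case (quadratic a b)
      then obtain w' where w': "w = [:a\<^sup>2 + b\<^sup>2, - 2 * a, 1:] * w'" by blast
      have "w' \<noteq> 0" using w' less.prems(1) by auto
      have dw: "degree w = 2 + degree w'" using \<open>w' \<noteq> 0\<close> unfolding w' by (subst degree_mult_eq) auto
      have pw: "poly w t = ((t - a)\<^sup>2 + b\<^sup>2) * poly w' t" for t
        by (simp add: w' power2_eq_square algebra_simps)
      obtain c1 where c1: "c1 > 0" "\<And>t. c1 * (1 + t\<^sup>2) \<le> (t - a)\<^sup>2 + b\<^sup>2"
        using quadratic_weight_bound[OF \<open>b \<noteq> 0\<close>] by blast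
      obtain c k where c: "c > 0" "\<And>t. c * \<rho> t ^ k * (1 + t\<^sup>2) ^ degree w' \<le> (poly w' t)\<^sup>2"
        using less.hyps[of w'] dw \<open>w' \<noteq> 0\<close> less.prems(2) pw by auto
      have "c1\<^sup>2 * c * \<rho> t ^ k * (1 + t\<^sup>2) ^ degree w \<le> (poly w t)\<^sup>2" for t
      proof -
        have "c1\<^sup>2 * c * \<rho> t ^ k * (1 + t\<^sup>2) ^ degree w = (c1 * (1 + t\<^sup>2))\<^sup>2 * (c * \<rho> t ^ k * (1 + t\<^sup>2) ^ degree w')"
          by (simp only: dw power_add power_mult_distrib mult_ac)
        also have "\<dots> \<le> ((t - a)\<^sup>2 + b\<^sup>2)\<^sup>2 * (poly w' t)\<^sup>2"
          using c1 c \<rho>0[of t] by (intro mult_mono power_mono) auto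
        finally show ?thesis by (simp add: pw power_mult_distrib)
      qed
      then show ?thesis using c c1 by (intro exI[of _ "c1\<^sup>2 * c"] conjI exI[of _ k]) auto
    qed
  qed
qed

text \<open>The value at -1 is the value at t = infinity, so a degree below 2 m would mean a zero
  there.\<close>

lemma pull_poly_degree_eq:
  assumes v: "rpf v" "v (- 1) \<noteq> 0"
    and q: "degree q \<le> 2 * m" "\<And>t. v (zt t) * (1 + t\<^sup>2) ^ m = poly q t"
  shows "q \<noteq> 0" "degree q = 2 * m"
proof -
  show "q \<noteq> 0"
  proof
    assume "q = 0"
    then have "v (zt t) = 0" for t using q(2)[of t] by simp
    then have "v (- 1) = 0" using circle_eqI[OF v(1), of "\<lambda>z. 0" "- 1"] by (simp add: real_polynomial_function.intros(2))
    then show False using v(2) by simp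
  qed
  show "degree q = 2 * m"
  proof (rule ccontr)
    assume "degree q \<noteq> 2 * m"
    \<comment> \<open>There is room for one more degree, so t * v is a circle function c. The
      relation v (1 - Re z) = c Im z, evaluated at -1, gives v(-1) = 0.\<close>
    then have "degree (pCons 0 q) \<le> 2 * m" using q(1) degree_pCons_le[of 0 q] by linarith
    then obtain c where c: "rpf c" "\<And>t. c (zt t) * (1 + t\<^sup>2) ^ m = poly (pCons 0 q) t"
      using push_poly by blast
    have "v z * ((1 - Re z) / 2) = c z * (Im z / 2)" if "norm z = 1" for z
    proof (rule circle_eqI[OF _ _ _ that])
      show "rpf (\<lambda>z. v z * ((1 - Re z) / 2))" "rpf (\<lambda>z. c z * (Im z / 2))"
        by (intro rpf_intros v(1) c(1) rpf_Re rpf_Im)+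
      fix t
      have "c (zt t) * (1 + t\<^sup>2) ^ m = t * v (zt t) * (1 + t\<^sup>2) ^ m"
        using c(2)[of t] q(2)[of t] by simp
      moreover have "(1 + t\<^sup>2) ^ m \<noteq> 0" by simp
      ultimately have cv: "c (zt t) = t * v (zt t)" by (metis mult_right_cancel)
      have "v (zt t) * ((1 - Re (zt t)) / 2) * (1 + t\<^sup>2) = c (zt t) * (Im (zt t) / 2) * (1 + t\<^sup>2)"
        unfolding mult.assoc zt_half cv by (simp add: power2_eq_square)
      moreover have "1 + t\<^sup>2 \<noteq> 0" by simp
      ultimately show "v (zt t) * ((1 - Re (zt t)) / 2) = c (zt t) * (Im (zt t) / 2)"
        by (metis mult_right_cancel)
    qed
    from this[of "- 1"] v(2) show False by simp
  qed
qed

text \<open>With a smaller degree, subtracting c (1 + y^2)^d would leave a nonnegative polynomial in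
  y with leading coefficient -c.\<close>

lemma lower_bound_imp_degree:
  fixes P :: "real poly poly"
  assumes "degree P \<le> 2 * d" "c > 0" "\<And>y. c * (1 + y\<^sup>2) ^ d \<le> ev2 P t y"
  shows "degree P = 2 * d"
proof (rule ccontr)
  assume "degree P \<noteq> 2 * d"
  then have "degree P < 2 * d" using assms(1) by simp
  define W where "W = ([:1, 0, 1:] ^ d :: real poly)"
  have dW: "degree W = 2 * d" by (simp add: W_def degree_power_eq mult.commute)
  have lW: "lead_coeff W = 1" by (simp add: W_def lead_coeff_power)
  define p where "p = map_poly (\<lambda>a. poly a t) P - smult c W"
  have cp: "coeff p (2 * d) = - c"
    using \<open>degree P < 2 * d\<close> lW by (simp add: p_def coeff_map_poly coeff_eq_0 dW)
  have "degree p \<le> 2 * d"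
  proof (rule degree_le, intro allI impI)
    fix i assume i: "2 * d < i"
    have "coeff W i = 0" by (rule coeff_eq_0) (simp add: dW i)
    moreover have "coeff P i = 0" by (rule coeff_eq_0) (use i \<open>degree P < 2 * d\<close> in linarith)
    ultimately show "coeff p i = 0" by (simp add: p_def coeff_map_poly)
  qed
  moreover have "2 * d \<le> degree p" by (rule le_degree) (use cp assms(2) in simp)
  ultimately have "lead_coeff p = - c" using cp by simp
  moreover have "poly p y \<ge> 0" for y
  proof -
    have "poly W y = (1 + y\<^sup>2) ^ d" unfolding W_def by (simp only: poly_power poly_weight)
    then show ?thesis using assms(3)[of y] by (simp add: p_def ev2_poly)
  qed
  ultimately show False using nonneg_poly_even_degree(2)[of p] assms(2) by simp
qed

text \<open>Reducing the coefficients modulo \<open>W\<close> bounds their t-degrees, which is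
  needed to turn u and v back into cylinder functions.\<close>

lemma two_squares_mod_reduced:
  fixes P :: "real poly poly"
  assumes "[:W:] dvd P - (u\<^sup>2 + v\<^sup>2)" "degree u \<le> d" "degree v \<le> d" "W \<noteq> 0"
  obtains u' v' Q where "P = u'\<^sup>2 + v'\<^sup>2 + [:W:] * Q" "degree u' \<le> d" "degree v' \<le> d"
    "\<And>j. degree (coeff u' j) \<le> degree W" "\<And>j. degree (coeff v' j) \<le> degree W"
proof -
  define red where "red = map_poly (\<lambda>a. a mod W)"
  have c: "coeff (red x) j = coeff x j mod W" for x j by (simp add: red_def coeff_map_poly)
  have d1: "[:W:] dvd x - red x" for x
    by (simp add: const_poly_dvd_iff c minus_mod_eq_mult_div)
  have d2: "degree (coeff (red x) j) \<le> degree W" for x j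
    using degree_mod_less[OF \<open>W \<noteq> 0\<close>, of "coeff x j"] by (auto simp: c)
  have d3: "degree (red x) \<le> d" if "degree x \<le> d" for x
  proof (rule degree_le, intro allI impI)
    fix i assume "d < i"
    then have "coeff x i = 0" using that by (intro coeff_eq_0) linarith
    then show "coeff (red x) i = 0" by (simp add: c)
  qed
  have sq: "[:W:] dvd x\<^sup>2 - (red x)\<^sup>2" for x
  proof -
    have "x\<^sup>2 - (red x)\<^sup>2 = (x - red x) * (x + red x)" by (simp add: power2_eq_square algebra_simps)
    then show ?thesis using d1[of x] by simp
  qed
  have "P - ((red u)\<^sup>2 + (red v)\<^sup>2) = (P - (u\<^sup>2 + v\<^sup>2)) + (u\<^sup>2 - (red u)\<^sup>2) + (v\<^sup>2 - (red v)\<^sup>2)" by simp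
  then have "[:W:] dvd P - ((red u)\<^sup>2 + (red v)\<^sup>2)" using assms(1) sq by (simp only: dvd_add)
  then obtain Q where "P - ((red u)\<^sup>2 + (red v)\<^sup>2) = [:W:] * Q" by blast
  then have "P = (red u)\<^sup>2 + (red v)\<^sup>2 + [:W:] * Q" by (simp add: algebra_simps)
  then show ?thesis using that d2 d3 assms(2,3) by blast
qed

lemma degree_coeff_square:
  fixes u :: "real poly poly"
  assumes "\<And>j. degree (coeff u j) \<le> n"
  shows "degree (coeff (u\<^sup>2) j) \<le> 2 * n"
  unfolding power2_eq_square coeff_mult
proof (rule degree_sum_le)
  fix i assume "i \<in> {..j}"
  show "degree (coeff u i * coeff u (j - i)) \<le> 2 * n"
    using degree_mult_le[of "coeff u i" "coeff u (j - i)"] assms[of i] assms[of "j - i"] by linarith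
qed simp

text \<open>By the geometric sum, s times the sum of (1 - s)^i over i <= K is at most 1, and each of
  its K + 1 terms is at least s (1 - s)^K.\<close>

lemma bump_bound:
  fixes s :: real
  assumes "0 \<le> s" "s \<le> 1"
  shows "real (Suc K) * (s * (1 - s) ^ K) \<le> 1"
proof -
  have "real (Suc K) * (1 - s) ^ K = (\<Sum>i<Suc K. (1 - s) ^ K)" by simp
  also have "\<dots> \<le> (\<Sum>i<Suc K. (1 - s) ^ i)"
    using assms by (intro sum_mono power_decreasing) auto
  finally have "s * (real (Suc K) * (1 - s) ^ K) \<le> s * (\<Sum>i<Suc K. (1 - s) ^ i)"
    using assms by (intro mult_left_mono)
  also have "\<dots> = 1 - (1 - s) ^ Suc K" using one_diff_power_eq[of "1 - s" "Suc K"] by simp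
  also have "\<dots> \<le> 1" using assms by simp
  finally show ?thesis by (simp add: mult_ac)
qed

text \<open>One half of \<open>\<epsilon>\<close> makes the cofactor \<open>k\<close> of A
  nonnegative in spite of Q, the other half is spent on the approximation in
  \<open>sosC_nonneg_plus_eps\<close>.\<close>

lemma sosC_combine:
  assumes f1: "cyl (2 * d) f1" and Q: "cyl (2 * d) Q" and A: "rpf A" and uv: "cyl n u" "cyl n' v"
    and A0: "\<And>z. norm z = 1 \<Longrightarrow> A z \<ge> 0" and f10: "\<And>z y. norm z = 1 \<Longrightarrow> f1 z y \<ge> 0" and "\<epsilon> > 0"
    and eq: "\<And>z y. norm z = 1 \<Longrightarrow> f1 z y = (u z y)\<^sup>2 + (v z y)\<^sup>2 + (A z)\<^sup>2 * Q z y"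
  shows "sosC (\<lambda>z y. f1 z y + \<epsilon> * A z * (1 + y\<^sup>2) ^ d)"
proof -
  obtain B where B: "B > 0" "\<And>z. norm z = 1 \<Longrightarrow> \<bar>A z\<bar> \<le> B" using rpf_bounded_circle[OF A] by blast
  obtain C where C: "C > 0" "\<And>z y. norm z = 1 \<Longrightarrow> \<bar>Q z y\<bar> \<le> C * (1 + y\<^sup>2) ^ d" using cyl_bound[OF Q] by blast
  \<comment> \<open>With s = A / B in [0, 1], \<open>bump_bound\<close> gives A
    \<open>\<phi>\<close> C <= B C / (K + 1), which this K brings below \<open>\<epsilon>\<close> /
    2.\<close>
  obtain K :: nat where K: "2 * B * C / \<epsilon> < real K" using reals_Archimedean2 by blast
  define s where "s z = A z / B" for z
  define \<phi> where "\<phi> z = (1 - s z) ^ K" for z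
  \<comment> \<open>The quotient (1 - \<open>\<phi>\<close>) / A written as a geometric sum: a
    polynomial, nonnegative on the circle.\<close>
  define \<chi> where "\<chi> z = (\<Sum>i<K. (1 - s z) ^ i) / B" for z
  have rs: "rpf s" unfolding s_def by (intro rpf_intros A)
  have r\<phi>: "rpf \<phi>" unfolding \<phi>_def by (intro rpf_intros rs)
  have r\<chi>: "rpf \<chi>" unfolding \<chi>_def by (intro rpf_intros rs finite_lessThan)
  have s01: "0 \<le> s z" "s z \<le> 1" if "norm z = 1" for z
    using A0[OF that] B(1) B(2)[OF that] by (simp_all add: s_def)
  have \<phi>0: "\<phi> z \<ge> 0" if "norm z = 1" for z using s01[OF that] by (simp add: \<phi>_def)
  have \<chi>0: "\<chi> z \<ge> 0" if "norm z = 1" for z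
    unfolding \<chi>_def using s01[OF that] B(1) by (intro divide_nonneg_pos sum_nonneg) auto
  have A\<chi>: "A z * \<chi> z = 1 - \<phi> z" for z
  proof -
    have "A z * \<chi> z = s z * (\<Sum>i<K. (1 - s z) ^ i)" by (simp add: \<chi>_def s_def)
    also have "\<dots> = 1 - \<phi> z" using one_diff_power_eq[of "1 - s z" K] by (simp add: \<phi>_def)
    finally show ?thesis .
  qed
  have small: "A z * \<phi> z * C \<le> \<epsilon> / 2" if "norm z = 1" for z
  proof -
    have "real K * (s z * \<phi> z) \<le> real (Suc K) * (s z * \<phi> z)"
      using s01[OF that] \<phi>0[OF that] by (intro mult_right_mono) auto
    also have "\<dots> \<le> 1" unfolding \<phi>_def by (rule bump_bound[OF s01[OF that]])
    finally have K1: "real K * (s z * \<phi> z) \<le> 1" .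
    have "2 * B * C / \<epsilon> * (s z * \<phi> z) \<le> real K * (s z * \<phi> z)"
      using K s01[OF that] \<phi>0[OF that] by (intro mult_right_mono) auto
    with K1 have "2 * B * C / \<epsilon> * (s z * \<phi> z) \<le> 1" by linarith
    then have "2 * B * C * (s z * \<phi> z) \<le> \<epsilon>" using \<open>\<epsilon> > 0\<close> by (simp add: pos_divide_le_eq)
    moreover have "B * s z = A z" using B(1) by (simp add: s_def)
    then have "2 * B * C * (s z * \<phi> z) = 2 * (A z * \<phi> z * C)" by (metis (no_types, lifting) mult.assoc mult.commute)
    ultimately show ?thesis by linarith
  qed
  define k where "k z y = \<chi> z * f1 z y + (A z * \<phi> z) * Q z y + \<epsilon> / 2 * (1 + y\<^sup>2) ^ d" for z y
  have "cyl (2 * d) k"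
    unfolding k_def by (intro cyl_add cyl_scale r\<chi> f1 rpf_intros A r\<phi> Q cyl_weight)
  moreover have "k z y \<ge> 0" if z: "norm z = 1" for z y
  proof -
    have "\<bar>(A z * \<phi> z) * Q z y\<bar> \<le> (A z * \<phi> z) * (C * (1 + y\<^sup>2) ^ d)"
      unfolding abs_mult[of "A z * \<phi> z"] using A0[OF z] \<phi>0[OF z] C(2)[OF z] by (intro mult_mono) auto
    also have "\<dots> = (A z * \<phi> z * C) * (1 + y\<^sup>2) ^ d" by simp
    also have "\<dots> \<le> \<epsilon> / 2 * (1 + y\<^sup>2) ^ d" using small[OF z] by (intro mult_right_mono) auto
    finally have "\<bar>(A z * \<phi> z) * Q z y\<bar> \<le> \<epsilon> / 2 * (1 + y\<^sup>2) ^ d" .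
    moreover have "\<chi> z * f1 z y \<ge> 0" using \<chi>0[OF z] f10[OF z] by simp
    ultimately show ?thesis unfolding k_def by linarith
  qed
  ultimately have sk: "sosC (\<lambda>z y. k z y + \<epsilon> / 2 * (1 + y\<^sup>2) ^ d)"
    using \<open>\<epsilon> > 0\<close> by (intro sosC_nonneg_plus_eps) auto
  have "sosC (\<lambda>z y. \<phi> z * ((u z y)\<^sup>2 + (v z y)\<^sup>2) + A z * (k z y + \<epsilon> / 2 * (1 + y\<^sup>2) ^ d))"
    by (intro sosC_add[OF sosC_mult[OF _ sosC_add] sosC_mult[OF _ sk]] sosC_square[OF uv(1)] sosC_square[OF uv(2)]
        sosC_nonneg_rpf A r\<phi> A0 \<phi>0)
  moreover have "f1 z y + \<epsilon> * A z * (1 + y\<^sup>2) ^ d = \<phi> z * ((u z y)\<^sup>2 + (v z y)\<^sup>2) + A z * (k z y + \<epsilon> / 2 * (1 + y\<^sup>2) ^ d)"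
    if "norm z = 1" for z y
  proof -
    have "A z * (k z y + \<epsilon> / 2 * (1 + y\<^sup>2) ^ d) = (A z * \<chi> z) * f1 z y + \<phi> z * ((A z)\<^sup>2 * Q z y) + \<epsilon> * A z * (1 + y\<^sup>2) ^ d"
      by (simp add: k_def power2_eq_square distrib_left mult_ac)
    also have "\<dots> = f1 z y - \<phi> z * (f1 z y - (A z)\<^sup>2 * Q z y) + \<epsilon> * A z * (1 + y\<^sup>2) ^ d"
      unfolding A\<chi> by (simp add: left_diff_distrib right_diff_distrib)
    also have "f1 z y - (A z)\<^sup>2 * Q z y = (u z y)\<^sup>2 + (v z y)\<^sup>2" using eq[OF that, of y] by simp
    finally show ?thesis by simp
  qed
  then have "sosC (\<lambda>z y. f1 z y + \<epsilon> * A z * (1 + y\<^sup>2) ^ d) \<longleftrightarrow>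
      sosC (\<lambda>z y. \<phi> z * ((u z y)\<^sup>2 + (v z y)\<^sup>2) + A z * (k z y + \<epsilon> / 2 * (1 + y\<^sup>2) ^ d))"
    by (rule sosC_cong)
  ultimately show ?thesis by blast
qed

text \<open>Expressions by two squares near each root are glued over all roots. The order 4 k is the
  one required for divisibility by A^2, where A is \<open>\<omega>\<close> ^ (2 k) over a power of 1
  + t^2.\<close>

lemma two_squares_mod_omega:
  fixes P :: "real poly poly" and S :: "real set"
  assumes "finite S" "\<epsilon> > 0" "degree P \<le> 2 * d"
  defines "\<omega> \<equiv> \<Prod>s\<in>S. [:- s, 1:]"
  assumes bound: "\<And>t y. \<epsilon> * (poly \<omega> t)\<^sup>2 ^ k * (1 + y\<^sup>2) ^ d \<le> ev2 P t y"
  obtains u v Q where "P = u\<^sup>2 + v\<^sup>2 + [:\<omega> ^ (4 * k):] * Q" "degree u \<le> d" "degree v \<le> d"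
    "\<And>j. degree (coeff u j) \<le> 4 * k * card S" "\<And>j. degree (coeff v j) \<le> 4 * k * card S"
proof -
  have \<omega>0: "\<omega> \<noteq> 0" using assms(1) by (simp add: \<omega>_def)
  have d\<omega>: "degree \<omega> = card S" using assms(1) by (simp add: \<omega>_def degree_prod_eq_sum_degree)
  have psd: "ev2 P t y \<ge> 0" for t y
  proof -
    have "0 \<le> \<epsilon> * (poly \<omega> t)\<^sup>2 ^ k * (1 + y\<^sup>2) ^ d" using assms(2) by simp
    then show ?thesis using bound[of t y] by linarith
  qed
  obtain t0 where t0: "poly \<omega> t0 \<noteq> 0" using \<omega>0 poly_all_0_iff_0 by blast
  have deg: "degree P = 2 * d"
    by (rule lower_bound_imp_degree[OF assms(3) _ bound[of t0]]) (use t0 assms(2) in simp)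
  have loc: "\<exists>u v. [:[:- r, 1:] ^ (4 * k):] dvd P - (u\<^sup>2 + v\<^sup>2) \<and> degree u \<le> d \<and> degree v \<le> d" if "r \<in> S" for r
  proof -
    define a where "a = (\<omega>\<^sup>2 ^ k) \<circ>\<^sub>p [:r, 1:]"
    have "a \<noteq> 0" using \<omega>0 by (auto simp: a_def pcompose_eq_0_iff)
    then obtain c \<delta> j where c: "c > 0" "\<delta> > 0" "\<And>t. \<bar>t\<bar> < \<delta> \<Longrightarrow> c * \<bar>t\<bar> ^ j \<le> \<bar>poly a t\<bar>"
      using poly_lower_bound_near_0 by metis
    show ?thesis
    proof (rule local_two_squares_at[OF psd deg])
      show "\<epsilon> * c > 0" "\<delta> > 0" using c assms(2) by simp_all
      fix t y assume t: "\<bar>t - r\<bar> < \<delta>"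
      have pa: "poly a (t - r) = (poly \<omega> t)\<^sup>2 ^ k" by (simp add: a_def poly_pcompose)
      have "\<epsilon> * c * \<bar>t - r\<bar> ^ j \<le> \<epsilon> * (poly \<omega> t)\<^sup>2 ^ k"
        using c(3)[OF t] assms(2) unfolding pa by (simp add: mult.assoc)
      also have "\<dots> \<le> \<epsilon> * (poly \<omega> t)\<^sup>2 ^ k * (1 + y\<^sup>2) ^ d"
        using assms(2) one_le_power[of "1 + y\<^sup>2" d] mult_left_mono[of 1 "(1 + y\<^sup>2) ^ d" "\<epsilon> * (poly \<omega> t)\<^sup>2 ^ k"] by simp
      also have "\<dots> \<le> ev2 P t y" by (rule bound)
      finally show "\<epsilon> * c * \<bar>t - r\<bar> ^ j \<le> ev2 P t y" .
    qed
  qed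
  obtain u v where uv: "[:\<omega> ^ (4 * k):] dvd P - (u\<^sup>2 + v\<^sup>2)" "degree u \<le> d" "degree v \<le> d"
    using two_squares_mod_roots[OF assms(1) loc] unfolding \<omega>_def by blast
  have "\<omega> ^ (4 * k) \<noteq> 0" using \<omega>0 by simp
  moreover have "degree (\<omega> ^ (4 * k)) = 4 * k * card S" using \<omega>0 by (simp add: degree_power_eq d\<omega>)
  ultimately show ?thesis using two_squares_mod_reduced[OF uv] that by metis
qed

text \<open>Since v(-1) is not 0, all zeros of v on the circle have finite parameter t, so the local
  work takes place in R[t][y].\<close>

lemma sosC_of_lower_bound:
  assumes f: "cyl (2 * d) f" and v: "rpf v" "v (- 1) \<noteq> 0" and "\<epsilon> > 0"
    and bound: "\<And>z y. norm z = 1 \<Longrightarrow> \<epsilon> * (v z)\<^sup>2 * (1 + y\<^sup>2) ^ d \<le> f z y"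
  shows "sosC f"
proof -
  obtain q m where q: "degree q \<le> 2 * m" "\<And>t. v (zt t) * (1 + t\<^sup>2) ^ m = poly q t"
    using pull_poly[OF v(1)] by blast
  note q0 = pull_poly_degree_eq[OF v q]
  define S where "S = {t. poly q t = 0}"
  have S: "finite S" unfolding S_def using q0(1) by (rule poly_roots_finite)
  define \<rho> where "\<rho> t = (\<Prod>s\<in>S. (t - s)\<^sup>2 / (1 + t\<^sup>2))" for t :: real
  define \<omega> where "\<omega> = (\<Prod>s\<in>S. [:- s, 1:] :: real poly)"
  define e where "e = card S"
  have \<rho>\<omega>: "\<rho> t * (1 + t\<^sup>2) ^ e = (poly \<omega> t)\<^sup>2" and \<rho>0: "\<rho> t \<ge> 0" for t
    using weighted_root_product(1,2)[OF S] by (simp_all add: \<rho>_def \<omega>_def e_def)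
  obtain c k where c: "c > 0" "\<And>t. c * \<rho> t ^ k * (1 + t\<^sup>2) ^ degree q \<le> (poly q t)\<^sup>2"
    using poly_bound_by_roots[OF S q0(1)] unfolding \<rho>_def S_def by blast
  have pos: "(1 + t\<^sup>2) ^ n > (0::real)" "(1 + t\<^sup>2) ^ n \<noteq> (0::real)" for t n
    by (simp_all add: zero_less_power)
  have cv: "c * \<rho> t ^ k \<le> (v (zt t))\<^sup>2" for t
  proof -
    have "c * \<rho> t ^ k * (1 + t\<^sup>2) ^ (2 * m) \<le> (v (zt t))\<^sup>2 * (1 + t\<^sup>2) ^ (2 * m)"
      using c(2)[of t] by (simp only: q0(2) q(2)[symmetric] power_mult_distrib power_even_eq)
    then show ?thesis using pos(1) by (simp only: mult_le_cancel_right_pos)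
  qed
  have "degree (\<omega>\<^sup>2) = 2 * e"
    using S by (simp add: \<omega>_def e_def degree_power_eq degree_prod_eq_sum_degree)
  then obtain W where W: "rpf W" "\<And>t. W (zt t) * (1 + t\<^sup>2) ^ e = poly (\<omega>\<^sup>2) t"
    using push_poly[of "\<omega>\<^sup>2" e] by auto
  have W\<rho>: "W (zt t) = \<rho> t" for t
    using W(2)[of t] \<rho>\<omega>[of t] pos(2)[of t e] by (metis mult_right_cancel poly_power)
  have W0: "W z \<ge> 0" if "norm z = 1" for z
    by (rule circle_nonneg[OF W(1) _ that]) (simp add: W\<rho> \<rho>0)
  \<comment> \<open>A takes the place of v^2: it retains only the real roots of q, so that the
    pull-back of A^2 is a product of powers of real linear factors over a power of 1 + t^2.\<close>
  define A where "A z = W z ^ k" for z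
  have rA: "rpf A" unfolding A_def by (intro rpf_intros W(1))
  have A0: "A z \<ge> 0" if "norm z = 1" for z using W0[OF that] by (simp add: A_def)
  have Av: "c * A z \<le> (v z)\<^sup>2" if "norm z = 1" for z
  proof -
    have "(v z)\<^sup>2 - c * A z \<ge> 0"
      by (rule circle_nonneg[OF _ _ that]) (use cv in \<open>auto simp: A_def W\<rho> intro!: rpf_intros v(1) W(1)\<close>)
    then show ?thesis by simp
  qed
  define \<epsilon>1 where "\<epsilon>1 = \<epsilon> * c / 2"
  have \<epsilon>1: "\<epsilon>1 > 0" using \<open>\<epsilon> > 0\<close> c(1) by (simp add: \<epsilon>1_def)
  define f1 where "f1 z y = f z y + (- \<epsilon>1 * A z) * (1 + y\<^sup>2) ^ d" for z y
  have cf1: "cyl (2 * d) f1"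
    unfolding f1_def by (intro cyl_add f cyl_scale rpf_intros rA cyl_weight)
  have f1_ge: "\<epsilon>1 * A z * (1 + y\<^sup>2) ^ d \<le> f1 z y" if "norm z = 1" for z y
  proof -
    have "\<epsilon> * (c * A z) * (1 + y\<^sup>2) ^ d \<le> \<epsilon> * (v z)\<^sup>2 * (1 + y\<^sup>2) ^ d"
      using Av[OF that] \<open>\<epsilon> > 0\<close> by (intro mult_right_mono mult_left_mono) auto
    also have "\<dots> \<le> f z y" by (rule bound[OF that])
    finally show ?thesis by (simp add: f1_def \<epsilon>1_def)
  qed
  have f1_0: "f1 z y \<ge> 0" if "norm z = 1" for z y
  proof -
    have "0 \<le> \<epsilon>1 * A z * (1 + y\<^sup>2) ^ d" using A0[OF that] \<epsilon>1 by simp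
    then show ?thesis using f1_ge[OF that, of y] by linarith
  qed
  obtain m0 where m0: "\<And>m. m \<ge> m0 \<Longrightarrow> \<exists>P. degree P \<le> 2 * d \<and> (\<forall>j. degree (coeff P j) \<le> 2 * m) \<and>
    (\<forall>t y. f1 (zt t) y * (1 + t\<^sup>2) ^ m = ev2 P t y)"
    using pull_cyl[OF cf1] by blast
  \<comment> \<open>The exponent 2 H is even so that u and v can each be divided by (1 + t^2)^H. It
    exceeds \<open>m0\<close>, and the summand 4 k e covers the t-degrees of u and v and the
    denominator of A^2.\<close>
  define H where "H = m0 + 4 * k * e"
  have "2 * H \<ge> m0" by (simp add: H_def)
  then obtain P where P: "degree P \<le> 2 * d" "\<And>j. degree (coeff P j) \<le> 2 * (2 * H)"
    "\<And>t y. f1 (zt t) y * (1 + t\<^sup>2) ^ (2 * H) = ev2 P t y"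
    using m0 by blast
  have He: "2 * H = e * k + (2 * H - e * k)" "2 * H = 2 * k * e + (2 * H - 2 * k * e)"
    by (simp_all add: H_def mult_ac)
  have P_ge: "\<epsilon>1 * (poly \<omega> t)\<^sup>2 ^ k * (1 + y\<^sup>2) ^ d \<le> ev2 P t y" for t y
  proof -
    have "(poly \<omega> t)\<^sup>2 ^ k = A (zt t) * (1 + t\<^sup>2) ^ (e * k)"
      by (simp only: \<rho>\<omega>[symmetric] power_mult_distrib A_def W\<rho> power_mult)
    also have "\<dots> \<le> A (zt t) * (1 + t\<^sup>2) ^ (2 * H)"
      using A0[of "zt t"] He(1) by (intro mult_left_mono power_increasing) auto
    finally have "\<epsilon>1 * (poly \<omega> t)\<^sup>2 ^ k * (1 + y\<^sup>2) ^ d \<le> \<epsilon>1 * (A (zt t) * (1 + t\<^sup>2) ^ (2 * H)) * (1 + y\<^sup>2) ^ d"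
      using \<epsilon>1 by (intro mult_right_mono mult_left_mono) auto
    also have "\<dots> = \<epsilon>1 * A (zt t) * (1 + y\<^sup>2) ^ d * (1 + t\<^sup>2) ^ (2 * H)" by (simp only: mult_ac)
    also have "\<dots> \<le> f1 (zt t) y * (1 + t\<^sup>2) ^ (2 * H)"
      using f1_ge[of "zt t" y] by (intro mult_right_mono) auto
    finally show ?thesis by (simp only: P(3))
  qed
  obtain u v' Q where uvQ: "P = u\<^sup>2 + v'\<^sup>2 + [:\<omega> ^ (4 * k):] * Q" "degree u \<le> d" "degree v' \<le> d"
    "\<And>j. degree (coeff u j) \<le> 4 * k * e" "\<And>j. degree (coeff v' j) \<le> 4 * k * e"
    using two_squares_mod_omega[OF S \<epsilon>1 P(1), of k] P_ge unfolding \<omega>_def e_def by blast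
  have \<omega>0: "\<omega> ^ (4 * k) \<noteq> 0" using S by (simp add: \<omega>_def)
  have d\<omega>: "degree (\<omega> ^ (4 * k)) = 4 * k * e"
    using S by (simp add: \<omega>_def e_def degree_power_eq degree_prod_eq_sum_degree)
  have cQ: "\<omega> ^ (4 * k) * coeff Q j = coeff P j - (coeff (u\<^sup>2) j + coeff (v'\<^sup>2) j)" for j
    by (simp add: uvQ(1))
  have dQ: "degree Q \<le> 2 * d"
  proof (rule degree_le, intro allI impI)
    fix i assume i: "2 * d < i"
    have "degree (x\<^sup>2) < i" if "degree x \<le> d" for x :: "real poly poly"
      using degree_power_le[of x 2] that i by linarith
    then have "coeff (u\<^sup>2) i = 0" "coeff (v'\<^sup>2) i = 0" using uvQ(2,3) by (simp_all add: coeff_eq_0)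
    moreover have "coeff P i = 0" by (rule coeff_eq_0) (use P(1) i in linarith)
    ultimately have "\<omega> ^ (4 * k) * coeff Q i = 0" by (simp add: cQ)
    then show "coeff Q i = 0" using \<omega>0 mult_eq_0_iff by blast
  qed
  \<comment> \<open>Dividing by \<open>\<omega>\<close> ^ (4 k), of degree 4 k e, lowers the bound 4
    H by as much; this matches the power of 1 + t^2 left for Q once A^2 has taken 2 k e.\<close>
  have dQc: "degree (coeff Q j) \<le> 2 * (2 * H - 2 * k * e)" for j
  proof (cases "coeff Q j = 0")
    case False
    have "degree (coeff P j - (coeff (u\<^sup>2) j + coeff (v'\<^sup>2) j)) \<le> 2 * (2 * H)"
    proof (intro degree_diff_le degree_add_le P(2))
      show "degree (coeff (u\<^sup>2) j) \<le> 2 * (2 * H)" "degree (coeff (v'\<^sup>2) j) \<le> 2 * (2 * H)"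
        using degree_coeff_square[OF uvQ(4), of j] degree_coeff_square[OF uvQ(5), of j] by (simp_all add: H_def)
    qed
    then have "degree (\<omega> ^ (4 * k)) + degree (coeff Q j) \<le> 2 * (2 * H)"
      using degree_mult_eq[OF \<omega>0 False] unfolding cQ by simp
    then show ?thesis by (simp add: d\<omega>)
  qed simp
  have du: "degree (coeff u j) \<le> 2 * H" and dv: "degree (coeff v' j) \<le> 2 * H" for j
    using uvQ(4)[of j] uvQ(5)[of j] by (simp_all add: H_def)
  obtain U where U: "cyl d U" "\<And>t y. U (zt t) y * (1 + t\<^sup>2) ^ H = ev2 u t y"
    using push_cyl[OF du uvQ(2)] by blast
  obtain V where V: "cyl d V" "\<And>t y. V (zt t) y * (1 + t\<^sup>2) ^ H = ev2 v' t y"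
    using push_cyl[OF dv uvQ(3)] by blast
  obtain Q' where Q': "cyl (2 * d) Q'" "\<And>t y. Q' (zt t) y * (1 + t\<^sup>2) ^ (2 * H - 2 * k * e) = ev2 Q t y"
    using push_cyl[OF dQc dQ] by blast
  have eqt: "f1 (zt t) y = (U (zt t) y)\<^sup>2 + (V (zt t) y)\<^sup>2 + (A (zt t))\<^sup>2 * Q' (zt t) y" for t y
  proof -
    have w: "poly (\<omega> ^ (4 * k)) t = (A (zt t))\<^sup>2 * (1 + t\<^sup>2) ^ (2 * k * e)"
    proof -
      have "poly (\<omega> ^ (4 * k)) t = (((poly \<omega> t)\<^sup>2) ^ k)\<^sup>2"
        by (simp add: poly_power mult_ac flip: power_mult)
      also have "(poly \<omega> t)\<^sup>2 ^ k = A (zt t) * (1 + t\<^sup>2) ^ (e * k)"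
        by (simp only: \<rho>\<omega>[symmetric] power_mult_distrib A_def W\<rho> power_mult)
      also have "(A (zt t) * (1 + t\<^sup>2) ^ (e * k))\<^sup>2 = (A (zt t))\<^sup>2 * (1 + t\<^sup>2) ^ (2 * k * e)"
        by (simp add: power_mult_distrib mult_ac flip: power_mult)
      finally show ?thesis .
    qed
    have "f1 (zt t) y * (1 + t\<^sup>2) ^ (2 * H) = (ev2 u t y)\<^sup>2 + (ev2 v' t y)\<^sup>2 + poly (\<omega> ^ (4 * k)) t * ev2 Q t y"
      by (simp only: P(3) uvQ(1) ev2_add ev2_power ev2_mult ev2_const)
    also have "\<dots> = (U (zt t) y)\<^sup>2 * (1 + t\<^sup>2) ^ (2 * H) + (V (zt t) y)\<^sup>2 * (1 + t\<^sup>2) ^ (2 * H) +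
       (A (zt t))\<^sup>2 * Q' (zt t) y * ((1 + t\<^sup>2) ^ (2 * k * e) * (1 + t\<^sup>2) ^ (2 * H - 2 * k * e))"
      unfolding w U(2)[symmetric] V(2)[symmetric] Q'(2)[symmetric] power_mult_distrib power_even_eq[of _ H]
      by (simp only: mult_ac)
    also have "(1 + t\<^sup>2) ^ (2 * k * e) * (1 + t\<^sup>2) ^ (2 * H - 2 * k * e) = (1 + t\<^sup>2) ^ (2 * H)"
      using He(2) by (metis power_add)
    finally have "f1 (zt t) y * (1 + t\<^sup>2) ^ (2 * H) =
        ((U (zt t) y)\<^sup>2 + (V (zt t) y)\<^sup>2 + (A (zt t))\<^sup>2 * Q' (zt t) y) * (1 + t\<^sup>2) ^ (2 * H)"
      by (simp only: distrib_right)
    then show ?thesis using pos(2) by (metis mult_right_cancel)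
  qed
  have eq: "f1 z y = (U z y)\<^sup>2 + (V z y)\<^sup>2 + (A z)\<^sup>2 * Q' z y" if "norm z = 1" for z y
  proof (rule circle_eqI[OF _ _ _ that])
    show "rpf (\<lambda>z. f1 z y)" by (rule cyl_slice[OF cf1])
    show "rpf (\<lambda>z. (U z y)\<^sup>2 + (V z y)\<^sup>2 + (A z)\<^sup>2 * Q' z y)"
      by (intro rpf_intros rA cyl_slice[OF U(1)] cyl_slice[OF V(1)] cyl_slice[OF Q'(1)])
  qed (rule eqt)
  have "sosC (\<lambda>z y. f1 z y + \<epsilon>1 * A z * (1 + y\<^sup>2) ^ d)"
    by (rule sosC_combine[OF cf1 Q'(1) rA U(1) V(1) A0 f1_0 \<epsilon>1 eq])
  moreover have "f1 z y + \<epsilon>1 * A z * (1 + y\<^sup>2) ^ d = f z y" for z y by (simp add: f1_def)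
  ultimately show ?thesis by (simp only:)
qed

section \<open>Sums of squares on the cylinder\<close>

lemma ev2_eqI:
  assumes "\<And>t y. ev2 P t y = ev2 Q t y"
  shows "P = Q"
proof (rule ccontr)
  assume "P \<noteq> Q"
  then have "finite {x. poly (P - Q) x = 0}" by (intro poly_roots_finite) simp
  moreover have "range (\<lambda>y. [:y:]) \<subseteq> {x. poly (P - Q) x = 0}"
  proof -
    have "poly (P - Q) [:y:] = 0" for y
      using assms poly_all_0_iff_0[of "poly (P - Q) [:y:]"] by (simp add: ev2_def)
    then show ?thesis by auto
  qed
  ultimately have "finite (range (\<lambda>y::real. [:y:]))" by (rule rev_finite_subset)
  then have "finite (UNIV :: real set)" by (rule finite_imageD) (simp add: inj_on_def)
  then show False using infinite_UNIV_char_0 by blast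
qed

lemma rpf_rotate:
  assumes "rpf c"
  shows "rpf (\<lambda>z. c (a * z))"
proof -
  have "polynomial_function (\<lambda>z::complex. a * z)"
    by (rule polynomial_function_bounded_linear) (rule bounded_linear_mult_right)
  from real_polynomial_function_compose[OF this assms] show ?thesis by (simp add: o_def)
qed

lemma cyl_rotate:
  assumes "cyl n f"
  shows "cyl n (\<lambda>z. f (a * z))"
proof -
  obtain p where p: "\<And>j. rpf (\<lambda>z. coeff (p z) j)" "\<And>z. degree (p z) \<le> n" "\<And>z y. f z y = poly (p z) y"
    using assms unfolding cyl_def by blast
  show ?thesis
    by (rule cylI[where p = "\<lambda>z. p (a * z)"]) (use p rpf_rotate[OF p(1)] in auto)
qed

lemma sosC_rotate:
  assumes "norm a = 1" "sosC f"
  shows "sosC (\<lambda>z. f (a * z))"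
proof -
  obtain gs where gs: "\<forall>g\<in>set gs. \<exists>n. cyl n g" "\<forall>z y. norm z = 1 \<longrightarrow> f z y = (\<Sum>g\<leftarrow>gs. (g z y)\<^sup>2)"
    using assms(2) unfolding sosC_def by blast
  have "f (a * z) y = (\<Sum>g\<leftarrow>map (\<lambda>g z. g (a * z)) gs. (g z y)\<^sup>2)" if "norm z = 1" for z y
    using gs(2) that assms(1) by (simp add: norm_mult o_def)
  moreover have "\<exists>n. cyl n (\<lambda>z. g (a * z))" if "g \<in> set gs" for g
    using gs(1) that cyl_rotate by blast
  ultimately show ?thesis unfolding sosC_def by (intro exI[of _ "map (\<lambda>g z. g (a * z)) gs"]) auto
qed

section \<open>Introducing and cancelling powers of 1 + t^2\<close>

lemma pull_cyl_list:
  assumes "\<forall>g\<in>set gs. \<exists>n. cyl n g"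
  obtains m G where "\<And>g t y. g \<in> set gs \<Longrightarrow> g (zt t) y * (1 + t\<^sup>2) ^ m = ev2 (G g) t y"
proof -
  have "\<exists>m0. \<forall>m\<ge>m0. \<exists>G. \<forall>t y. g (zt t) y * (1 + t\<^sup>2) ^ m = ev2 G t y" if g: "g \<in> set gs" for g
  proof -
    obtain n where "cyl n g" using assms g by blast
    then obtain m0 where "\<And>m. m \<ge> m0 \<Longrightarrow> \<exists>P. degree P \<le> n \<and> (\<forall>j. degree (coeff P j) \<le> 2 * m) \<and>
        (\<forall>t y. g (zt t) y * (1 + t\<^sup>2) ^ m = ev2 P t y)"
      using pull_cyl by blast
    then show ?thesis by (intro exI[of _ m0]) blast
  qed
  then have "\<forall>g\<in>set gs. \<exists>m0. \<forall>m\<ge>m0. \<exists>G. \<forall>t y. g (zt t) y * (1 + t\<^sup>2) ^ m = ev2 G t y" by blast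
  from bchoice[OF this] obtain \<mu> where
    \<mu>: "\<And>g m. g \<in> set gs \<Longrightarrow> m \<ge> \<mu> g \<Longrightarrow> \<exists>G. \<forall>t y. g (zt t) y * (1 + t\<^sup>2) ^ m = ev2 G t y"
    by blast
  define m where "m = (\<Sum>g\<in>set gs. \<mu> g)"
  have "\<mu> g \<le> m" if "g \<in> set gs" for g unfolding m_def using that by (intro member_le_sum) auto
  then have "\<exists>G. \<forall>t y. g (zt t) y * (1 + t\<^sup>2) ^ m = ev2 G t y" if "g \<in> set gs" for g
    using \<mu> that by blast
  then have "\<forall>g\<in>set gs. \<exists>G. \<forall>t y. g (zt t) y * (1 + t\<^sup>2) ^ m = ev2 G t y" by blast
  from bchoice[OF this] show ?thesis using that by blast
qed

lemma ev2_sum_list_squares: "ev2 (\<Sum>g\<leftarrow>gs. g\<^sup>2) t y = (\<Sum>g\<leftarrow>gs. (ev2 g t y)\<^sup>2)"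
  by (induction gs) simp_all

abbreviation wt :: "real poly" where "wt \<equiv> [:1, 0, 1:]"

lemma ev2_wt: "ev2 [:wt ^ N:] t y = (1 + t\<^sup>2) ^ N"
  by (simp only: ev2_const poly_power poly_weight)

lemma sosC_imp_weighted_sos:
  assumes "sosC f" "\<And>t y. f (zt t) y * (1 + t\<^sup>2) ^ m1 = ev2 P t y"
  shows "\<exists>N gs. [:wt ^ N:] * P = (\<Sum>g\<leftarrow>gs. g\<^sup>2)"
proof -
  obtain gs where gs: "\<forall>g\<in>set gs. \<exists>n. cyl n g" "\<forall>z y. norm z = 1 \<longrightarrow> f z y = (\<Sum>g\<leftarrow>gs. (g z y)\<^sup>2)"
    using assms(1) unfolding sosC_def by blast
  obtain m G where G: "\<And>g t y. g \<in> set gs \<Longrightarrow> g (zt t) y * (1 + t\<^sup>2) ^ m = ev2 (G g) t y"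
    using pull_cyl_list[OF gs(1)] by blast
  define Gs where "Gs = map G gs"
  \<comment> \<open>P already carries the exponent m1; a further m1 makes the total 2 m + 2 m1 even,
    whatever the parity of m1.\<close>
  have "[:wt ^ (2 * m + m1):] * P = (\<Sum>g\<leftarrow>map (\<lambda>G. [:wt ^ m1:] * G) Gs. g\<^sup>2)"
  proof (rule ev2_eqI)
    fix t y :: real
    define T where "T = 1 + t\<^sup>2"
    have "(\<Sum>g\<leftarrow>Gs. (ev2 g t y)\<^sup>2) = (\<Sum>g\<leftarrow>gs. (g (zt t) y)\<^sup>2 * (T ^ m)\<^sup>2)"
      unfolding Gs_def map_map
      by (intro arg_cong[where f = sum_list] map_cong refl)
        (simp add: G[symmetric] T_def power_mult_distrib)
    also have "\<dots> = (\<Sum>g\<leftarrow>gs. (g (zt t) y)\<^sup>2) * (T ^ m)\<^sup>2"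
      by (rule sum_list_mult_const)
    also have "\<dots> = f (zt t) y * (T ^ m)\<^sup>2" using gs(2) by simp
    finally have sumG: "(\<Sum>g\<leftarrow>Gs. (ev2 g t y)\<^sup>2) = f (zt t) y * (T ^ m)\<^sup>2" .
    have "ev2 (\<Sum>g\<leftarrow>map (\<lambda>G. [:wt ^ m1:] * G) Gs. g\<^sup>2) t y = (\<Sum>g\<leftarrow>Gs. (T ^ m1)\<^sup>2 * (ev2 g t y)\<^sup>2)"
      unfolding ev2_sum_list_squares by (simp only: map_map o_def ev2_mult ev2_wt power_mult_distrib T_def)
    also have "\<dots> = (T ^ m1)\<^sup>2 * (f (zt t) y * (T ^ m)\<^sup>2)"
      by (simp only: sum_list_const_mult sumG)
    also have "\<dots> = T ^ (2 * m + m1) * (f (zt t) y * T ^ m1)"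
      unfolding power_add power_even_eq power2_eq_square[of "T ^ m1"] by (simp only: mult_ac)
    also have "\<dots> = ev2 ([:wt ^ (2 * m + m1):] * P) t y"
      by (simp only: ev2_mult ev2_wt assms(2)[symmetric] T_def)
    finally show "ev2 ([:wt ^ (2 * m + m1):] * P) t y = ev2 (\<Sum>g\<leftarrow>map (\<lambda>G. [:wt ^ m1:] * G) Gs. g\<^sup>2) t y" ..
  qed
  then show ?thesis by blast
qed

lemma psd_weighted_sos:
  fixes P :: "real poly poly"
  assumes "\<And>t y. ev2 P t y \<ge> 0"
  shows "\<exists>N gs. [:wt ^ N:] * P = (\<Sum>g\<leftarrow>gs. g\<^sup>2)"
  using assms
proof (induction "degree P" arbitrary: P rule: less_induct)
  case less
  show ?case
  proof (cases "degree P = 0")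
    case True
    then obtain a where a: "P = [:a:]" by (auto elim: degree_eq_zeroE)
    then obtain q r where qr: "a = q\<^sup>2 + r\<^sup>2"
      using nonneg_poly_two_squares[of a] less.prems by auto
    have "[:wt ^ 0:] * P = (\<Sum>g\<leftarrow>[[:q:], [:r:]]. g\<^sup>2)"
      by (simp add: a qr power2_eq_square)
    then show ?thesis by blast
  next
    case False
    then have P0: "degree P > 0" "P \<noteq> 0" by auto
    show ?thesis
    proof (cases "\<exists>p. degree p > 0 \<and> p\<^sup>2 dvd P")
      case True
      then obtain p P' where p: "degree p > 0" "P = p\<^sup>2 * P'" by blast
      have "p \<noteq> 0" "P' \<noteq> 0" using P0 p by auto
      then have "degree P = degree (p\<^sup>2) + degree P'" unfolding p(2) by (intro degree_mult_eq) auto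
      then have "degree P' < degree P" using p(1) \<open>p \<noteq> 0\<close> by (simp add: degree_power_eq)
      moreover have "ev2 P' t y \<ge> 0" for t y
        by (rule psd_divide_square[OF _ \<open>p \<noteq> 0\<close>]) (use less.prems p(2) in simp)
      ultimately obtain N gs where N: "[:wt ^ N:] * P' = (\<Sum>g\<leftarrow>gs. g\<^sup>2)"
        using less.hyps by blast
      have "[:wt ^ N:] * P = p\<^sup>2 * ([:wt ^ N:] * P')" unfolding p(2) by (simp only: mult_ac)
      also have "\<dots> = (\<Sum>g\<leftarrow>map (\<lambda>g. p * g) gs. g\<^sup>2)"
        by (simp only: N map_map o_def power_mult_distrib sum_list_const_mult)
      finally show ?thesis by blast
    next
      case False
      have sqf: "\<not> p\<^sup>2 dvd P" if "degree p > 0" for p using False that by blast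
      from squarefree_bezout[OF P0(1) sqf]
      obtain A B r where bez: "A * P + B * pderiv P = [:r:]" "r \<noteq> 0" by blast
      obtain d where d: "degree P = 2 * d" using psd_lead_coeff(2)[OF less.prems] by blast
      then have "d > 0" using P0 by simp
      obtain \<epsilon> w \<kappa> where \<epsilon>: "\<epsilon> > 0" and w: "w \<noteq> 0"
        and loj: "\<And>t y. \<epsilon> * (poly w t)\<^sup>2 * (1 + y\<^sup>2) ^ d \<le> ev2 P t y * (1 + t\<^sup>2) ^ \<kappa>"
        using lojasiewicz_bound[OF less.prems d \<open>d > 0\<close> bez] by blast
      define m1 where "m1 = (\<Sum>j\<le>degree P. degree (coeff P j))"
      have m1: "degree (coeff P j) \<le> 2 * m1" for j
      proof (cases "j \<le> degree P")
        case True
        then have "degree (coeff P j) \<le> m1" unfolding m1_def by (intro member_le_sum) auto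
        then show ?thesis by simp
      qed (simp add: coeff_eq_0)
      obtain f where f: "cyl (2 * d) f" "\<And>t y. f (zt t) y * (1 + t\<^sup>2) ^ m1 = ev2 P t y"
        using push_cyl[OF m1, of "2 * d"] d by auto
      \<comment> \<open>Besides deg w <= 2 mv this gives m1 + \<open>\<kappa>\<close> <= 2 mv, which
        lets the inequality pass from P to f after division by powers of 1 + t^2.\<close>
      define mv where "mv = degree w + m1 + \<kappa>"
      have "degree w \<le> 2 * mv" by (simp add: mv_def)
      then obtain v where v: "rpf v" "\<And>t. v (zt t) * (1 + t\<^sup>2) ^ mv = poly w t"
        using push_poly by blast
      have low: "\<epsilon> * (v z)\<^sup>2 * (1 + y\<^sup>2) ^ d \<le> f z y" if "norm z = 1" for z y
      proof -
        have "f z y - \<epsilon> * (v z)\<^sup>2 * (1 + y\<^sup>2) ^ d \<ge> 0"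
        proof (rule circle_nonneg[OF _ _ that])
          show "rpf (\<lambda>z. f z y - \<epsilon> * (v z)\<^sup>2 * (1 + y\<^sup>2) ^ d)"
            by (intro rpf_intros cyl_slice[OF f(1)] v(1))
          fix t :: real
          define T where "T = 1 + t\<^sup>2"
          have T1: "T \<ge> 1" by (simp add: T_def)
          have "\<epsilon> * (v (zt t))\<^sup>2 * (1 + y\<^sup>2) ^ d * T ^ (m1 + \<kappa>) \<le> \<epsilon> * (v (zt t))\<^sup>2 * (1 + y\<^sup>2) ^ d * T ^ (2 * mv)"
            using T1 \<epsilon> by (intro mult_left_mono power_increasing) (auto simp: mv_def)
          also have "\<dots> = \<epsilon> * (poly w t)\<^sup>2 * (1 + y\<^sup>2) ^ d"
            unfolding v(2)[symmetric] T_def power_mult_distrib power_even_eq by (simp only: mult_ac)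
          also have "\<dots> \<le> ev2 P t y * T ^ \<kappa>" using loj by (simp add: T_def)
          also have "\<dots> = f (zt t) y * T ^ (m1 + \<kappa>)"
            by (simp only: f(2)[symmetric] T_def power_add mult_ac)
          finally have "\<epsilon> * (v (zt t))\<^sup>2 * (1 + y\<^sup>2) ^ d \<le> f (zt t) y"
            using T1 by (simp add: mult_le_cancel_right_pos)
          then show "f (zt t) y - \<epsilon> * (v (zt t))\<^sup>2 * (1 + y\<^sup>2) ^ d \<ge> 0" by simp
        qed
        then show ?thesis by simp
      qed
      obtain t0 where "poly w t0 \<noteq> 0" using w poly_all_0_iff_0 by blast
      then have v0: "v (zt t0) \<noteq> 0" using v(2)[of t0] by auto
      \<comment> \<open>The rotation taking -1 to \<open>zt t0\<close>, where v does not vanish;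
        \<open>cnj a\<close> undoes it afterwards.\<close>
      define a where "a = - zt t0"
      have na: "norm a = 1" by (simp add: a_def)
      have "sosC (\<lambda>z. f (a * z))"
      proof (rule sosC_of_lower_bound[where v = "\<lambda>z. v (a * z)" and \<epsilon> = \<epsilon> and d = d])
        show "cyl (2 * d) (\<lambda>z. f (a * z))" by (rule cyl_rotate[OF f(1)])
        show "rpf (\<lambda>z. v (a * z))" by (rule rpf_rotate[OF v(1)])
        show "v (a * - 1) \<noteq> 0" using v0 by (simp add: a_def)
        show "\<epsilon> * (v (a * z))\<^sup>2 * (1 + y\<^sup>2) ^ d \<le> f (a * z) y" if "norm z = 1" for z y
          by (rule low) (simp add: norm_mult na that)
      qed (rule \<epsilon>)
      then have "sosC (\<lambda>z. f (a * (cnj a * z)))"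
        using sosC_rotate[of "cnj a" "\<lambda>z. f (a * z)"] na by simp
      moreover have "a * (cnj a * z) = z" for z
        using na complex_norm_square[of a] by (simp flip: mult.assoc)
      ultimately have "sosC f" by simp
      then show ?thesis by (rule sosC_imp_weighted_sos) (rule f(2))
    qed
  qed
qed

lemma weighted_sos_Suc:
  "[:wt:] * (\<Sum>g\<leftarrow>gs. g\<^sup>2) = (\<Sum>g\<leftarrow>gs @ map (\<lambda>g. [:[:0, 1:]:] * g) gs. g\<^sup>2)"
proof -
  have "[:wt:] = 1 + [:[:0, 1:]:]\<^sup>2" by (simp add: power2_eq_square one_pCons)
  then have "[:wt:] * (\<Sum>g\<leftarrow>gs. g\<^sup>2) = (\<Sum>g\<leftarrow>gs. g\<^sup>2) + [:[:0, 1:]:]\<^sup>2 * (\<Sum>g\<leftarrow>gs. g\<^sup>2)"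
    by (simp only: distrib_right mult_1)
  then show ?thesis
    by (simp only: map_append sum_list_append map_map o_def power_mult_distrib sum_list_const_mult)
qed

lemma degree_le_of_square_bound:
  fixes q :: "real poly"
  assumes "\<And>t. (poly q t)\<^sup>2 \<le> B * (1 + t\<^sup>2) ^ n"
  shows "degree q \<le> n"
proof (rule ccontr)
  assume "\<not> degree q \<le> n"
  then have n: "n < degree q" "q \<noteq> 0" by auto
  define p where "p = smult B (wt ^ n) - q\<^sup>2"
  have dq: "degree (q\<^sup>2) = 2 * degree q" using n(2) by (simp add: degree_power_eq)
  have dw: "degree (smult B (wt ^ n)) < degree (q\<^sup>2)"
    using degree_smult_le[of B "wt ^ n"] n(1) by (simp add: dq degree_power_eq)
  have "degree p = degree (q\<^sup>2)"
    unfolding p_def using degree_add_eq_right[of "smult B (wt ^ n)" "- q\<^sup>2"] dw by simp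
  moreover have "coeff (smult B (wt ^ n)) (degree (q\<^sup>2)) = 0" using dw by (rule coeff_eq_0)
  ultimately have "lead_coeff p = - lead_coeff (q\<^sup>2)" by (simp only: p_def coeff_diff diff_0)
  also have "\<dots> = - (lead_coeff q)\<^sup>2" by (simp add: lead_coeff_power)
  finally have "lead_coeff p < 0" using n(2) by simp
  moreover have "poly p t \<ge> 0" for t
    using assms[of t] by (simp only: p_def poly_diff poly_smult poly_power poly_weight)
  ultimately show False using nonneg_poly_even_degree(2)[of p] by simp
qed

text \<open>The coefficient of t^k is a polynomial in y; it vanishes for all y when k > n, hence is
  0.\<close>

lemma degree_coeff_le_of_slices:
  fixes g :: "real poly poly"
  assumes "\<And>y. degree (poly g [:y:]) \<le> n"
  shows "degree (coeff g j) \<le> n"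
proof (rule degree_le, intro allI impI)
  fix k assume "n < k"
  have slice: "poly (map_poly (\<lambda>a. coeff a k) g) y = coeff (poly g [:y:]) k" for y
    by (induction g) (simp_all add: map_poly_pCons)
  have "poly (map_poly (\<lambda>a. coeff a k) g) y = 0" for y
    unfolding slice using assms[of y] \<open>n < k\<close> by (intro coeff_eq_0) linarith
  then have "map_poly (\<lambda>a. coeff a k) g = 0" using poly_all_0_iff_0 by blast
  then have "coeff (map_poly (\<lambda>a. coeff a k) g) j = 0" by simp
  then show "coeff (coeff g j) k = 0" by (simp add: coeff_map_poly)
qed

text \<open>For fixed y, f is bounded on the compact circle, so every summand satisfies g^2 <= B (1
  + t^2)^(2 h). Hence g has t-degree at most 2 h, g / (1 + t^2)^h is a cylinder function, and the
  denominators cancel.\<close>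

lemma weighted_sos_imp_sosC:
  assumes f: "cyl n f" and eq: "\<And>t y. f (zt t) y * (1 + t\<^sup>2) ^ (2 * h) = (\<Sum>g\<leftarrow>gs. (ev2 g t y)\<^sup>2)"
  shows "sosC f"
proof -
  have deg: "degree (coeff g j) \<le> 2 * h" if g: "g \<in> set gs" for g j
  proof (rule degree_coeff_le_of_slices)
    fix y :: real
    obtain B where B: "B > 0" "\<And>z. norm z = 1 \<Longrightarrow> \<bar>f z y\<bar> \<le> B"
      using rpf_bounded_circle[OF cyl_slice[OF f]] by blast
    show "degree (poly g [:y:]) \<le> 2 * h"
    proof (rule degree_le_of_square_bound[where B = B])
      fix t :: real
      have "(poly (poly g [:y:]) t)\<^sup>2 \<le> (\<Sum>g\<leftarrow>gs. (ev2 g t y)\<^sup>2)"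
        unfolding ev2_def[symmetric] using g by (intro member_le_sum_list) auto
      also have "\<dots> = f (zt t) y * (1 + t\<^sup>2) ^ (2 * h)" by (rule eq[symmetric])
      also have "\<dots> \<le> B * (1 + t\<^sup>2) ^ (2 * h)"
        using B(2)[of "zt t"] by (intro mult_right_mono) auto
      finally show "(poly (poly g [:y:]) t)\<^sup>2 \<le> B * (1 + t\<^sup>2) ^ (2 * h)" .
    qed
  qed
  have "\<exists>G. cyl (degree g) G \<and> (\<forall>t y. G (zt t) y * (1 + t\<^sup>2) ^ h = ev2 g t y)" if g: "g \<in> set gs" for g
  proof -
    obtain G where "cyl (degree g) G" "\<And>t y. G (zt t) y * (1 + t\<^sup>2) ^ h = ev2 g t y"
      using push_cyl[OF deg[OF g] order.refl] by blast
    then show ?thesis by blast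
  qed
  then have "\<forall>g\<in>set gs. \<exists>G. cyl (degree g) G \<and> (\<forall>t y. G (zt t) y * (1 + t\<^sup>2) ^ h = ev2 g t y)" by blast
  from bchoice[OF this] obtain G where G: "\<And>g. g \<in> set gs \<Longrightarrow> cyl (degree g) (G g)"
    "\<And>g t y. g \<in> set gs \<Longrightarrow> G g (zt t) y * (1 + t\<^sup>2) ^ h = ev2 g t y" by blast
  have slices: "rpf (\<lambda>z. \<Sum>g\<leftarrow>xs. (G g z y)\<^sup>2)" if "set xs \<subseteq> set gs" for xs y
    using that
  proof (induction xs)
    case Nil
    show ?case using rpf_intros(1)[of 0] by simp
  next
    case (Cons g xs)
    have "rpf (\<lambda>z. G g z y)" using cyl_slice[OF G(1)] Cons.prems by simp
    then have "rpf (\<lambda>z. (G g z y)\<^sup>2 + (\<Sum>g\<leftarrow>xs. (G g z y)\<^sup>2))" using Cons by (intro rpf_intros) auto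
    then show ?case by simp
  qed
  have eqC: "f z y = (\<Sum>g\<leftarrow>gs. (G g z y)\<^sup>2)" if "norm z = 1" for z y
  proof (rule circle_eqI[OF cyl_slice[OF f] slices[OF order.refl] _ that])
    fix t :: real
    have "f (zt t) y * ((1 + t\<^sup>2) ^ h)\<^sup>2 = (\<Sum>g\<leftarrow>gs. (G g (zt t) y)\<^sup>2 * ((1 + t\<^sup>2) ^ h)\<^sup>2)"
      unfolding power_even_eq[symmetric] eq
      by (intro arg_cong[where f = sum_list] map_cong refl)
        (simp only: G(2)[symmetric] power_mult_distrib power_even_eq)
    also have "\<dots> = (\<Sum>g\<leftarrow>gs. (G g (zt t) y)\<^sup>2) * ((1 + t\<^sup>2) ^ h)\<^sup>2" by (rule sum_list_mult_const)
    finally show "f (zt t) y = (\<Sum>g\<leftarrow>gs. (G g (zt t) y)\<^sup>2)" by simp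
  qed
  have "\<forall>g\<in>set (map G gs). \<exists>n. cyl n g" using G(1) by auto
  moreover have "\<forall>z y. norm z = 1 \<longrightarrow> f z y = (\<Sum>g\<leftarrow>map G gs. (g z y)\<^sup>2)"
    using eqC by (simp add: o_def)
  ultimately show ?thesis unfolding sosC_def by blast
qed

lemma psd_cyl_sosC:
  assumes f: "cyl n f" "\<And>z y. norm z = 1 \<Longrightarrow> f z y \<ge> 0"
  shows "sosC f"
proof -
  obtain m P where P: "\<And>t y. f (zt t) y * (1 + t\<^sup>2) ^ m = ev2 P t y"
  proof -
    obtain m0 where "\<And>m. m \<ge> m0 \<Longrightarrow> \<exists>P. degree P \<le> n \<and> (\<forall>j. degree (coeff P j) \<le> 2 * m) \<and>
        (\<forall>t y. f (zt t) y * (1 + t\<^sup>2) ^ m = ev2 P t y)"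
      using pull_cyl[OF f(1)] by blast
    from this[OF order.refl] show ?thesis using that by blast
  qed
  have "ev2 P t y \<ge> 0" for t y unfolding P[symmetric] using f(2) by simp
  then obtain N gs where N: "[:wt ^ N:] * P = (\<Sum>g\<leftarrow>gs. g\<^sup>2)" using psd_weighted_sos by blast
  have eq: "f (zt t) y * (1 + t\<^sup>2) ^ (m + N) = (\<Sum>g\<leftarrow>gs. (ev2 g t y)\<^sup>2)" for t y
  proof -
    have "(\<Sum>g\<leftarrow>gs. (ev2 g t y)\<^sup>2) = (1 + t\<^sup>2) ^ N * ev2 P t y"
      by (simp only: ev2_sum_list_squares[symmetric] N[symmetric] ev2_mult ev2_wt)
    then show ?thesis by (simp only: P[symmetric] power_add mult_ac)
  qed
  show ?thesis
  proof (cases "even (m + N)")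
    case True
    then obtain h where "m + N = 2 * h" by blast
    then show ?thesis using weighted_sos_imp_sosC[OF f(1), of h gs] eq by simp
  next
    case False
    then obtain h where h: "m + N + 1 = 2 * h" by (metis even_plus_one_iff evenE)
    \<comment> \<open>An odd exponent is made even by one more factor 1 + t^2, which is itself the
      sum of squares 1^2 + t^2.\<close>
    define gs' where "gs' = gs @ map (\<lambda>g. [:[:0, 1:]:] * g) gs"
    have "f (zt t) y * (1 + t\<^sup>2) ^ (2 * h) = (\<Sum>g\<leftarrow>gs'. (ev2 g t y)\<^sup>2)" for t y
    proof -
      have "(\<Sum>g\<leftarrow>gs'. (ev2 g t y)\<^sup>2) = ev2 [:wt ^ 1:] t y * (\<Sum>g\<leftarrow>gs. (ev2 g t y)\<^sup>2)"
        by (simp only: ev2_sum_list_squares[symmetric] gs'_def weighted_sos_Suc[symmetric] ev2_mult power_one_right)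
      also have "\<dots> = (1 + t\<^sup>2) ^ 1 * (f (zt t) y * (1 + t\<^sup>2) ^ (m + N))" by (simp only: ev2_wt eq)
      also have "\<dots> = f (zt t) y * (1 + t\<^sup>2) ^ (m + N + 1)"
        unfolding power_add by (simp only: mult_ac)
      finally show ?thesis by (simp only: h)
    qed
    then show ?thesis by (rule weighted_sos_imp_sosC[OF f(1)])
  qed
qed

section \<open>Back to polynomials in three variables\<close>

lemma eval3_ev2: "eval3 p a b t = poly (map_poly (\<lambda>q. ev2 q a b) p) t"
  by (induction p) (simp_all add: eval3_def map_poly_pCons ev2_def)

lemma eval3_diff: "eval3 (p - q) a b t = eval3 p a b t - eval3 q a b t"
  by (simp add: eval3_def)

lemma eval3_sum_list_squares: "eval3 (\<Sum>g\<leftarrow>gs. g\<^sup>2) a b t = (\<Sum>g\<leftarrow>gs. (eval3 g a b t)\<^sup>2)"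
  by (induction gs) (simp_all add: eval3_def)

lemma rpf_ev2: "rpf (\<lambda>z. ev2 q (Re z) (Im z))"
proof -
  have poly: "rpf (\<lambda>z. poly c (Re z))" for c :: "real poly"
    by (induction c) (auto intro!: rpf_intros rpf_Re)
  show ?thesis
  proof (induction q)
    case 0
    show ?case using rpf_intros(1)[of 0] by simp
  next
    case (pCons c q)
    then show ?case by (auto simp: ev2_pCons intro!: rpf_intros rpf_Im poly)
  qed
qed

lemma rpf_imp_ev2:
  assumes "rpf c"
  shows "\<exists>q. \<forall>z. c z = ev2 q (Re z) (Im z)"
  using assms
proof (induction rule: real_polynomial_function.induct)
  case (linear f)
  then interpret bounded_linear f .
  have "f z = ev2 [:[:0, f 1:], [:f \<i>:]:] (Re z) (Im z)" for z
  proof -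
    have "z = Re z *\<^sub>R 1 + Im z *\<^sub>R \<i>" by (simp add: complex_eq_iff)
    then have "f z = Re z * f 1 + Im z * f \<i>" by (metis add scaleR real_scaleR_def)
    then show ?thesis by (simp add: ev2_pCons)
  qed
  then show ?case by blast
next
  case (const c)
  then show ?case by (intro exI[of _ "[:[:c:]:]"]) simp
next
  case (add f g)
  then obtain p q where "\<forall>z. f z = ev2 p (Re z) (Im z)" "\<forall>z. g z = ev2 q (Re z) (Im z)" by blast
  then show ?case by (intro exI[of _ "p + q"]) simp
next
  case (mult f g)
  then obtain p q where "\<forall>z. f z = ev2 p (Re z) (Im z)" "\<forall>z. g z = ev2 q (Re z) (Im z)" by blast
  then show ?case by (intro exI[of _ "p * q"]) simp
qed

lemma cyl_imp_eval3:
  assumes "cyl n f"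
  shows "\<exists>G. \<forall>z y. f z y = eval3 G (Re z) (Im z) y"
proof -
  obtain p where p: "\<And>j. rpf (\<lambda>z. coeff (p z) j)" "\<And>z. degree (p z) \<le> n" "\<And>z y. f z y = poly (p z) y"
    using assms unfolding cyl_def by blast
  obtain q where q: "\<And>j z. coeff (p z) j = ev2 (q j) (Re z) (Im z)"
    using rpf_imp_ev2[OF p(1)] by metis
  define G where "G = (\<Sum>j\<le>n. monom (q j) j)"
  have "map_poly (\<lambda>q. ev2 q (Re z) (Im z)) G = p z" for z
  proof (rule poly_eqI)
    fix j
    have "coeff (p z) j = 0" if "j > n" using p(2)[of z] that by (intro coeff_eq_0) linarith
    then show "coeff (map_poly (\<lambda>q. ev2 q (Re z) (Im z)) G) j = coeff (p z) j"
      by (simp add: coeff_map_poly G_def coeff_sum q[symmetric])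
  qed
  then show ?thesis by (intro exI[of _ G]) (simp add: p(3) eval3_ev2)
qed

lemma circle_division:
  fixes q :: "real poly poly"
  defines "ce \<equiv> [:[:- 1, 0, 1:], 0, 1:]"
  shows "\<exists>k r0 r1. q = ce * k + [:r0, r1:]"
proof (induction q)
  case 0
  show ?case by (intro exI[of _ 0]) simp
next
  case (pCons a q)
  then obtain k r0 r1 where "q = ce * k + [:r0, r1:]" by blast
  then have "pCons a q = ce * (pCons 0 k + [:r1:]) + [:a - [:- 1, 0, 1:] * r1, r0:]"
    by (simp add: ce_def algebra_simps)
  then show ?case by blast
qed

text \<open>Divide by the equation, which is monic in the outer variable. For |a| < 1 the points (a,
  b) and (a, -b) with b > 0 force both remainder coefficients to vanish at a, hence
  identically.\<close>

lemma circle_vanishing_dvd: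
  fixes q :: "real poly poly"
  assumes "\<And>a b. a\<^sup>2 + b\<^sup>2 = 1 \<Longrightarrow> ev2 q a b = 0"
  shows "[:[:- 1, 0, 1:], 0, 1:] dvd q"
proof -
  obtain k r0 r1 where q: "q = [:[:- 1, 0, 1:], 0, 1:] * k + [:r0, r1:]"
    using circle_division by blast
  have r: "poly r0 a + b * poly r1 a = 0" if "a\<^sup>2 + b\<^sup>2 = 1" for a b
  proof -
    have "ev2 [:[:- 1, 0, 1:], 0, 1:] a b = a\<^sup>2 + b\<^sup>2 - 1"
      by (simp add: ev2_pCons power2_eq_square)
    then have "ev2 q a b = poly r0 a + b * poly r1 a"
      unfolding q ev2_add ev2_mult by (simp add: that ev2_pCons)
    then show ?thesis using assms[OF that] by simp
  qed
  have zero: "poly r0 a = 0 \<and> poly r1 a = 0" if "a \<in> {-1<..<1}" for a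
  proof -
    define b where "b = sqrt (1 - a\<^sup>2)"
    have "a\<^sup>2 < 1" using that by (simp add: abs_square_less_1 abs_less_iff)
    then have b: "a\<^sup>2 + b\<^sup>2 = 1" "b > 0" by (simp_all add: b_def)
    then have "poly r0 a + b * poly r1 a = 0" "poly r0 a + (- b) * poly r1 a = 0"
      using r[of a b] r[of a "- b"] by simp_all
    then show ?thesis using b(2) by auto
  qed
  have "p = 0" if "\<And>a. a \<in> {-1<..<1} \<Longrightarrow> poly p a = 0" for p :: "real poly"
  proof (rule ccontr)
    assume "p \<noteq> 0"
    then have "finite {a. poly p a = 0}" by (rule poly_roots_finite)
    then have "finite {-1<..<1::real}" by (rule rev_finite_subset) (use that in auto)
    then show False using infinite_Ioo[of "-1::real" 1] by simp
  qed
  then have "r0 = 0" "r1 = 0" using zero by blast+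
  then have "[:r0, r1:] = 0" by simp
  then show ?thesis unfolding q by (simp only: add_0_right dvd_triv_left)
qed

lemma circle_eq_conv: "circle_eq = [:[:[:- 1, 0, 1:], 0, 1:]:]"
  by (simp add: circle_eq_def X1_def X2_def power2_eq_square one_pCons)

theorem theorem2:
  fixes p :: rpoly3
  assumes "\<And>a b t. a^2 + b^2 = 1 \<Longrightarrow> eval3 p a b t \<ge> 0"
  shows "sos_mod_circle p"
proof -
  define f where "f z y = eval3 p (Re z) (Im z) y" for z y
  have "cyl (degree p) f"
  proof (rule cylI[where p = "\<lambda>z. map_poly (\<lambda>q. ev2 q (Re z) (Im z)) p"])
    show "rpf (\<lambda>z. coeff (map_poly (\<lambda>q. ev2 q (Re z) (Im z)) p) j)" for j
      by (simp add: coeff_map_poly rpf_ev2)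
    show "degree (map_poly (\<lambda>q. ev2 q (Re z) (Im z)) p) \<le> degree p" for z
      by (rule degree_le) (simp add: coeff_map_poly coeff_eq_0)
  qed (simp add: f_def eval3_ev2)
  moreover have "f z y \<ge> 0" if "norm z = 1" for z y
    unfolding f_def using that by (intro assms) (simp add: cmod_def)
  ultimately obtain gs where gs: "\<forall>g\<in>set gs. \<exists>n. cyl n g"
    "\<And>z y. norm z = 1 \<Longrightarrow> f z y = (\<Sum>g\<leftarrow>gs. (g z y)\<^sup>2)"
    using psd_cyl_sosC unfolding sosC_def by blast
  then have "\<exists>G. \<forall>z y. g z y = eval3 G (Re z) (Im z) y" if "g \<in> set gs" for g
    using cyl_imp_eval3 that by blast
  then have "\<forall>g\<in>set gs. \<exists>G. \<forall>z y. g z y = eval3 G (Re z) (Im z) y" by blast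
  from bchoice[OF this] obtain G where
    G: "\<And>g z y. g \<in> set gs \<Longrightarrow> g z y = eval3 (G g) (Re z) (Im z) y" by blast
  define D where "D = p - sum_list (map (\<lambda>g. g^2) (map G gs))"
  have D0: "eval3 D a b t = 0" if ab: "a\<^sup>2 + b\<^sup>2 = 1" for a b t
  proof -
    have "norm (Complex a b) = 1" using ab by (simp add: cmod_def)
    then have "eval3 p a b t = (\<Sum>g\<leftarrow>gs. (g (Complex a b) t)\<^sup>2)"
      using gs(2)[of "Complex a b" t] by (simp add: f_def)
    also have "\<dots> = (\<Sum>g\<leftarrow>map G gs. (eval3 g a b t)\<^sup>2)"
      unfolding map_map by (intro arg_cong[where f = sum_list] map_cong refl) (simp add: G)
    finally have "eval3 p a b t = (\<Sum>g\<leftarrow>map G gs. (eval3 g a b t)\<^sup>2)" .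
    then show ?thesis unfolding D_def eval3_diff eval3_sum_list_squares by (simp only: diff_self)
  qed
  \<comment> \<open>The circle equation is constant in the outermost variable, so divisibility can
    be checked coefficientwise.\<close>
  have "[:[:- 1, 0, 1:], 0, 1:] dvd coeff D j" for j
  proof (rule circle_vanishing_dvd)
    fix a b :: real assume ab: "a\<^sup>2 + b\<^sup>2 = 1"
    have "map_poly (\<lambda>q. ev2 q a b) D = 0"
      using D0[OF ab] poly_all_0_iff_0[of "map_poly (\<lambda>q. ev2 q a b) D"] by (simp add: eval3_ev2)
    then have "coeff (map_poly (\<lambda>q. ev2 q a b) D) j = 0" by simp
    then show "ev2 (coeff D j) a b = 0" by (simp add: coeff_map_poly)
  qed
  then have "circle_eq dvd D" by (simp add: circle_eq_conv const_poly_dvd_iff)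
  then show ?thesis unfolding sos_mod_circle_def D_def by blast
qed

end
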